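(* Let $u$ be the solution of the convection-diffusion problem with large shift \[-\varepsilon u''(x)-b(x)u'(x)+c(x)u(x)+d(x)u(x-1)=f(x),\ x\in\Omega=(0,2),\qquad u(2)=0,\qquad u(x)=\Phi(x),\ x\in(-1,0],\] and let $u_N\in\mathcal U_N$ be the finite element solution, i.e. $B(u_N,v)=F(v)$ for all $v\in\mathcal U_N$, on the Durán mesh with parameter $H\in(0,1)$ (problem data, mesh, $\mathcal U_N$, $B$ and $F$ as specified in the context). Then \[\left(\varepsilon\|(u-u_N)'\|_{L^2(\Omega)}^2+\gamma\|u-u_N\|_{L^2(\Omega)}^2\right)^{1/2}\le C\,H^k ,\] where $C>0$ is a constant independent of $\varepsilon$ and of the mesh (i.e. of $H$).
   Context: Problem: $\Omega=(0,2)$, and $0<\varepsilon\ll1$ is a small perturbation parameter, $\varepsilon\in(0,1)$. The data $b,c,d$ and $f$ on $[0,2]$ and $\Phi$ on $[-1,0]$ are independent of $\varepsilon$ and smooth enough (i.e. of class $C^m$ for some sufficiently large $m$ depending only on $k$), with $b\ge\beta>0$ and $d\ge0$ for a constant $\beta$, $c+\frac{b'}{2}-\frac{\|d\|_{L^\infty(1,2)}}{2}\ge\gamma>0$ for a constant $\gamma$, and $\Phi(0)=0$. Thus $u\in H_0^1(\Omega)$, where for $x\in(0,1)$ the term $u(x-1)$ means $\Phi(x-1)$. Weak form: with $\langle\cdot,\cdot\rangle_D$ the $L^2(D)$ scalar product, for $u,v\in H_0^1(\Omega)$, \[B(u,v)=\varepsilon\langle u',v'\rangle_\Omega+\langle cu-bu',v\rangle_\Omega+\langle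 d\,u(\cdot-1),v\rangle_{(1,2)},\qquad F(v)=\langle f,v\rangle_\Omega-\langle d\,\Phi(\cdot-1),v\rangle_{(0,1)};\] the solution $u$ satisfies $B(u,v)=F(v)$ for all $v\in H_0^1(\Omega)$. Durán mesh: for $H\in(0,1)$ put \[M=\left\lceil\left\lceil\tfrac1H\right\rceil-\frac{\ln\left(H\varepsilon\lceil 1/H\rceil\right)}{\ln(1+H)}\right\rceil\] and $x_0=0$; $x_i=iH\varepsilon$ for $1\le i\le\lceil1/H\rceil$; $x_i=(1+H)x_{i-1}$ for $\lceil1/H\rceil<i\le M-1$; $x_M=1$ (this last value takes precedence for $i=M$); $x_i=1+x_{i-M}$ for $M\le i\le2M$. If $(x_{M-1},1)$ is too small in relation to $(x_{M-2},x_{M-1})$, the mesh point $x_{M-1}$ is simply omitted (the paper does not quantify "too small"; the result is understood to hold whether or not this point is omitted). The mesh cells are the intervals between consecutive mesh points. Discrete space: $k\ge1$ is a fixed integer and $\mathcal U_N=\{v\in H_0^1(\Omega): v|_\tau\in\mathcal P_k(\tau)\text{ for every mesh cell }\tau\}$, where $\mathcal P_k(\tau)$ is the space of polynomials of degree at most $k$ on $\tau$. *)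

theory Defs
  imports "HOL-Probability.Essential_Supremum" "HOL-Computational_Algebra.Polynomial"
begin

section \<open>Lebesgue and Sobolev spaces on subsets of the real line\<close>

text \<open>
  Elements of \<open>L\<^sup>2(D)\<close> are represented by functions on the whole line; only their values almost
  everywhere on \<open>D\<close> matter.
\<close>

definition L2 :: "real set \<Rightarrow> (real \<Rightarrow> real) set" where
  "L2 D = {u. u \<in> borel_measurable (lebesgue_on D) \<and> integrable (lebesgue_on D) (\<lambda>x. (u x)\<^sup>2)}"

definition ip :: "real set \<Rightarrow> (real \<Rightarrow> real) \<Rightarrow> (real \<Rightarrow> real) \<Rightarrow> real" where
  "ip D u v = (LINT x|lebesgue_on D. u x * v x)"

definition L2_norm :: "real set \<Rightarrow> (real \<Rightarrow> real) \<Rightarrow> real" where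
  "L2_norm D u = sqrt (ip D u u)"

definition Linf_norm :: "real set \<Rightarrow> (real \<Rightarrow> real) \<Rightarrow> real" where
  "Linf_norm D u = real_of_ereal (esssup (lebesgue_on D) (\<lambda>x. ereal \<bar>u x\<bar>))"

text \<open>
  Test functions are of class \<open>C\<^sup>1\<close> with compact support in the open set \<open>D\<close>, as in Brezis,
  \<^emph>\<open>Functional Analysis, Sobolev Spaces and PDEs\<close>, Section 8.2 (smooth test functions give
  the same weak derivatives and the same spaces).
\<close>

definition test_fun :: "real set \<Rightarrow> (real \<Rightarrow> real) \<Rightarrow> bool" where
  "test_fun D \<phi> \<longleftrightarrow> (\<forall>x. \<phi> differentiable (at x)) \<and> continuous_on UNIV (deriv \<phi>)
     \<and> compact (closure {x. \<phi> x \<noteq> 0}) \<and> closure {x. \<phi> x \<noteq> 0} \<subseteq> D"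

definition has_weak_deriv :: "real set \<Rightarrow> (real \<Rightarrow> real) \<Rightarrow> (real \<Rightarrow> real) \<Rightarrow> bool" where
  "has_weak_deriv D u g \<longleftrightarrow> u \<in> L2 D \<and> g \<in> L2 D
     \<and> (\<forall>\<phi>. test_fun D \<phi> \<longrightarrow> ip D u (deriv \<phi>) = - ip D g \<phi>)"

definition H1 :: "real set \<Rightarrow> (real \<Rightarrow> real) set" where
  "H1 D = {u. \<exists>g. has_weak_deriv D u g}"

text \<open>The weak derivative is only unique almost everywhere; this is one representative of it.\<close>

definition wderiv :: "real set \<Rightarrow> (real \<Rightarrow> real) \<Rightarrow> real \<Rightarrow> real" where
  "wderiv D u = (SOME g. has_weak_deriv D u g)"

definition H1_norm :: "real set \<Rightarrow> (real \<Rightarrow> real) \<Rightarrow> real" where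
  "H1_norm D u = sqrt ((L2_norm D u)\<^sup>2 + (L2_norm D (wderiv D u))\<^sup>2)"

text \<open>The closure of the test functions in \<open>H\<^sup>1(D)\<close>.\<close>

definition H01 :: "real set \<Rightarrow> (real \<Rightarrow> real) set" where
  "H01 D = {u \<in> H1 D. \<exists>\<phi>. (\<forall>n::nat. test_fun D (\<phi> n))
      \<and> (\<lambda>n. H1_norm D (\<lambda>x. u x - \<phi> n x)) \<longlonglongrightarrow> 0}"

text \<open>
  Class \<open>C\<^sup>m\<close> on a closed interval, with one-sided derivatives at its end points; values outside of
  the interval are irrelevant.
\<close>

definition Cm_on :: "nat \<Rightarrow> real set \<Rightarrow> (real \<Rightarrow> real) \<Rightarrow> bool" where
  "Cm_on m I f \<longleftrightarrow> (\<exists>g :: nat \<Rightarrow> real \<Rightarrow> real. (\<forall>x\<in>I. g 0 x = f x)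
     \<and> (\<forall>i<m. \<forall>x\<in>I. (g i has_real_derivative g (Suc i) x) (at x within I))
     \<and> continuous_on I (g m))"


section \<open>The convection-diffusion problem with shift\<close>

abbreviation \<Omega> :: "real set" where "\<Omega> \<equiv> {0<..<2}"

text \<open>The derivative of \<open>b\<close> is relative to \<open>[0,2]\<close>, hence one-sided at 0 and 2.\<close>

definition admissible_data ::
  "nat \<Rightarrow> real \<Rightarrow> real \<Rightarrow> (real \<Rightarrow> real) \<Rightarrow> (real \<Rightarrow> real) \<Rightarrow> (real \<Rightarrow> real) \<Rightarrow> (real \<Rightarrow> real)
    \<Rightarrow> (real \<Rightarrow> real) \<Rightarrow> bool" where
  "admissible_data m \<beta> \<gamma> b c d f \<Phi> \<longleftrightarrow>
     Cm_on m {0..2} b \<and> Cm_on m {0..2} c \<and> Cm_on m {0..2} d \<and> Cm_on m {0..2} f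
     \<and> Cm_on m {-1..0} \<Phi>
     \<and> \<beta> > 0 \<and> (\<forall>x\<in>{0..2}. b x \<ge> \<beta>)
     \<and> (\<forall>x\<in>{0..2}. d x \<ge> 0)
     \<and> \<gamma> > 0
     \<and> (\<forall>x\<in>{0..2}. c x + vector_derivative b (at x within {0..2}) / 2
                      - Linf_norm {1<..<2} d / 2 \<ge> \<gamma>)
     \<and> \<Phi> 0 = 0"

text \<open>
  The equation holds almost everywhere in \<open>\<Omega>\<close>, with \<open>w\<close> the weak second derivative of \<open>u\<close>. The
  boundary conditions \<open>u(0) = \<Phi>(0) = 0\<close> and \<open>u(2) = 0\<close> are encoded in \<open>u \<in> H01 \<Omega>\<close>; the history of \<open>u\<close>
  on \<open>(-1,0]\<close> enters through the shifted term only. Theorem \<open>bvp_solution_iff_weak_solution\<close> below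
  shows that this is equivalent to the weak formulation.
\<close>

definition bvp_solution ::
  "real \<Rightarrow> (real \<Rightarrow> real) \<Rightarrow> (real \<Rightarrow> real) \<Rightarrow> (real \<Rightarrow> real) \<Rightarrow> (real \<Rightarrow> real) \<Rightarrow> (real \<Rightarrow> real)
    \<Rightarrow> (real \<Rightarrow> real) \<Rightarrow> bool" where
  "bvp_solution \<epsilon> b c d f \<Phi> u \<longleftrightarrow> u \<in> H01 \<Omega>
     \<and> (\<exists>w. has_weak_deriv \<Omega> (wderiv \<Omega> u) w
          \<and> (AE x in lebesgue_on \<Omega>.
               - \<epsilon> * w x - b x * wderiv \<Omega> u x + c x * u x
                 + d x * (if x < 1 then \<Phi> (x - 1) else u (x - 1)) = f x))"

definition bilin ::
  "real \<Rightarrow> (real \<Rightarrow> real) \<Rightarrow> (real \<Rightarrow> real) \<Rightarrow> (real \<Rightarrow> real) \<Rightarrow> (real \<Rightarrow> real) \<Rightarrow> (real \<Rightarrow> real)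
    \<Rightarrow> real" where
  "bilin \<epsilon> b c d u v = \<epsilon> * ip \<Omega> (wderiv \<Omega> u) (wderiv \<Omega> v)
     + ip \<Omega> (\<lambda>x. c x * u x - b x * wderiv \<Omega> u x) v
     + ip {1<..<2} (\<lambda>x. d x * u (x - 1)) v"

definition rhs ::
  "(real \<Rightarrow> real) \<Rightarrow> (real \<Rightarrow> real) \<Rightarrow> (real \<Rightarrow> real) \<Rightarrow> (real \<Rightarrow> real) \<Rightarrow> real" where
  "rhs d f \<Phi> v = ip \<Omega> f v - ip {0<..<1} (\<lambda>x. d x * \<Phi> (x - 1)) v"

definition weak_solution ::
  "real \<Rightarrow> (real \<Rightarrow> real) \<Rightarrow> (real \<Rightarrow> real) \<Rightarrow> (real \<Rightarrow> real) \<Rightarrow> (real \<Rightarrow> real) \<Rightarrow> (real \<Rightarrow> real)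
    \<Rightarrow> (real \<Rightarrow> real) \<Rightarrow> bool" where
  "weak_solution \<epsilon> b c d f \<Phi> u \<longleftrightarrow>
     u \<in> H01 \<Omega> \<and> (\<forall>v\<in>H01 \<Omega>. bilin \<epsilon> b c d u v = rhs d f \<Phi> v)"

definition energy_norm :: "real \<Rightarrow> real \<Rightarrow> (real \<Rightarrow> real) \<Rightarrow> real" where
  "energy_norm \<epsilon> \<gamma> v = sqrt (\<epsilon> * (L2_norm \<Omega> (wderiv \<Omega> v))\<^sup>2 + \<gamma> * (L2_norm \<Omega> v)\<^sup>2)"


section \<open>Duran mesh and finite element space\<close>

definition duran_M :: "real \<Rightarrow> real \<Rightarrow> nat" where
  "duran_M H \<epsilon> = nat \<lceil>of_int \<lceil>1 / H\<rceil> - ln (H * \<epsilon> * of_int \<lceil>1 / H\<rceil>) / ln (1 + H)\<rceil>"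

fun duran_graded :: "real \<Rightarrow> real \<Rightarrow> nat \<Rightarrow> real" where
  "duran_graded H \<epsilon> 0 = 0"
| "duran_graded H \<epsilon> (Suc i) =
     (if int (Suc i) \<le> \<lceil>1 / H\<rceil> then real (Suc i) * H * \<epsilon> else (1 + H) * duran_graded H \<epsilon> i)"

definition duran_pt :: "real \<Rightarrow> real \<Rightarrow> nat \<Rightarrow> real" where
  "duran_pt H \<epsilon> i = (let M = duran_M H \<epsilon> in
     if i < M then duran_graded H \<epsilon> i
     else if i = M then 1
     else if i < 2 * M then 1 + duran_graded H \<epsilon> (i - M)
     else 2)"

text \<open>
  A mesh is given by its set of points. The point with index \<open>M - 1\<close> may be omitted (by itself, or
  together with its translate in \<open>(1,2)\<close>, which has index \<open>2 * M - 1\<close>).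
\<close>

definition duran_meshes :: "real \<Rightarrow> real \<Rightarrow> real set set" where
  "duran_meshes H \<epsilon> = (let M = duran_M H \<epsilon>; x = duran_pt H \<epsilon> in
     {x ` {0..2 * M} - P | P. P \<in> {{}, {x (M - 1)}, {x (M - 1), x (2 * M - 1)}}})"

definition cells :: "real set \<Rightarrow> real set set" where
  "cells T = {{l<..<r} | l r. l \<in> T \<and> r \<in> T \<and> l < r \<and> {l<..<r} \<inter> T = {}}"

definition fe_space :: "nat \<Rightarrow> real set \<Rightarrow> (real \<Rightarrow> real) set" where
  "fe_space k T = {v \<in> H01 \<Omega>. \<forall>\<tau>\<in>cells T. \<exists>p :: real poly. degree p \<le> k
      \<and> (AE x in lebesgue_on \<tau>. v x = poly p x)}"

definition fe_solution ::
  "nat \<Rightarrow> real set \<Rightarrow> real \<Rightarrow> (real \<Rightarrow> real) \<Rightarrow> (real \<Rightarrow> real) \<Rightarrow> (real \<Rightarrow> real) \<Rightarrow> (real \<Rightarrow> real)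
    \<Rightarrow> (real \<Rightarrow> real) \<Rightarrow> (real \<Rightarrow> real) \<Rightarrow> bool" where
  "fe_solution k T \<epsilon> b c d f \<Phi> uN \<longleftrightarrow>
     uN \<in> fe_space k T \<and> (\<forall>v\<in>fe_space k T. bilin \<epsilon> b c d uN v = rhs d f \<Phi> v)"


section \<open>Equivalence of the differential equation and its weak form\<close>

lemma pos_part_sq_deriv:
  "((\<lambda>t::real. (max 0 t)\<^sup>2) has_real_derivative 2 * max 0 t) (at t)"
proof -
  consider "t < 0" | "t > 0" | "t = 0" by linarith
  then show ?thesis
  proof cases
    case 1
    have "((\<lambda>t::real. 0) has_real_derivative 2 * max 0 t) (at t)" using 1 by simp
    moreover have "\<forall>\<^sub>F s in nhds t. (max 0 s)\<^sup>2 = (0::real)"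
      using eventually_nhds_in_open[of "{..<0}" t] 1 by (auto elim!: eventually_mono)
    ultimately show ?thesis
      by (subst DERIV_cong_ev[OF refl _ refl]) auto
  next
    case 2
    have "((\<lambda>t::real. t\<^sup>2) has_real_derivative 2 * max 0 t) (at t)"
      using 2 by (auto intro!: derivative_eq_intros)
    moreover have "\<forall>\<^sub>F s in nhds t. (max 0 s)\<^sup>2 = (s\<^sup>2::real)"
      using eventually_nhds_in_open[of "{0<..}" t] 2 by (auto elim!: eventually_mono)
    ultimately show ?thesis
      by (subst DERIV_cong_ev[OF refl _ refl]) auto
  next
    case 3
    have "(\<lambda>h. ((max 0 (0 + h))\<^sup>2 - (max 0 0)\<^sup>2) / h) = (\<lambda>h::real. max 0 h)"
      by (auto simp: fun_eq_iff max_def power2_eq_square)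
    moreover have "((\<lambda>h::real. max 0 h) \<longlongrightarrow> max 0 0) (at 0)"
      by (intro tendsto_intros)
    ultimately show ?thesis using 3 by (simp add: DERIV_def)
  qed
qed

definition bump :: "real \<Rightarrow> real \<Rightarrow> nat \<Rightarrow> real \<Rightarrow> real" where
  "bump a b n x = (let s = (max 0 (real n * ((x - a) * (b - x)) - 1))\<^sup>2 in s / (1 + s))"

lemma bump_bounds: "0 \<le> bump a b n x" "bump a b n x \<le> 1"
  by (auto simp: bump_def Let_def divide_simps add_pos_nonneg)

lemma bump_support: "bump a b n x \<noteq> 0 \<Longrightarrow> real n * ((x - a) * (b - x)) \<ge> 1"
  by (auto simp: bump_def Let_def max_def split: if_splits)

lemma bump_deriv:
  defines "q \<equiv> \<lambda>a b n x. max 0 (real n * ((x - a) * (b - x)) - 1)"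
  shows "(bump a b n has_real_derivative
    (2 * q a b n x * (real n * (a + b - 2 * x))) / (1 + (q a b n x)\<^sup>2)\<^sup>2) (at x)"
proof -
  have 1: "((\<lambda>x. real n * ((x - a) * (b - x)) - 1) has_real_derivative real n * (a + b - 2 * x)) (at x)"
    by (auto intro!: derivative_eq_intros simp: algebra_simps)
  have 2: "((\<lambda>x. (q a b n x)\<^sup>2) has_real_derivative 2 * q a b n x * (real n * (a + b - 2 * x))) (at x)"
    unfolding q_def using DERIV_chain2[OF pos_part_sq_deriv 1] by simp
  have p: "1 + (q a b n x)\<^sup>2 \<noteq> 0" by (smt (verit) zero_le_power2)
  have "((\<lambda>x. (q a b n x)\<^sup>2 / (1 + (q a b n x)\<^sup>2)) has_real_derivative
    (2 * q a b n x * (real n * (a + b - 2 * x))) / (1 + (q a b n x)\<^sup>2)\<^sup>2) (at x)"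
    using DERIV_divide[OF 2 DERIV_add[OF DERIV_const[of 1] 2] p] p
    by (simp add: power2_eq_square algebra_simps)
  then show ?thesis unfolding q_def bump_def Let_def .
qed

lemma bump_test_fun:
  assumes "{a<..<b} \<subseteq> D" "a < b"
  shows "test_fun D (bump a b n)"
proof -
  define K where "K = {x. real n * ((x - a) * (b - x)) \<ge> 1}"
  have K_sub: "K \<subseteq> {a<..<b}"
  proof
    fix x assume "x \<in> K"
    then have "real n * ((x - a) * (b - x)) > 0" by (simp add: K_def)
    then have "(x - a) * (b - x) > 0" by (simp add: zero_less_mult_iff)
    then show "x \<in> {a<..<b}" using assms(2) by (auto simp: zero_less_mult_iff)
  qed
  have "closed K" unfolding K_def by (intro closed_Collect_le continuous_intros)
  then have cl: "closure {x. bump a b n x \<noteq> 0} \<subseteq> K"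
    by (intro closure_minimal) (auto simp: K_def dest: bump_support)
  have bd: "bounded (closure {x. bump a b n x \<noteq> 0})"
    using cl K_sub by (intro bounded_subset[OF bounded_closed_interval[of a b]]) force
  have der: "deriv (bump a b n) = (\<lambda>x. (2 * max 0 (real n * ((x - a) * (b - x)) - 1) * (real n * (a + b - 2 * x)))
      / (1 + (max 0 (real n * ((x - a) * (b - x)) - 1))\<^sup>2)\<^sup>2)"
    by (rule ext) (rule DERIV_imp_deriv[OF bump_deriv])
  have "continuous_on UNIV (deriv (bump a b n))"
    unfolding der by (intro continuous_intros) (smt (verit) zero_le_power2 zero_eq_power2)
  moreover have "bump a b n differentiable (at x)" for x
    using bump_deriv real_differentiable_def by blast
  ultimately show ?thesis
    unfolding test_fun_def using cl bd K_sub assms by (auto simp: compact_eq_bounded_closed)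
qed

lemma bump_tendsto:
  assumes "a < b"
  shows "(\<lambda>n. bump a b n x) \<longlonglongrightarrow> indicat_real {a<..<b} x"
proof (cases "x \<in> {a<..<b}")
  case True
  define p where "p = (x - a) * (b - x)"
  have "p > 0" using True by (simp add: p_def)
  then have "filterlim (\<lambda>n. real n * p) at_top sequentially"
    by (intro filterlim_at_top_mult_tendsto_pos[OF tendsto_const] filterlim_real_sequentially | simp add: mult.commute)+
  then have "filterlim (\<lambda>n. -1 + real n * p) at_top sequentially"
    by (intro filterlim_tendsto_add_at_top[OF tendsto_const])
  then have f1: "filterlim (\<lambda>n. (-1 + real n * p)\<^sup>2) at_top sequentially"
    by (intro filterlim_pow_at_top) auto
  then have "filterlim (\<lambda>n. 1 + (-1 + real n * p)\<^sup>2) at_top sequentially"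
    by (intro filterlim_tendsto_add_at_top[OF tendsto_const])
  then have "(\<lambda>n. 1 - inverse (1 + (-1 + real n * p)\<^sup>2)) \<longlonglongrightarrow> 1 - 0"
    by (intro tendsto_intros tendsto_inverse_0_at_top)
  moreover have "\<forall>\<^sub>F n in sequentially. -1 + real n * p > 0"
    using \<open>filterlim (\<lambda>n. -1 + real n * p) at_top sequentially\<close> unfolding filterlim_at_top_dense by blast
  then have "\<forall>\<^sub>F n in sequentially. 1 - inverse (1 + (-1 + real n * p)\<^sup>2) = bump a b n x"
  proof (rule eventually_mono)
    fix n assume t: "-1 + real n * p > 0"
    define t where "t = -1 + real n * p"
    have "bump a b n x = t\<^sup>2 / (1 + t\<^sup>2)"
      using t by (simp add: bump_def Let_def p_def[symmetric] t_def)
    moreover have "1 + t\<^sup>2 \<noteq> 0" by (smt (verit) zero_le_power2)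
    ultimately show "1 - inverse (1 + (-1 + real n * p)\<^sup>2) = bump a b n x"
      unfolding t_def[symmetric] by (simp add: field_simps)
  qed
  ultimately show ?thesis using True by (simp add: tendsto_cong)
next
  case False
  have "bump a b n x = 0" for n
  proof (rule ccontr)
    assume "bump a b n x \<noteq> 0"
    then have "real n * ((x - a) * (b - x)) > 0" using bump_support[of a b n x] by simp
    then have "(x - a) * (b - x) > 0" by (simp add: zero_less_mult_iff)
    then show False using False assms by (auto simp: zero_less_mult_iff)
  qed
  then show ?thesis using False by simp
qed

lemma zero_on_intervals_imp_AE_zero:
  fixes g :: "real \<Rightarrow> real"
  assumes g: "integrable lborel g"
    and z: "\<And>a b. a < b \<Longrightarrow> (LINT x|lborel. indicator {a<..<b} x * g x) = 0"
  shows "AE x in lborel. g x = 0"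
proof (rule sigma_finite_measure.density_zero[OF lborel.sigma_finite_measure_axioms g])
  let ?I = "\<lambda>A. LINT x|lborel. indicator A x * g x"
  have [measurable]: "g \<in> borel_measurable lborel" using g by auto
  have int: "integrable lborel (\<lambda>x. indicator A x * g x)" if "A \<in> sets borel" for A
    using integrable_mult_indicator[of A lborel g] g that by simp
  have tot: "?I UNIV = 0"
  proof -
    have "(\<lambda>n. ?I {- real (Suc n)<..<real (Suc n)}) \<longlonglongrightarrow> ?I UNIV"
    proof (rule integral_dominated_convergence[where w = "\<lambda>x. \<bar>g x\<bar>"])
      show "AE x in lborel. (\<lambda>n. indicator {- real (Suc n)<..<real (Suc n)} x * g x) \<longlonglongrightarrow> indicator UNIV x * g x"
      proof (rule AE_I2)
        fix x :: real
        obtain N :: nat where N: "\<bar>x\<bar> < real N" using reals_Archimedean2 by blast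
        have "\<forall>\<^sub>F n in sequentially. indicator {- real (Suc n)<..<real (Suc n)} x * g x = indicator UNIV x * g x"
          using eventually_ge_at_top[of N]
          by eventually_elim (use N in \<open>auto simp: indicator_def\<close>)
        then show "(\<lambda>n. indicator {- real (Suc n)<..<real (Suc n)} x * g x) \<longlonglongrightarrow> indicator UNIV x * g x"
          by (rule tendsto_eventually)
      qed
    qed (use g in \<open>auto simp: indicator_def\<close>)
    moreover have "?I {- real (Suc n)<..<real (Suc n)} = 0" for n by (rule z) auto
    ultimately have "(\<lambda>n::nat. 0) \<longlonglongrightarrow> ?I UNIV" by (simp only:)
    then show ?thesis by (simp add: LIMSEQ_const_iff)
  qed
  have all: "?I A = 0" if "A \<in> sets borel" for A
  proof -
    have bx: "(\<lambda>(a, b). box a b) = (\<lambda>(a, b). {a<..<b::real})" by (auto simp: fun_eq_iff)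
    have eq: "sets borel = sigma_sets UNIV (range (\<lambda>(a, b). {a<..<b::real}))"
      by (subst borel_eq_box) (simp add: sets_measure_of bx)
    have "Int_stable (range (\<lambda>(a, b). {a<..<b::real}))"
      proof (rule Int_stableI)
      fix A B :: "real set"
      assume "A \<in> range (\<lambda>(a, b). {a<..<b})" "B \<in> range (\<lambda>(a, b). {a<..<b})"
      then obtain a b c d where "A = {a<..<b}" "B = {c<..<d}" by auto
      then have "A \<inter> B = (\<lambda>(a, b). {a<..<b}) (max a c, min b d)" by auto
      then show "A \<inter> B \<in> range (\<lambda>(a, b). {a<..<b})" by (rule range_eqI)
    qed
    moreover have "range (\<lambda>(a, b). {a<..<b::real}) \<subseteq> Pow UNIV" by simp
    moreover have "A \<in> sigma_sets UNIV (range (\<lambda>(a, b). {a<..<b::real}))" using that eq by simp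
    ultimately show ?thesis
    proof (induction rule: sigma_sets_induct_disjoint)
      case (basic A)
      then obtain a b where "A = {a<..<b}" by auto
      then show ?case using z[of a b] by (cases "a < b") auto
    next
      case empty then show ?case by simp
    next
      case (compl A)
      have A: "A \<in> sets borel" using compl eq by simp
      have "?I UNIV - ?I A = (LINT x|lborel. indicator UNIV x * g x - indicator A x * g x)"
        using int[OF A] int[of UNIV] by (intro Bochner_Integration.integral_diff[symmetric]) auto
      also have "\<dots> = ?I (UNIV - A)"
        by (intro Bochner_Integration.integral_cong refl) (simp split: split_indicator)
      finally have "?I (UNIV - A) = ?I UNIV - ?I A" by simp
      then show ?case using compl tot by simp
    next
      case (union A)
      have A: "A i \<in> sets borel" for i using union eq by auto
      have "?I (\<Union>i. A i) = (\<Sum>i. ?I (A i))"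
        using lebesgue_integral_countable_add[of A lborel g] union A int[of "\<Union>i. A i"]
        by (auto simp: set_lebesgue_integral_def set_integrable_def disjoint_family_on_def)
      then show ?case using union by simp
    qed
  qed
  fix A :: "real set" assume "A \<in> sets lborel"
  then show "set_lebesgue_integral lborel A g = 0"
    using all by (simp add: set_lebesgue_integral_def)
qed

lemma fundamental_lemma:
  fixes g :: "real \<Rightarrow> real" and l r :: real
  assumes g: "integrable (lebesgue_on {l<..<r}) g"
    and z: "\<And>\<phi>. test_fun {l<..<r} \<phi> \<Longrightarrow> ip {l<..<r} g \<phi> = 0"
  shows "AE x in lebesgue_on {l<..<r}. g x = 0"
proof -
  define D where "D = {l<..<r}"
  have D: "D \<in> sets lebesgue" "D \<inter> space lebesgue \<in> sets lebesgue" by (auto simp: D_def)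
  define G where "G = (\<lambda>x. indicator D x * g x)"
  have G: "integrable lebesgue G"
    using g integrable_restrict_space[OF D(2), of g] by (simp add: G_def D_def)
  then obtain g' where g': "g' \<in> borel_measurable lborel" "AE x in lborel. G x = g' x"
    using completion_ex_borel_measurable_real[of G lborel] by auto
  have ae: "AE x in lebesgue. G x = g' x" using g'(2) by (rule AE_completion)
  have g'm: "g' \<in> borel_measurable lebesgue" using g'(1) by (rule measurable_completion)
  have g'i: "integrable lebesgue g'"
    using integrable_cong_AE_imp[OF G g'm] ae by (auto elim: eventually_mono)
  then have g'il: "integrable lborel g'" using g'(1) integrable_completion by blast
  have "AE x in lborel. g' x = 0"
  proof (rule zero_on_intervals_imp_AE_zero[OF g'il])
    fix a b :: real assume "a < b"
    define a' b' where "a' = max a l" and "b' = min b r"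
    have "(LINT x|lborel. indicator {a<..<b} x * g' x) = (LINT x|lebesgue. indicator {a<..<b} x * g' x)"
      using g'(1) by (subst integral_completion) auto
    also have "\<dots> = (LINT x|lebesgue. indicator {a<..<b} x * G x)"
      using g'm G ae by (intro integral_cong_AE) (auto intro!: borel_measurable_times borel_measurable_indicator elim: eventually_mono)
    also have "\<dots> = (LINT x|lebesgue. indicator {a'<..<b'} x * G x)"
      by (intro Bochner_Integration.integral_cong) (auto simp: G_def D_def a'_def b'_def indicator_def)
    also have "\<dots> = 0"
    proof (cases "a' < b'")
      case True
      have sub: "{a'<..<b'} \<subseteq> {l<..<r}" by (auto simp: a'_def b'_def)
      have zn: "(LINT x|lebesgue. bump a' b' n x * G x) = 0" for n
      proof -
        have "0 = ip D g (bump a' b' n)"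
          using z[OF bump_test_fun[OF sub True]] by (simp add: D_def)
        also have "\<dots> = (LINT x|lebesgue. bump a' b' n x * G x)"
          unfolding ip_def by (subst integral_restrict_space[OF D(2)])
            (auto intro!: Bochner_Integration.integral_cong simp: G_def)
        finally show ?thesis by simp
      qed
      have bm: "bump a' b' n \<in> borel_measurable lebesgue" for n
        using bump_test_fun[OF sub True, of n]
        by (intro measurable_completion) (auto simp: test_fun_def intro!: borel_measurable_continuous_onI
            continuous_at_imp_continuous_on differentiable_imp_continuous_within)
      have "(\<lambda>n. LINT x|lebesgue. bump a' b' n x * G x) \<longlonglongrightarrow> (LINT x|lebesgue. indicator {a'<..<b'} x * G x)"
      proof (rule integral_dominated_convergence[where w = "\<lambda>x. \<bar>G x\<bar>"])
        show "AE x in lebesgue. (\<lambda>n. bump a' b' n x * G x) \<longlonglongrightarrow> indicator {a'<..<b'} x * G x"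
          by (intro AE_I2 tendsto_intros bump_tendsto True)
        show "AE x in lebesgue. norm (bump a' b' n x * G x) \<le> \<bar>G x\<bar>" for n
          using bump_bounds[of a' b' n] by (intro AE_I2) (simp add: abs_mult mult_left_le_one_le)
      qed (use G bm in \<open>auto intro!: borel_measurable_times borel_measurable_indicator\<close>)
      then show ?thesis unfolding zn by (simp add: LIMSEQ_const_iff)
    qed auto
    finally show "(LINT x|lborel. indicator {a<..<b} x * g' x) = 0" .
  qed
  then have "AE x in lebesgue. g' x = 0" by (rule AE_completion)
  with ae have "AE x in lebesgue. x \<in> D \<longrightarrow> g x = 0"
    by eventually_elim (auto simp: G_def)
  then show ?thesis using D by (subst AE_restrict_space_iff) (auto simp: D_def)
qed


lemma L2_meas: "u \<in> L2 D \<Longrightarrow> u \<in> borel_measurable (lebesgue_on D)"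
  by (simp add: L2_def)

lemma L2_mult_integrable:
  assumes "u \<in> L2 D" "v \<in> L2 D"
  shows "integrable (lebesgue_on D) (\<lambda>x. u x * v x)"
proof (rule Bochner_Integration.integrable_bound)
  show "integrable (lebesgue_on D) (\<lambda>x. (u x)\<^sup>2 + (v x)\<^sup>2)"
    using assms by (auto simp: L2_def)
  have "\<bar>a * b\<bar> \<le> a\<^sup>2 + b\<^sup>2" for a b :: real
  proof -
    have "2 * (\<bar>a\<bar> * \<bar>b\<bar>) \<le> a\<^sup>2 + b\<^sup>2" using sum_squares_bound[of "\<bar>a\<bar>" "\<bar>b\<bar>"] by simp
    moreover have "\<bar>a\<bar> * \<bar>b\<bar> \<ge> 0" by simp
    ultimately have "\<bar>a\<bar> * \<bar>b\<bar> \<le> a\<^sup>2 + b\<^sup>2" by linarith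
    then show ?thesis by (simp add: abs_mult)
  qed
  then show "AE x in lebesgue_on D. norm (u x * v x) \<le> norm ((u x)\<^sup>2 + (v x)\<^sup>2)"
    by (auto intro!: AE_I2 simp: sum_power2_ge_zero)
qed (use assms in \<open>auto simp: L2_def\<close>)

lemma L2_add: assumes "u \<in> L2 D" "v \<in> L2 D" shows "(\<lambda>x. u x + v x) \<in> L2 D"
proof -
  have "integrable (lebesgue_on D) (\<lambda>x. (u x)\<^sup>2 + (v x)\<^sup>2 + 2 * (u x * v x))"
    using assms L2_mult_integrable[OF assms] by (auto simp: L2_def)
  then show ?thesis using assms by (auto simp: L2_def power2_sum algebra_simps)
qed

lemma L2_cmult: assumes "u \<in> L2 D" shows "(\<lambda>x. a * u x) \<in> L2 D"
  using assms by (auto simp: L2_def power_mult_distrib)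

lemma L2_diff: assumes "u \<in> L2 D" "v \<in> L2 D" shows "(\<lambda>x. u x - v x) \<in> L2 D"
  using L2_add[OF assms(1) L2_cmult[OF assms(2), of "-1"]] by simp

lemma L2_bounded_mult:
  assumes u: "u \<in> L2 D" and p: "p \<in> borel_measurable (lebesgue_on D)"
    and b: "\<And>x. x \<in> D \<Longrightarrow> \<bar>p x\<bar> \<le> B"
  shows "(\<lambda>x. p x * u x) \<in> L2 D"
proof -
  have "integrable (lebesgue_on D) (\<lambda>x. (p x * u x)\<^sup>2)"
  proof (rule Bochner_Integration.integrable_bound)
    show "integrable (lebesgue_on D) (\<lambda>x. B\<^sup>2 * (u x)\<^sup>2)" using u by (auto simp: L2_def)
    show "AE x in lebesgue_on D. norm ((p x * u x)\<^sup>2) \<le> norm (B\<^sup>2 * (u x)\<^sup>2)"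
    proof (rule AE_I2)
      fix x assume "x \<in> space (lebesgue_on D)"
      then have "\<bar>p x\<bar> \<le> B" using b by simp
      then have "\<bar>p x\<bar> \<le> \<bar>B\<bar>" by simp
      then have "(p x)\<^sup>2 \<le> B\<^sup>2" by (rule abs_le_square_iff[THEN iffD1])
      then show "norm ((p x * u x)\<^sup>2) \<le> norm (B\<^sup>2 * (u x)\<^sup>2)"
        by (simp add: power_mult_distrib mult_right_mono)
    qed
  qed (use u p in \<open>auto simp: L2_def\<close>)
  then show ?thesis using u p by (auto simp: L2_def)
qed

lemma one_L2: "bounded D \<Longrightarrow> D \<in> sets lebesgue \<Longrightarrow> (\<lambda>x. 1) \<in> L2 D"
  using finite_measure.integrable_const[OF finite_measure_lebesgue_on[of D], of 1]
  by (auto simp: L2_def bounded_set_imp_lmeasurable)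

lemma bounded_L2:
  assumes "bounded D" "D \<in> sets lebesgue" "p \<in> borel_measurable (lebesgue_on D)"
    "\<And>x. x \<in> D \<Longrightarrow> \<bar>p x\<bar> \<le> B"
  shows "p \<in> L2 D"
  using L2_bounded_mult[OF one_L2[OF assms(1,2)] assms(3,4)] by simp

lemma L2_integrable:
  assumes "bounded D" "D \<in> sets lebesgue" "u \<in> L2 D" shows "integrable (lebesgue_on D) u"
  using L2_mult_integrable[OF one_L2[OF assms(1,2)] assms(3)] by simp

lemma ip_add: "u \<in> L2 D \<Longrightarrow> u' \<in> L2 D \<Longrightarrow> v \<in> L2 D \<Longrightarrow> ip D (\<lambda>x. u x + u' x) v = ip D u v + ip D u' v"
  unfolding ip_def by (simp add: distrib_right L2_mult_integrable)
lemma ip_diff: "u \<in> L2 D \<Longrightarrow> u' \<in> L2 D \<Longrightarrow> v \<in> L2 D \<Longrightarrow> ip D (\<lambda>x. u x - u' x) v = ip D u v - ip D u' v"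
  unfolding ip_def by (simp add: left_diff_distrib L2_mult_integrable)
lemma ip_diff2: "u \<in> L2 D \<Longrightarrow> u' \<in> L2 D \<Longrightarrow> v \<in> L2 D \<Longrightarrow> ip D v (\<lambda>x. u x - u' x) = ip D v u - ip D v u'"
  unfolding ip_def by (simp add: right_diff_distrib L2_mult_integrable)
lemma ip_cmult: "ip D (\<lambda>x. a * u x) v = a * ip D u v"
  unfolding ip_def by (simp add: mult.assoc)

lemma ip_cong_AE:
  assumes "AE x in lebesgue_on D. u x = u' x" "AE x in lebesgue_on D. v x = v' x"
    "u \<in> L2 D" "v \<in> L2 D" "u' \<in> L2 D" "v' \<in> L2 D"
  shows "ip D u v = ip D u' v'"
  unfolding ip_def
proof (rule integral_cong_AE)
  show "AE x in lebesgue_on D. u x * v x = u' x * v' x"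
    using assms(1,2) by eventually_elim simp
qed (intro borel_measurable_times L2_meas assms)+

lemma ip_bound:
  assumes "u \<in> L2 D" "v \<in> L2 D" "t > 0"
  shows "\<bar>ip D u v\<bar> \<le> t * ip D u u + ip D v v / t"
proof -
  have "\<bar>ip D u v\<bar> \<le> (LINT x|lebesgue_on D. \<bar>u x * v x\<bar>)"
    unfolding ip_def using integral_norm_bound[of "lebesgue_on D" "\<lambda>x. u x * v x"] by simp
  also have "\<dots> \<le> (LINT x|lebesgue_on D. t * (u x * u x) + v x * v x / t)"
  proof (rule integral_mono)
    fix x
    have "0 \<le> (t * \<bar>u x\<bar> - \<bar>v x\<bar>)\<^sup>2 + t * \<bar>u x\<bar> * \<bar>v x\<bar>" using assms by simp
    then have "t * \<bar>u x\<bar> * \<bar>v x\<bar> \<le> t\<^sup>2 * (u x * u x) + v x * v x"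
      by (simp add: power2_eq_square algebra_simps abs_mult_self_eq)
    then show "\<bar>u x * v x\<bar> \<le> t * (u x * u x) + v x * v x / t"
      using assms(3) by (simp add: field_simps abs_mult power2_eq_square)
  qed (use assms in \<open>auto intro!: L2_mult_integrable Bochner_Integration.integrable_add integrable_mult_right integrable_divide Bochner_Integration.integrable_abs\<close>)
  also have "\<dots> = t * ip D u u + ip D v v / t"
    unfolding ip_def using assms by (subst Bochner_Integration.integral_add) (auto intro!: L2_mult_integrable)
  finally show ?thesis .
qed

lemma ip_self_nonneg: "ip D u u \<ge> 0"
  unfolding ip_def by (intro integral_nonneg_AE) auto

lemma L2_norm_sq: "(L2_norm D u)\<^sup>2 = ip D u u"
  by (simp add: L2_norm_def ip_self_nonneg)

lemma ip_tendsto_0: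
  assumes u: "u \<in> L2 D" and v: "\<And>n::nat. v n \<in> L2 D" and z: "(\<lambda>n. ip D (v n) (v n)) \<longlonglongrightarrow> 0"
  shows "(\<lambda>n. ip D u (v n)) \<longlonglongrightarrow> 0"
proof (rule LIMSEQ_I)
  fix e :: real assume e: "e > 0"
  define A where "A = ip D u u + 1"
  have A: "A > 0" using ip_self_nonneg[of D u] by (simp add: A_def)
  define t where "t = e / (2 * A)"
  have t: "t > 0" using e A by (simp add: t_def)
  obtain N where N: "\<And>n. n \<ge> N \<Longrightarrow> \<bar>ip D (v n) (v n)\<bar> < t * e / 2"
    using LIMSEQ_D[OF z, of "t * e / 2"] t e by auto
  show "\<exists>N. \<forall>n\<ge>N. norm (ip D u (v n) - 0) < e"
  proof (intro exI allI impI)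
    fix n assume "n \<ge> N"
    then have "ip D (v n) (v n) / t < e / 2" using N[of n] t by (auto simp: field_simps)
    moreover have "t * ip D u u \<le> t * A" using t by (simp add: A_def)
    moreover have "t * A = e / 2" using A by (simp add: t_def)
    moreover have "\<bar>ip D u (v n)\<bar> \<le> t * ip D u u + ip D (v n) (v n) / t" by (rule ip_bound[OF u v[of n] t])
    ultimately have "\<bar>ip D u (v n)\<bar> < e" by linarith
    then show "norm (ip D u (v n) - 0) < e" by simp
  qed
qed

lemma compact_support_bounded:
  fixes h :: "real \<Rightarrow> real"
  assumes c: "continuous_on UNIV h" and K: "compact K" and z: "\<And>x. x \<notin> K \<Longrightarrow> h x = 0"
  obtains B where "\<And>x. \<bar>h x\<bar> \<le> B"
proof -
  have "compact (h ` K)" using c K by (meson compact_continuous_image continuous_on_subset top_greatest)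
  then obtain B where B: "\<And>x. x \<in> K \<Longrightarrow> \<bar>h x\<bar> \<le> B" using compact_imp_bounded[of "h ` K"] by (auto simp: bounded_iff)
  then have "\<bar>h x\<bar> \<le> max B 0" for x using z[of x] B[of x] by (cases "x \<in> K") (simp_all add: le_max_iff_disj)
  then show ?thesis using that by blast
qed

lemma cont_meas: "continuous_on UNIV h \<Longrightarrow> (h :: real \<Rightarrow> real) \<in> borel_measurable (lebesgue_on D)"
  by (rule measurable_restrict_space1) (auto intro: measurable_completion simp: borel_measurable_continuous_onI)

lemma test_fun_facts:
  assumes "test_fun D \<phi>"
  shows "(\<phi> has_real_derivative deriv \<phi> x) (at x)" "continuous_on UNIV \<phi>" "continuous_on UNIV (deriv \<phi>)"
    "x \<notin> D \<Longrightarrow> \<phi> x = 0" "x \<notin> closure {x. \<phi> x \<noteq> 0} \<Longrightarrow> deriv \<phi> x = 0"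
    "x \<notin> closure {x. \<phi> x \<noteq> 0} \<Longrightarrow> \<phi> x = 0" "compact (closure {x. \<phi> x \<noteq> 0})"
proof -
  show d: "(\<phi> has_real_derivative deriv \<phi> x) (at x)" for x
    using assms by (simp add: test_fun_def DERIV_deriv_iff_real_differentiable)
  show "continuous_on UNIV \<phi>"
    using d by (meson DERIV_isCont continuous_at_imp_continuous_on)
  show "x \<notin> D \<Longrightarrow> \<phi> x = 0" using assms closure_subset[of "{x. \<phi> x \<noteq> 0}"] by (auto simp: test_fun_def)
  show "x \<notin> closure {x. \<phi> x \<noteq> 0} \<Longrightarrow> \<phi> x = 0" using closure_subset[of "{x. \<phi> x \<noteq> 0}"] by auto
  show "deriv \<phi> x = 0" if "x \<notin> closure {x. \<phi> x \<noteq> 0}"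
  proof -
    have "\<forall>\<^sub>F y in nhds x. y \<in> - closure {x. \<phi> x \<noteq> 0}"
      using that by (intro eventually_nhds_in_open) auto
    then have "\<forall>\<^sub>F y in nhds x. \<phi> y = 0"
      by (rule eventually_mono) (use closure_subset[of "{x. \<phi> x \<noteq> 0}"] in auto)
    then have "deriv \<phi> x = deriv (\<lambda>_. 0) x" by (rule deriv_cong_ev) simp
    then show ?thesis by simp
  qed
qed (use assms in \<open>auto simp: test_fun_def\<close>)

lemma test_fun_L2:
  assumes "test_fun D \<phi>" "bounded D" "D \<in> sets lebesgue"
  shows "\<phi> \<in> L2 D" "deriv \<phi> \<in> L2 D"
proof -
  note f = test_fun_facts[OF assms(1)]
  obtain B where "\<And>x. \<bar>\<phi> x\<bar> \<le> B" using compact_support_bounded[OF f(2) f(7)] f(6) by blast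
  then show "\<phi> \<in> L2 D" by (intro bounded_L2[OF assms(2,3) cont_meas[OF f(2)]]) auto
  obtain B where "\<And>x. \<bar>deriv \<phi> x\<bar> \<le> B" using compact_support_bounded[OF f(3) f(7)] f(5) by blast
  then show "deriv \<phi> \<in> L2 D" by (intro bounded_L2[OF assms(2,3) cont_meas[OF f(3)]]) auto
qed

lemma test_fun_zero: "test_fun D (\<lambda>_. 0)"
  by (simp add: test_fun_def)

lemma test_fun_weak_deriv:
  assumes t: "test_fun {l<..<r} \<phi>" and lr: "l \<le> r"
  shows "has_weak_deriv {l<..<r} \<phi> (deriv \<phi>)"
  unfolding has_weak_deriv_def
proof (intro conjI allI impI)
  let ?D = "{l<..<r}"
  have D: "bounded ?D" "?D \<in> sets lebesgue" "?D \<inter> space lebesgue \<in> sets lebesgue" by auto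
  show "\<phi> \<in> L2 ?D" "deriv \<phi> \<in> L2 ?D" using test_fun_L2[OF t] D by auto
  fix \<psi> assume p: "test_fun ?D \<psi>"
  note f = test_fun_facts[OF t] and g = test_fun_facts[OF p]
  define k where "k = (\<lambda>x. \<phi> x * deriv \<psi> x + deriv \<phi> x * \<psi> x)"
  have kc: "continuous_on UNIV k" unfolding k_def by (intro continuous_intros f g)
  have eq: "indicator ?D x * k x = k x * indicator {l..r} x" for x
    using f(4)[of x] g(4)[of x] by (cases "x \<in> ?D") (auto simp: k_def indicator_def)
  have "ip ?D \<phi> (deriv \<psi>) + ip ?D (deriv \<phi>) \<psi> = (LINT x|lebesgue_on ?D. k x)"
    unfolding ip_def k_def
    by (subst Bochner_Integration.integral_add) (auto intro!: L2_mult_integrable test_fun_L2 t p)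
  also have "\<dots> = (LINT x|lebesgue. k x * indicator {l..r} x)"
    by (subst integral_restrict_space[OF D(3)]) (simp add: eq)
  also have "\<dots> = (LINT x|lborel. k x * indicator {l..r} x)"
  proof (rule integral_completion)
    have "k \<in> borel_measurable borel" by (rule borel_measurable_continuous_onI[OF kc])
    then show "(\<lambda>x. k x * indicator {l..r} x) \<in> borel_measurable lborel" by simp
  qed
  also have "\<dots> = \<phi> r * \<psi> r - \<phi> l * \<psi> l"
  proof (rule integral_FTC_Icc_real[OF lr])
    fix x
    show "((\<lambda>x. \<phi> x * \<psi> x) has_real_derivative k x) (at x)"
      unfolding k_def by (auto intro!: derivative_eq_intros f(1) g(1) simp: algebra_simps)
    show "isCont k x" using kc continuous_on_eq_continuous_at open_UNIV by blast
  qed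
  also have "\<dots> = 0" using f(4)[of r] f(4)[of l] by simp
  finally show "ip ?D \<phi> (deriv \<psi>) = - ip ?D (deriv \<phi>) \<psi>" by simp
qed

lemma weak_deriv_unique:
  assumes "has_weak_deriv {l<..<r} u g" "has_weak_deriv {l<..<r} u h"
  shows "AE x in lebesgue_on {l<..<r}. g x = h x"
proof -
  let ?D = "{l<..<r}"
  have D: "bounded ?D" "?D \<in> sets lebesgue" by auto
  have "AE x in lebesgue_on ?D. g x - h x = 0"
  proof (rule fundamental_lemma)
    show "integrable (lebesgue_on ?D) (\<lambda>x. g x - h x)"
      using assms D by (intro Bochner_Integration.integrable_diff L2_integrable) (auto simp: has_weak_deriv_def)
    fix \<phi> assume t: "test_fun ?D \<phi>"
    show "ip ?D (\<lambda>x. g x - h x) \<phi> = 0"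
      using assms t ip_diff[of g ?D h \<phi>] test_fun_L2[OF t D] by (auto simp: has_weak_deriv_def)
  qed
  then show ?thesis by (auto elim: eventually_mono)
qed

lemma has_weak_deriv_diff:
  assumes "has_weak_deriv D u g" "has_weak_deriv D v h" "bounded D" "D \<in> sets lebesgue"
  shows "has_weak_deriv D (\<lambda>x. u x - v x) (\<lambda>x. g x - h x)"
  unfolding has_weak_deriv_def
proof (intro conjI allI impI)
  have L: "u \<in> L2 D" "v \<in> L2 D" "g \<in> L2 D" "h \<in> L2 D" using assms by (auto simp: has_weak_deriv_def)
  then show "(\<lambda>x. u x - v x) \<in> L2 D" "(\<lambda>x. g x - h x) \<in> L2 D" by (auto intro: L2_diff)
  fix \<phi> assume t: "test_fun D \<phi>"
  then have "\<phi> \<in> L2 D" "deriv \<phi> \<in> L2 D" using test_fun_L2 assms by blast+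
  then show "ip D (\<lambda>x. u x - v x) (deriv \<phi>) = - ip D (\<lambda>x. g x - h x) \<phi>"
    using L assms t by (simp add: ip_diff has_weak_deriv_def)
qed

lemma H1I: "has_weak_deriv D u g \<Longrightarrow> u \<in> H1 D"
  unfolding H1_def by blast

lemma wderiv: "u \<in> H1 D \<Longrightarrow> has_weak_deriv D u (wderiv D u)"
  unfolding H1_def wderiv_def by (drule CollectD) (erule someI_ex)

lemma H01_approx:
  assumes "v \<in> H01 {l<..<r}" "l \<le> r"
  obtains \<phi> where "\<And>n::nat. test_fun {l<..<r} (\<phi> n)"
    "(\<lambda>n. ip {l<..<r} (\<lambda>x. v x - \<phi> n x) (\<lambda>x. v x - \<phi> n x)) \<longlonglongrightarrow> 0"
    "(\<lambda>n. ip {l<..<r} (\<lambda>x. wderiv {l<..<r} v x - deriv (\<phi> n) x)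
                      (\<lambda>x. wderiv {l<..<r} v x - deriv (\<phi> n) x)) \<longlonglongrightarrow> 0"
proof -
  let ?D = "{l<..<r}"
  have D: "bounded ?D" "?D \<in> sets lebesgue" by auto
  obtain \<phi> where t: "\<And>n::nat. test_fun ?D (\<phi> n)" and
    l: "(\<lambda>n. H1_norm ?D (\<lambda>x. v x - \<phi> n x)) \<longlonglongrightarrow> 0" and v: "v \<in> H1 ?D"
    using assms(1) unfolding H01_def by blast
  define E where "E = (\<lambda>n x. v x - \<phi> n x)"
  define E' where "E' = (\<lambda>n x. wderiv ?D v x - deriv (\<phi> n) x)"
  have w: "has_weak_deriv ?D (E n) (E' n)" for n
    unfolding E_def E'_def by (intro has_weak_deriv_diff wderiv v test_fun_weak_deriv t assms D)
  then have w': "has_weak_deriv ?D (E n) (wderiv ?D (E n))" for n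
    by (intro wderiv H1I)
  have eq: "ip ?D (wderiv ?D (E n)) (wderiv ?D (E n)) = ip ?D (E' n) (E' n)" for n
    using weak_deriv_unique[OF w' w, of n] w[of n] w'[of n]
    by (intro ip_cong_AE) (auto simp: has_weak_deriv_def)
  have "(\<lambda>n. (H1_norm ?D (E n))\<^sup>2) \<longlonglongrightarrow> 0\<^sup>2" using l unfolding E_def by (intro tendsto_intros)
  moreover have "(H1_norm ?D (E n))\<^sup>2 = ip ?D (E n) (E n) + ip ?D (E' n) (E' n)" for n
    by (simp add: H1_norm_def L2_norm_sq ip_self_nonneg eq)
  ultimately have lim: "(\<lambda>n. ip ?D (E n) (E n) + ip ?D (E' n) (E' n)) \<longlonglongrightarrow> 0" by simp
  have "(\<lambda>n. ip ?D (E n) (E n)) \<longlonglongrightarrow> 0" "(\<lambda>n. ip ?D (E' n) (E' n)) \<longlonglongrightarrow> 0"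
    by (rule tendsto_sandwich[OF _ _ tendsto_const lim]; auto simp: ip_self_nonneg)+
  then show ?thesis using that t unfolding E_def E'_def by blast
qed

lemma test_fun_H01:
  assumes t: "test_fun {l<..<r} \<phi>" and "l \<le> r" shows "\<phi> \<in> H01 {l<..<r}"
proof -
  let ?D = "{l<..<r}"
  note w = test_fun_weak_deriv[OF test_fun_zero[of ?D] assms(2)]
  then have w': "has_weak_deriv ?D (\<lambda>_. 0) (wderiv ?D (\<lambda>_. 0))" by (intro wderiv H1I)
  have "ip ?D (wderiv ?D (\<lambda>_. 0)) (wderiv ?D (\<lambda>_. 0)) = ip ?D (deriv (\<lambda>_. 0)) (deriv (\<lambda>_. 0))"
    using weak_deriv_unique[OF w' w] w w' by (intro ip_cong_AE) (auto simp: has_weak_deriv_def)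
  then have "H1_norm ?D (\<lambda>x. \<phi> x - \<phi> x) = 0"
    by (simp add: H1_norm_def L2_norm_sq) (simp add: ip_def)
  then have "(\<lambda>n::nat. H1_norm ?D (\<lambda>x. \<phi> x - \<phi> x)) \<longlonglongrightarrow> 0" by simp
  moreover have "\<phi> \<in> H1 ?D" using test_fun_weak_deriv[OF assms] by (rule H1I)
  ultimately show ?thesis using t unfolding H01_def by (intro CollectI conjI exI[of _ "\<lambda>n. \<phi>"]) auto
qed


lemma cont_Icc_facts:
  fixes h :: "real \<Rightarrow> real"
  assumes "continuous_on {0..2} h"
  shows "h \<in> borel_measurable (lebesgue_on {0<..<2})" "\<exists>B. \<forall>x\<in>{0<..<2}. \<bar>h x\<bar> \<le> B"
proof -
  have "continuous_on {0<..<2} h" using assms by (rule continuous_on_subset) auto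
  then show "h \<in> borel_measurable (lebesgue_on {0<..<2})"
    by (intro continuous_imp_measurable_on_sets_lebesgue) auto
  have "compact (h ` {0..2})" using assms by (intro compact_continuous_image) auto
  then show "\<exists>B. \<forall>x\<in>{0<..<2}. \<bar>h x\<bar> \<le> B"
    using compact_imp_bounded[of "h ` {0..2}"] by (force simp: bounded_iff)
qed

lemma cont_mult_L2:
  assumes "continuous_on {0..2} h" "u \<in> L2 \<Omega>" shows "(\<lambda>x. h x * u x) \<in> L2 \<Omega>"
proof -
  obtain B where "\<And>x. x \<in> \<Omega> \<Longrightarrow> \<bar>h x\<bar> \<le> B" using cont_Icc_facts[OF assms(1)] by blast
  then show ?thesis by (rule L2_bounded_mult[OF assms(2) cont_Icc_facts(1)[OF assms(1)]])
qed

lemma L2_iff: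
  assumes "D \<in> sets lebesgue"
  shows "u \<in> L2 D \<longleftrightarrow> (\<lambda>x. indicator D x * u x) \<in> borel_measurable lebesgue
     \<and> integrable lebesgue (\<lambda>x. (indicator D x * u x)\<^sup>2)"
proof -
  have "(\<lambda>x. (indicator D x * u x)\<^sup>2) = (\<lambda>x. indicator D x * (u x)\<^sup>2)"
    by (auto simp: indicator_def fun_eq_iff)
  then show ?thesis using assms
    by (simp add: L2_def integrable_restrict_space borel_measurable_restrict_space_iff)
qed

lemma L2_shift:
  assumes "u \<in> L2 D" "D \<in> sets lebesgue"
  shows "(\<lambda>x. indicator D (x - 1) * u (x - 1)) \<in> L2 \<Omega>"
proof -
  define U where "U = (\<lambda>x. indicator D x * u x)"
  have U: "U \<in> borel_measurable lebesgue" "integrable lebesgue (\<lambda>x. (U x)\<^sup>2)"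
    using assms by (auto simp: L2_iff U_def)
  have m: "(\<lambda>x. U (x - 1)) \<in> borel_measurable lebesgue"
    using borel_measurable_affine[OF U(1), of 1 "-1"] by simp
  moreover have i: "integrable lebesgue (\<lambda>x. (U (x - 1))\<^sup>2)"
    using lebesgue_integrable_real_affine[OF U(2), of 1 "-1"] by simp
  ultimately have "(\<lambda>x. U (x - 1)) \<in> L2 UNIV" by (subst L2_iff) auto
  have "integrable lebesgue (\<lambda>x. indicator \<Omega> x *\<^sub>R (U (x - 1))\<^sup>2)"
    by (rule integrable_mult_indicator[OF _ i]) auto
  then have "integrable (lebesgue_on \<Omega>) (\<lambda>x. (U (x - 1))\<^sup>2)"
    by (subst integrable_restrict_space) auto
  then show ?thesis using m unfolding L2_def U_def by (auto intro: measurable_restrict_space1)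
qed

abbreviation "shifted \<Phi> u \<equiv> \<lambda>x::real. if x < 1 then \<Phi> (x - 1) else (u (x - 1) :: real)"

lemma L2_cong: assumes "u \<in> L2 D" "\<And>x. x \<in> D \<Longrightarrow> u x = v x" shows "v \<in> L2 D"
proof -
  have "u \<in> borel_measurable (lebesgue_on D) \<longleftrightarrow> v \<in> borel_measurable (lebesgue_on D)"
    by (rule measurable_cong) (simp add: assms(2))
  moreover have "integrable (lebesgue_on D) (\<lambda>x. (u x)\<^sup>2) \<longleftrightarrow> integrable (lebesgue_on D) (\<lambda>x. (v x)\<^sup>2)"
    by (rule Bochner_Integration.integrable_cong) (simp_all add: assms(2))
  ultimately show ?thesis using assms(1) by (simp add: L2_def)
qed

lemma shifted_L2:
  assumes u: "u \<in> L2 \<Omega>" and P: "continuous_on {-1..0} \<Phi>"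
  shows "shifted \<Phi> u \<in> L2 \<Omega>"
proof -
  have O: "\<Omega> \<in> sets lebesgue" "bounded \<Omega>" by auto
  have ind: "indicat_real A \<in> borel_measurable (lebesgue_on \<Omega>)" if "A \<in> sets borel" for A
    by (rule measurable_restrict_space1[OF borel_measurable_indicator]) (use that in auto)
  have "compact (\<Phi> ` {-1..0})" using P by (intro compact_continuous_image) auto
  then obtain B where B: "\<And>x. x \<in> {-1..0} \<Longrightarrow> \<bar>\<Phi> x\<bar> \<le> B"
    using compact_imp_bounded[of "\<Phi> ` {-1..0}"] by (force simp: bounded_iff)
  have "\<Phi> \<in> L2 {-1..0}"
    by (rule bounded_L2[OF _ _ _ B]) (auto intro: continuous_imp_measurable_on_sets_lebesgue P)
  then have "(\<lambda>x. indicator {-1..0} (x - 1) * \<Phi> (x - 1)) \<in> L2 \<Omega>" by (rule L2_shift) auto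
  then have 1: "(\<lambda>x. indicator {..<1} x * (indicator {-1..0} (x - 1) * \<Phi> (x - 1))) \<in> L2 \<Omega>"
    by (rule L2_bounded_mult[where B = 1, OF _ ind]) (simp_all split: split_indicator)
  have "(\<lambda>x. indicator \<Omega> (x - 1) * u (x - 1)) \<in> L2 \<Omega>" using u by (rule L2_shift) auto
  then have 2: "(\<lambda>x. indicator {1<..} x * (indicator \<Omega> (x - 1) * u (x - 1))) \<in> L2 \<Omega>"
    by (rule L2_bounded_mult[where B = 1, OF _ ind]) (simp_all split: split_indicator)
  have 3: "(\<lambda>x. u 0 * indicator {1} x) \<in> L2 \<Omega>"
    by (rule L2_cmult, rule bounded_L2[OF O(2,1) ind, where B = 1]) (simp_all split: split_indicator)
  have eq: "shifted \<Phi> u x = indicator {..<1} x * (indicator {-1..0} (x - 1) * \<Phi> (x - 1))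
      + indicator {1<..} x * (indicator \<Omega> (x - 1) * u (x - 1)) + u 0 * indicator {1} x"
    if "x \<in> \<Omega>" for x using that by (auto simp: indicator_def)
  note L = L2_add[OF L2_add[OF 1 2] 3]
  show ?thesis by (rule L2_cong[OF L]) (rule eq[symmetric])
qed

lemma ip_split:
  fixes h :: "real \<Rightarrow> real"
  assumes h: "integrable (lebesgue_on \<Omega>) h"
  shows "(LINT x|lebesgue_on \<Omega>. h x)
     = (LINT x|lebesgue_on {0<..<1}. h x) + (LINT x|lebesgue_on {1<..<2}. h x)"
proof -
  define k where "k = (\<lambda>x. indicator \<Omega> x * h x)"
  have k: "integrable lebesgue k"
    using h by (subst (asm) integrable_restrict_space) (auto simp: k_def)
  have *: "(LINT x|lebesgue_on D. h x) = (LINT x|lebesgue. indicator D x * k x)"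
    if "D \<subseteq> \<Omega>" "D \<in> sets lebesgue" for D
    using that by (subst integral_restrict_space)
      (auto simp: k_def indicator_def intro!: Bochner_Integration.integral_cong)
  have i: "integrable lebesgue (\<lambda>x. indicator D x * k x)" if "D \<in> sets lebesgue" for D
    using integrable_mult_indicator[OF that k] by simp
  have ae: "AE x in lebesgue. x \<noteq> (1::real)" by (rule AE_completion[OF AE_lborel_singleton])
  have "(LINT x|lebesgue_on \<Omega>. h x) = (LINT x|lebesgue. indicator \<Omega> x * k x)" by (rule *) auto
  also have "\<dots> = (LINT x|lebesgue. indicator {0<..<1} x * k x + indicator {1<..<2} x * k x)"
  proof (rule integral_cong_AE)
    show "AE x in lebesgue. indicator \<Omega> x * k x = indicator {0<..<1} x * k x + indicator {1<..<2} x * k x"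
      using ae by eventually_elim (auto simp: indicator_def)
    show "(\<lambda>x. indicator \<Omega> x * k x) \<in> borel_measurable lebesgue"
      using i[of \<Omega>] by (intro borel_measurable_integrable) auto
    show "(\<lambda>x. indicator {0<..<1} x * k x + indicator {1<..<2} x * k x) \<in> borel_measurable lebesgue"
      by (intro borel_measurable_add borel_measurable_integrable i) auto
  qed
  also have "\<dots> = (LINT x|lebesgue. indicator {0<..<1} x * k x) + (LINT x|lebesgue. indicator {1<..<2} x * k x)"
    by (intro Bochner_Integration.integral_add i) auto
  also have "\<dots> = (LINT x|lebesgue_on {0<..<1}. h x) + (LINT x|lebesgue_on {1<..<2}. h x)"
    by (subst (1 2) *) auto
  finally show ?thesis .
qed

lemma bilin_rhs:
  assumes c: "continuous_on {0..2} b" "continuous_on {0..2} c" "continuous_on {0..2} d"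
      "continuous_on {0..2} f" "continuous_on {-1..0} \<Phi>"
    and u: "u \<in> L2 \<Omega>" "wderiv \<Omega> u \<in> L2 \<Omega>"
  defines "G \<equiv> \<lambda>x. c x * u x - b x * wderiv \<Omega> u x + d x * shifted \<Phi> u x - f x"
  shows "G \<in> L2 \<Omega>"
    "v \<in> L2 \<Omega> \<Longrightarrow> bilin \<epsilon> b c d u v - rhs d f \<Phi> v
       = \<epsilon> * ip \<Omega> (wderiv \<Omega> u) (wderiv \<Omega> v) + ip \<Omega> G v"
proof -
  have O: "\<Omega> \<in> sets lebesgue" "bounded \<Omega>" by auto
  have 1: "(\<lambda>x. c x * u x - b x * wderiv \<Omega> u x) \<in> L2 \<Omega>"
    by (intro L2_diff cont_mult_L2 c u)
  have 2: "(\<lambda>x. d x * shifted \<Phi> u x) \<in> L2 \<Omega>"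
    by (rule cont_mult_L2[OF c(3) shifted_L2[OF u(1) c(5)]])
  have 3: "f \<in> L2 \<Omega>" using cont_mult_L2[OF c(4) one_L2[OF O(2,1)]] by simp
  show "G \<in> L2 \<Omega>" unfolding G_def by (rule L2_diff[OF L2_add[OF 1 2] 3])
  assume v: "v \<in> L2 \<Omega>"
  have "ip \<Omega> (\<lambda>x. d x * shifted \<Phi> u x) v
     = ip {0<..<1} (\<lambda>x. d x * shifted \<Phi> u x) v + ip {1<..<2} (\<lambda>x. d x * shifted \<Phi> u x) v"
    unfolding ip_def by (rule ip_split[OF L2_mult_integrable[OF 2 v]])
  also have "ip {0<..<1} (\<lambda>x. d x * shifted \<Phi> u x) v = ip {0<..<1} (\<lambda>x. d x * \<Phi> (x - 1)) v"
    unfolding ip_def by (intro Bochner_Integration.integral_cong) auto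
  also have "ip {1<..<2} (\<lambda>x. d x * shifted \<Phi> u x) v = ip {1<..<2} (\<lambda>x. d x * u (x - 1)) v"
    unfolding ip_def by (intro Bochner_Integration.integral_cong) auto
  finally have s: "ip \<Omega> (\<lambda>x. d x * shifted \<Phi> u x) v
     = ip {0<..<1} (\<lambda>x. d x * \<Phi> (x - 1)) v + ip {1<..<2} (\<lambda>x. d x * u (x - 1)) v" .
  have "ip \<Omega> G v = ip \<Omega> (\<lambda>x. c x * u x - b x * wderiv \<Omega> u x) v
     + ip \<Omega> (\<lambda>x. d x * shifted \<Phi> u x) v - ip \<Omega> f v"
    unfolding G_def by (subst ip_diff[OF L2_add[OF 1 2] 3 v]) (simp only: ip_add[OF 1 2 v])
  then show "bilin \<epsilon> b c d u v - rhs d f \<Phi> v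
       = \<epsilon> * ip \<Omega> (wderiv \<Omega> u) (wderiv \<Omega> v) + ip \<Omega> G v"
    using s by (simp add: bilin_def rhs_def)
qed

text \<open>The differential equation and the variational formulation define the same solutions.\<close>

theorem bvp_solution_iff_weak_solution:
  assumes c: "continuous_on {0..2} b" "continuous_on {0..2} c" "continuous_on {0..2} d"
      "continuous_on {0..2} f" "continuous_on {-1..0} \<Phi>" and eps: "\<epsilon> > 0"
  shows "bvp_solution \<epsilon> b c d f \<Phi> u \<longleftrightarrow> weak_solution \<epsilon> b c d f \<Phi> u"
proof (cases "u \<in> H01 \<Omega>")
  case False
  then show ?thesis by (simp add: bvp_solution_def weak_solution_def)
next
  case True
  have O: "\<Omega> \<in> sets lebesgue" "bounded \<Omega>" by auto
  have wu: "has_weak_deriv \<Omega> u (wderiv \<Omega> u)" using True by (intro wderiv) (simp add: H01_def)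
  then have u: "u \<in> L2 \<Omega>" "wderiv \<Omega> u \<in> L2 \<Omega>" by (auto simp: has_weak_deriv_def)
  define G where "G = (\<lambda>x. c x * u x - b x * wderiv \<Omega> u x + d x * shifted \<Phi> u x - f x)"
  have G: "G \<in> L2 \<Omega>" unfolding G_def by (rule bilin_rhs(1)[OF c u])
  have form: "bilin \<epsilon> b c d u v - rhs d f \<Phi> v
       = \<epsilon> * ip \<Omega> (wderiv \<Omega> u) (wderiv \<Omega> v) + ip \<Omega> G v" if "v \<in> L2 \<Omega>" for v
    unfolding G_def by (rule bilin_rhs(2)[OF c u that])
  show ?thesis
  proof
    assume "bvp_solution \<epsilon> b c d f \<Phi> u"
    then obtain w where w: "has_weak_deriv \<Omega> (wderiv \<Omega> u) w" and
      ode: "AE x in lebesgue_on \<Omega>. - \<epsilon> * w x - b x * wderiv \<Omega> u x + c x * u x + d x * shifted \<Phi> u x = f x"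
      unfolding bvp_solution_def by blast
    have wL: "w \<in> L2 \<Omega>" using w by (simp add: has_weak_deriv_def)
    have ae: "AE x in lebesgue_on \<Omega>. \<epsilon> * w x = G x"
      using ode by eventually_elim (auto simp: G_def)
    have test: "\<epsilon> * ip \<Omega> (wderiv \<Omega> u) (deriv \<phi>) + ip \<Omega> G \<phi> = 0" if t: "test_fun \<Omega> \<phi>" for \<phi>
    proof -
      have pL: "\<phi> \<in> L2 \<Omega>" by (rule test_fun_L2[OF t O(2,1)])
      have "ip \<Omega> (\<lambda>x. \<epsilon> * w x) \<phi> = ip \<Omega> G \<phi>"
        by (rule ip_cong_AE[OF ae _ L2_cmult[OF wL] pL G pL]) simp
      moreover have "ip \<Omega> (wderiv \<Omega> u) (deriv \<phi>) = - ip \<Omega> w \<phi>" using w t by (simp add: has_weak_deriv_def)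
      ultimately show ?thesis by (simp add: ip_cmult)
    qed
    have "bilin \<epsilon> b c d u v = rhs d f \<Phi> v" if v: "v \<in> H01 \<Omega>" for v
    proof -
      have "has_weak_deriv \<Omega> v (wderiv \<Omega> v)" using v by (intro wderiv) (simp add: H01_def)
      then have vL: "v \<in> L2 \<Omega>" "wderiv \<Omega> v \<in> L2 \<Omega>" by (auto simp: has_weak_deriv_def)
      obtain \<phi> where t: "\<And>n::nat. test_fun \<Omega> (\<phi> n)"
        and l0: "(\<lambda>n. ip \<Omega> (\<lambda>x. v x - \<phi> n x) (\<lambda>x. v x - \<phi> n x)) \<longlonglongrightarrow> 0"
        and l1: "(\<lambda>n. ip \<Omega> (\<lambda>x. wderiv \<Omega> v x - deriv (\<phi> n) x)
                      (\<lambda>x. wderiv \<Omega> v x - deriv (\<phi> n) x)) \<longlonglongrightarrow> 0"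
        using H01_approx[OF v] by auto
      have p: "\<phi> n \<in> L2 \<Omega>" "deriv (\<phi> n) \<in> L2 \<Omega>" for n using test_fun_L2[OF t O(2,1)] by auto
      have "(\<lambda>n. \<epsilon> * ip \<Omega> (wderiv \<Omega> u) (\<lambda>x. wderiv \<Omega> v x - deriv (\<phi> n) x)
                + ip \<Omega> G (\<lambda>x. v x - \<phi> n x)) \<longlonglongrightarrow> \<epsilon> * 0 + 0"
        by (intro tendsto_add tendsto_mult_left ip_tendsto_0 u G L2_diff vL p l0 l1)
      moreover have "\<epsilon> * ip \<Omega> (wderiv \<Omega> u) (\<lambda>x. wderiv \<Omega> v x - deriv (\<phi> n) x)
                + ip \<Omega> G (\<lambda>x. v x - \<phi> n x)
           = \<epsilon> * ip \<Omega> (wderiv \<Omega> u) (wderiv \<Omega> v) + ip \<Omega> G v" for n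
        using test[OF t[of n]]
        by (simp add: ip_diff2[OF vL(2) p(2) u(2)] ip_diff2[OF vL(1) p(1) G] algebra_simps)
      ultimately have "\<epsilon> * ip \<Omega> (wderiv \<Omega> u) (wderiv \<Omega> v) + ip \<Omega> G v = 0"
        by (simp add: LIMSEQ_const_iff)
      then show ?thesis using form[OF vL(1)] by simp
    qed
    then show "weak_solution \<epsilon> b c d f \<Phi> u" using True by (simp add: weak_solution_def)
  next
    assume ws: "weak_solution \<epsilon> b c d f \<Phi> u"
    define w where "w = (\<lambda>x. (1 / \<epsilon>) * G x)"
    have wL: "w \<in> L2 \<Omega>" unfolding w_def by (rule L2_cmult[OF G])
    have "ip \<Omega> (wderiv \<Omega> u) (deriv \<phi>) = - ip \<Omega> w \<phi>" if t: "test_fun \<Omega> \<phi>" for \<phi>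
    proof -
      have pL: "\<phi> \<in> L2 \<Omega>" "deriv \<phi> \<in> L2 \<Omega>" using test_fun_L2[OF t O(2,1)] by auto
      have wp: "has_weak_deriv \<Omega> \<phi> (deriv \<phi>)" by (rule test_fun_weak_deriv[OF t]) simp
      have wp': "has_weak_deriv \<Omega> \<phi> (wderiv \<Omega> \<phi>)" by (rule wderiv[OF H1I[OF wp]])
      have "ip \<Omega> (wderiv \<Omega> u) (wderiv \<Omega> \<phi>) = ip \<Omega> (wderiv \<Omega> u) (deriv \<phi>)"
        using weak_deriv_unique[OF wp' wp] wp' pL u by (intro ip_cong_AE) (auto simp: has_weak_deriv_def)
      moreover have "\<phi> \<in> H01 \<Omega>" by (rule test_fun_H01[OF t]) simp
      ultimately have "\<epsilon> * ip \<Omega> (wderiv \<Omega> u) (deriv \<phi>) + ip \<Omega> G \<phi> = 0"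
        using ws form[OF pL(1)] by (simp add: weak_solution_def)
      moreover have "ip \<Omega> w \<phi> = (1 / \<epsilon>) * ip \<Omega> G \<phi>" unfolding w_def by (rule ip_cmult)
      ultimately have "\<epsilon> * (ip \<Omega> (wderiv \<Omega> u) (deriv \<phi>) + ip \<Omega> w \<phi>) = 0" using eps by (simp add: distrib_left)
      then show ?thesis using eps by simp
    qed
    then have "has_weak_deriv \<Omega> (wderiv \<Omega> u) w" using u wL by (simp add: has_weak_deriv_def)
    moreover have "- \<epsilon> * w x - b x * wderiv \<Omega> u x + c x * u x + d x * shifted \<Phi> u x = f x" for x
      using eps by (simp add: w_def G_def)
    ultimately show "bvp_solution \<epsilon> b c d f \<Phi> u" using True unfolding bvp_solution_def by blast
  qed
qed

end

theory Submission
  imports Defs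
begin

text \<open>
  The bilinear form is coercive with constant one in the energy norm (\<open>coercive\<close>): integrating the
  convective term by parts turns \<open>c\<close> into \<open>c + b' / 2\<close>, and the shifted term costs at most half of the
  supremum of \<open>d\<close>. By Galerkin orthogonality the discrete error \<open>\<xi>\<close>, the difference of \<open>uN\<close> and an
  interpolant of \<open>u\<close>, satisfies \<open>B(\<xi>,\<xi>) = B(\<eta>,\<xi>)\<close>, where \<open>\<eta>\<close> is the interpolation error. So it remains
  to bound \<open>B(\<eta>,\<xi>)\<close> by a multiple of \<open>H ^ k\<close> times the energy norm of \<open>\<xi>\<close>.

  The critical term is the convective one. Where the layers of \<open>u\<close> have decayed, \<open>\<eta>'\<close> is itself of order
  \<open>H ^ k\<close> and nothing has to be done. In the layers \<open>\<eta>'\<close> is of size \<open>H ^ k / \<epsilon>\<close>, but there \<open>\<eta>\<close> has norm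
  \<open>sqrt \<epsilon> * H ^ k\<close>, so one integrates by parts and pays \<open>\<parallel>\<xi>'\<parallel>\<close>, which the energy norm controls up to the
  factor \<open>1 / sqrt \<epsilon>\<close>. The choice is made cell by cell, according to whether the cell begins within distance
  \<open>sqrt \<epsilon>\<close> to the right of 0 or 1. Since \<open>\<eta>\<close> vanishes at all mesh points, the part \<open>\<nu>\<close> of \<open>\<eta>\<close> on the near
  cells is again a function in \<open>H\<^sub>0\<^sup>1\<close> (\<open>near_far_split\<close>, \<open>near_far_estimate\<close>).

  All this rests on pointwise bounds of the derivatives of \<open>u\<close>, namely \<open>\<bar>u\<^sup>(\<^sup>i\<^sup>) x\<bar> \<le> C (1 + \<epsilon> powr (- i) * exp (- \<beta> (x - a) / \<epsilon>))\<close> on \<open>[a,a+1]\<close> for \<open>a = 0\<close> and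
  \<open>a = 1\<close>. First, \<open>u\<close> is a classical solution (\<open>bvp_solution_classical\<close>): since \<open>\<Phi> 0 = 0 = u 0\<close>, the delayed
  function is continuous across 1. Coercivity bounds \<open>u\<close> in \<open>L\<^sup>2\<close>. Then \<open>\<epsilon> u' + b u\<close> equals the flux
  \<open>\<epsilon> u' 0\<close> up to a bounded function, so a comparison principle for first-order equations, together with
  \<open>u 2 = 0\<close>, bounds first that flux and then \<open>u\<close> (\<open>solution_bounds\<close>). All higher derivatives \<open>y\<close> solve
  first-order equations \<open>\<epsilon> y' + b y = G\<close> as well, and such an equation propagates layer bounds from \<open>G\<close> to \<open>y\<close>
  (\<open>layered_transport\<close>). On \<open>[1,2]\<close> the right-hand side contains \<open>u(x - 1)\<close>, which has its layer at 1.

  The only property of the mesh that matters is that a cell that begins at distance \<open>q\<close> to the right of 0 or 1 is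
  at most \<open>3 * H * max \<epsilon> q\<close> long (\<open>duran_mesh_layer_mesh\<close>). Against derivatives of the above form this
  yields powers of \<open>H\<close> (\<open>layer_cell_bounds\<close>), because powers of \<open>1 + q / \<epsilon>\<close> are absorbed by a part of the
  exponential.
\<close>

section \<open>Integration and test functions on an interval\<close>

lemma ip_commute: "ip D u v = ip D v u"
  by (simp add: ip_def mult.commute)

lemma ip_nonneg_eq_0_AE:
  assumes "u \<in> L2 D" "ip D u u = 0"
  shows "AE x in lebesgue_on D. u x = 0"
proof -
  have "AE x in lebesgue_on D. u x * u x = 0"
    using assms L2_mult_integrable[of u D u]
    by (subst integral_nonneg_eq_0_iff_AE[symmetric]) (auto simp: ip_def)
  then show ?thesis by simp
qed

lemma ip_diff_self_le:
  assumes "u \<in> L2 D" "v \<in> L2 D"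
  shows "ip D (\<lambda>x. u x - v x) (\<lambda>x. u x - v x) \<le> 2 * ip D u u + 2 * ip D v v"
proof -
  have "ip D (\<lambda>x. u x - v x) (\<lambda>x. u x - v x) \<le> (LINT x|lebesgue_on D. 2 * (u x * u x) + 2 * (v x * v x))"
    unfolding ip_def
  proof (rule integral_mono)
    fix x
    have "0 \<le> (u x + v x)\<^sup>2" by simp
    then show "(u x - v x) * (u x - v x) \<le> 2 * (u x * u x) + 2 * (v x * v x)"
      by (simp add: power2_eq_square algebra_simps)
  qed (use assms in \<open>auto intro!: L2_mult_integrable L2_diff Bochner_Integration.integrable_add integrable_mult_right\<close>)
  also have "\<dots> = 2 * ip D u u + 2 * ip D v v"
    unfolding ip_def using assms
    by (subst Bochner_Integration.integral_add) (auto intro!: L2_mult_integrable integrable_mult_right)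
  finally show ?thesis .
qed

lemma ip_mono_bound:
  assumes u: "u \<in> L2 D" and g: "integrable (lebesgue_on D) g"
    and le: "AE x in lebesgue_on D. (u x)\<^sup>2 \<le> g x"
  shows "ip D u u \<le> (LINT x|lebesgue_on D. g x)"
  unfolding ip_def
  by (rule integral_mono_AE[OF L2_mult_integrable[OF u u] g]) (use le in \<open>simp add: power2_eq_square\<close>)

lemma AE_not_finite:
  fixes T :: "real set"
  assumes "finite T" "D \<in> sets lebesgue"
  shows "AE x in lebesgue_on D. x \<notin> T"
proof -
  have "AE x in lebesgue. x \<notin> T"
    by (rule AE_completion, rule AE_not_in) (use assms in \<open>auto simp: finite_imp_null_set_lborel\<close>)
  then show ?thesis using assms(2) by (subst AE_restrict_space_iff) auto
qed

lemma integrable_const_interval: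
  fixes a b c :: real
  shows "integrable (lebesgue_on {a<..<b}) (\<lambda>x. c)"
  by (rule finite_measure.integrable_const[OF finite_measure_lebesgue_on[OF bounded_set_imp_lmeasurable]]) auto

lemma LINT_eq_integral:
  fixes f :: "real \<Rightarrow> real"
  assumes "integrable (lebesgue_on {a<..<b}) f"
  shows "(LINT x|lebesgue_on {a<..<b}. f x) = integral {a..b} f" "f integrable_on {a..b}"
  using lebesgue_integral_eq_integral[OF assms] has_integral_integral_lebesgue_on[OF assms]
  by (auto simp: integral_open_interval_real integrable_on_Icc_iff_Ioo)

lemma abs_integral_le_LINT:
  fixes h :: "real \<Rightarrow> real"
  assumes h: "integrable (lebesgue_on {a<..<b}) h" and x: "x \<in> {a..b}"
  shows "\<bar>integral {a..x} h\<bar> \<le> (LINT x|lebesgue_on {a<..<b}. \<bar>h x\<bar>)"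
proof -
  have i: "h integrable_on {a..b}" "(\<lambda>x. \<bar>h x\<bar>) integrable_on {a..b}"
    using LINT_eq_integral(2)[OF h] LINT_eq_integral(2)[of a b "\<lambda>x. \<bar>h x\<bar>"] h by auto
  have ix: "h integrable_on {a..x}" "(\<lambda>x. \<bar>h x\<bar>) integrable_on {a..x}"
    using i x by (auto elim!: integrable_subinterval_real)
  have "\<bar>integral {a..x} h\<bar> \<le> integral {a..x} (\<lambda>x. \<bar>h x\<bar>)"
    using integral_norm_bound_integral[OF ix] by auto
  also have "\<dots> \<le> integral {a..b} (\<lambda>x. \<bar>h x\<bar>)"
    by (rule integral_subset_le) (use ix i x in auto)
  also have "\<dots> = (LINT x|lebesgue_on {a<..<b}. \<bar>h x\<bar>)"
    by (rule LINT_eq_integral(1)[symmetric]) (use h in auto)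
  finally show ?thesis .
qed

lemma piecewise_continuous_L2:
  fixes g :: "real \<Rightarrow> real"
  assumes T: "finite T" and c: "\<And>x. x \<in> {a<..<b} - T \<Longrightarrow> isCont g x"
    and B: "\<And>x. x \<in> {a<..<b} - T \<Longrightarrow> \<bar>g x\<bar> \<le> B"
  shows "g \<in> L2 {a<..<b}"
proof (rule bounded_L2)
  let ?D = "{a<..<b}"
  have D: "?D - T \<in> sets lebesgue" using T by (intro sets.Diff) (auto intro!: sets_completionI_sets borel_closed finite_imp_closed)
  have "continuous_on (?D - T) g" using c by (simp add: continuous_at_imp_continuous_on)
  then have "g \<in> borel_measurable (lebesgue_on (?D - T))"
    using D by (rule continuous_imp_measurable_on_sets_lebesgue)
  then have 1: "(\<lambda>x. indicator (?D - T) x *\<^sub>R g x) \<in> borel_measurable lebesgue"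
    using D by (subst (asm) borel_measurable_restrict_space_iff) auto
  have "(\<lambda>x. indicator (?D - T) x *\<^sub>R g x + (\<Sum>t\<in>T \<inter> ?D. g t * indicator {t} x)) \<in> borel_measurable lebesgue"
    by (intro borel_measurable_add 1 borel_measurable_sum borel_measurable_times borel_measurable_indicator) auto
  moreover have "indicator (?D - T) x *\<^sub>R g x + (\<Sum>t\<in>T \<inter> ?D. g t * indicator {t} x) = indicator ?D x *\<^sub>R g x" for x
  proof (cases "x \<in> T \<inter> ?D")
    case True
    then have "(\<Sum>t\<in>T \<inter> ?D. g t * indicator {t} x) = g x"
      using T by (subst sum.remove[of _ x]) (auto intro!: sum.neutral)
    then show ?thesis using True by simp
  next
    case False
    then have "(\<Sum>t\<in>T \<inter> ?D. g t * indicator {t} x) = 0"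
      by (intro sum.neutral) (auto simp: indicator_def)
    then show ?thesis using False by (auto simp: indicator_def)
  qed
  ultimately show "g \<in> borel_measurable (lebesgue_on ?D)"
    by (subst borel_measurable_restrict_space_iff) auto
  fix x assume x: "x \<in> ?D"
  show "\<bar>g x\<bar> \<le> \<bar>B\<bar> + (\<Sum>t\<in>T. \<bar>g t\<bar>)"
  proof (cases "x \<in> T")
    case True
    then have "\<bar>g x\<bar> \<le> (\<Sum>t\<in>T. \<bar>g t\<bar>)" using T by (intro member_le_sum) auto
    then show ?thesis by simp
  next
    case False
    then have "\<bar>g x\<bar> \<le> B" using B x by auto
    moreover have "(\<Sum>t\<in>T. \<bar>g t\<bar>) \<ge> 0" by (intro sum_nonneg) auto
    ultimately show ?thesis by linarith
  qed
qed auto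

lemma DERIV_within_imp_continuous:
  "(\<And>x. x \<in> A \<Longrightarrow> (f has_real_derivative f' x) (at x within A)) \<Longrightarrow> continuous_on A f"
  by (meson DERIV_continuous continuous_on_eq_continuous_within)

lemma DERIV_within_interior:
  "(f has_real_derivative D) (at x within {a..b}) \<Longrightarrow> x \<in> {a<..<b} \<Longrightarrow> (f has_real_derivative D) (at x)"
  using at_within_interior[of x "{a..b}"] by simp

lemma continuous_Icc_bound:
  fixes h :: "real \<Rightarrow> real"
  assumes "continuous_on {a..b} h"
  obtains B where "B \<ge> 0" "\<And>x. x \<in> {a..b} \<Longrightarrow> \<bar>h x\<bar> \<le> B"
proof -
  have "compact (h ` {a..b})" using assms by (intro compact_continuous_image) auto
  then obtain B where B: "\<And>x. x \<in> {a..b} \<Longrightarrow> \<bar>h x\<bar> \<le> B"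
    using compact_imp_bounded[of "h ` {a..b}"] by (force simp: bounded_iff)
  then have "\<And>x. x \<in> {a..b} \<Longrightarrow> \<bar>h x\<bar> \<le> \<bar>B\<bar>" by fastforce
  then show ?thesis using that[of "\<bar>B\<bar>"] by simp
qed

lemma continuous_Icc_L2:
  assumes "continuous_on {a..b} h" shows "h \<in> L2 {a<..<b}"
proof -
  obtain B where B: "\<And>x. x \<in> {a..b} \<Longrightarrow> \<bar>h x\<bar> \<le> B" using continuous_Icc_bound[OF assms] by blast
  have "isCont h x" if "x \<in> {a<..<b}" for x
    using assms that by (intro continuous_on_interior[of "{a..b}"]) auto
  then show ?thesis using B by (intro piecewise_continuous_L2[of "{}" a b h B]) auto
qed

lemma LINT_FTC:
  fixes F :: "real \<Rightarrow> real"
  assumes T: "finite T" and ab: "a \<le> b" and F: "continuous_on {a..b} F"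
    and d: "\<And>x. x \<in> {a<..<b} - T \<Longrightarrow> (F has_real_derivative f x) (at x)"
    and f: "integrable (lebesgue_on {a<..<b}) f"
  shows "(LINT x|lebesgue_on {a<..<b}. f x) = F b - F a"
proof -
  have "(f has_integral (F b - F a)) {a..b}"
    by (rule fundamental_theorem_of_calculus_interior_strong[OF T ab _ F])
      (use d in \<open>simp add: has_real_derivative_iff_has_vector_derivative\<close>)
  then show ?thesis using LINT_eq_integral(1)[OF f] by (simp add: integral_unique)
qed

text \<open>
  Compact support of \<open>g\<close> makes the antiderivative vanish near \<open>l\<close>, zero mean makes it vanish near \<open>r\<close>.
\<close>

lemma antiderivative_test_fun:
  fixes g :: "real \<Rightarrow> real"
  assumes g: "continuous_on UNIV g" and K: "compact K" "K \<subseteq> {l<..<r}" "\<And>x. x \<notin> K \<Longrightarrow> g x = 0"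
    and lr: "l < r" and z: "integral {l..r} g = 0"
  shows "test_fun {l<..<r} (\<lambda>x. integral {l..x} g)" "deriv (\<lambda>x. integral {l..x} g) = g"
proof -
  let ?\<phi> = "\<lambda>x. integral {l..x} g"
  obtain p q where pq: "K \<subseteq> {p..q}" "l < p" "q < r" "p \<le> q"
  proof (cases "K = {}")
    case True then show ?thesis using that[of "(l+r)/2" "(l+r)/2"] lr by auto
  next
    case False
    obtain p where p: "p \<in> K" "\<And>x. x \<in> K \<Longrightarrow> p \<le> x" using compact_attains_inf[OF K(1) False] by auto
    obtain q where q: "q \<in> K" "\<And>x. x \<in> K \<Longrightarrow> x \<le> q" using compact_attains_sup[OF K(1) False] by auto
    show ?thesis by (rule that[of p q]) (use p q K(2) in auto)
  qed
  have gi: "g integrable_on {s..t}" for s t by (intro integrable_continuous_real continuous_on_subset[OF g]) auto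
  have low: "?\<phi> x = 0" if "x < p" for x
    by (rule integral_unique[OF has_integral_is_0]) (use that pq K(3) in \<open>force\<close>)
  have high: "?\<phi> x = 0" if "q < x" for x
  proof -
    have sup: "(g has_integral i) S" if "(g has_integral i) {l..q}" "{l..q} \<subseteq> S" for i S
      by (rule has_integral_on_superset[OF that(1) _ that(2)]) (use pq K(2,3) in force)
    have "(g has_integral (?\<phi> q)) {l..q}" using gi by (simp add: integrable_integral)
    then have "(g has_integral (?\<phi> q)) {l..r}" "(g has_integral (?\<phi> q)) {l..x}"
      using sup[of "?\<phi> q"] that pq by auto
    then show ?thesis using z by (simp add: integral_unique)
  qed
  have D: "(?\<phi> has_real_derivative g x) (at x)" for x
  proof (cases "x > l")
    case True
    have "(?\<phi> has_real_derivative g x) (at x within {l..x+1})"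
      by (rule integral_has_real_derivative) (use True in \<open>auto intro: continuous_on_subset[OF g]\<close>)
    moreover have "x \<in> interior {l..x+1}" using True by simp
    ultimately show ?thesis using at_within_interior by metis
  next
    case False
    have "((\<lambda>x. 0) has_real_derivative 0) (at x)" by simp
    moreover have "\<forall>\<^sub>F s in nhds x. ?\<phi> s = 0"
      using eventually_nhds_in_open[of "{..<p}" x] False pq low by (auto elim!: eventually_mono)
    moreover have "g x = 0" using False pq K(3)[of x] by force
    ultimately show ?thesis by (subst DERIV_cong_ev[OF refl _ refl]) auto
  qed
  then show dd: "deriv ?\<phi> = g" by (intro ext DERIV_imp_deriv)
  have cl: "closure {x. ?\<phi> x \<noteq> 0} \<subseteq> {p..q}"
  proof (intro closure_minimal subsetI)
    fix x assume "x \<in> {x. ?\<phi> x \<noteq> 0}"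
    then have "\<not> x < p" "\<not> q < x" using low[of x] high[of x] by auto
    then show "x \<in> {p..q}" by simp
  qed simp
  moreover have "bounded (closure {x. ?\<phi> x \<noteq> 0})" by (rule bounded_subset[OF bounded_closed_interval cl])
  ultimately show "test_fun {l<..<r} ?\<phi>"
    unfolding test_fun_def dd using D g pq
    by (auto simp: real_differentiable_def compact_eq_bounded_closed)
qed

text \<open>
  Subtracting a multiple of a fixed function of mass one corrects the mean of any other function.
\<close>

lemma unit_mass_tent:
  fixes l r :: real
  assumes "l < r"
  obtains \<rho> K where "continuous_on UNIV \<rho>" "compact K" "K \<subseteq> {l<..<r}"
    "\<And>x. x \<notin> K \<Longrightarrow> \<rho> x = 0" "integral {l..r} \<rho> = (1::real)"
proof -
  define m \<delta> where "m = (l + r) / 2" and "\<delta> = (r - l) / 4"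
  define t where "t = (\<lambda>x. max 0 (\<delta> - \<bar>x - m\<bar>))"
  have c: "continuous_on S t" for S unfolding t_def by (intro continuous_intros)
  have nz: "integral {l..r} t \<noteq> 0"
  proof
    assume "integral {l..r} t = 0"
    then have "\<forall>x\<in>{l..r}. t x = 0"
      using integral_eq_0_iff[of l r t] assms c by (auto simp: t_def)
    moreover have "m \<in> {l..r}" "t m > 0" using assms by (auto simp: m_def t_def \<delta>_def)
    ultimately show False by force
  qed
  then have int: "integral {l..r} (\<lambda>x. t x / integral {l..r} t) = 1" by simp
  have "cball m \<delta> \<subseteq> {l<..<r}"
  proof
    fix x assume "x \<in> cball m \<delta>"
    then have "\<bar>m - x\<bar> \<le> \<delta>" by (simp add: dist_real_def)
    then have "m - \<delta> \<le> x" "x \<le> m + \<delta>" by linarith+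
    then show "x \<in> {l<..<r}" using assms by (simp add: m_def \<delta>_def field_simps)
  qed
  moreover have "t x / integral {l..r} t = 0" if "x \<notin> cball m \<delta>" for x
    using that by (auto simp: t_def dist_real_def)
  moreover have "continuous_on UNIV (\<lambda>x. t x / integral {l..r} t)"
    by (cases "integral {l..r} t = 0") (auto intro!: continuous_intros c)
  ultimately show ?thesis by (intro that[OF _ _ _ _ int, of "cball m \<delta>"]) auto
qed

lemma mean_corrected_test_fun:
  fixes g :: "real \<Rightarrow> real"
  assumes g: "continuous_on UNIV g" and K: "compact K" "K \<subseteq> {l<..<r}" "\<And>x. x \<notin> K \<Longrightarrow> g x = 0"
    and \<rho>: "continuous_on UNIV \<rho>" "compact K'" "K' \<subseteq> {l<..<r}" "\<And>x. x \<notin> K' \<Longrightarrow> \<rho> x = 0"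
      "integral {l..r} \<rho> = (1::real)" and lr: "l < r"
  defines "h \<equiv> \<lambda>x. g x - integral {l..r} g * \<rho> x"
  shows "test_fun {l<..<r} (\<lambda>x. integral {l..x} h)" "deriv (\<lambda>x. integral {l..x} h) = h"
proof -
  have gi: "g integrable_on {l..r}" "\<rho> integrable_on {l..r}"
    by (auto intro!: integrable_continuous_real continuous_on_subset[OF g] continuous_on_subset[OF \<rho>(1)])
  have h: "continuous_on UNIV h" unfolding h_def by (intro continuous_intros g \<rho>)
  have I: "integral {l..r} h = 0"
    unfolding h_def using gi \<rho>(5) by (subst Henstock_Kurzweil_Integration.integral_diff) (auto intro: integrable_on_mult_right)
  have 0: "h x = 0" if "x \<notin> K \<union> K'" for x using that K(3) \<rho>(4) by (simp add: h_def)
  have "compact (K \<union> K')" "K \<union> K' \<subseteq> {l<..<r}" using K \<rho> by auto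
  note * = antiderivative_test_fun[OF h this 0 lr I]
  show "test_fun {l<..<r} (\<lambda>x. integral {l..x} h)" by (rule *(1))
  show "deriv (\<lambda>x. integral {l..x} h) = h" by (rule *(2))
qed

text \<open>
  The given orthogonality concerns derivatives of test functions, that is, continuous functions of compact support
  with zero mean. An arbitrary test function \<open>\<psi>\<close> differs from one of these by a multiple of the function \<open>\<rho>\<close> of
  mass one, so \<open>z\<close> minus the constant \<open>ip z \<rho>\<close> is orthogonal to all \<open>\<psi>\<close>.
\<close>

lemma du_Bois_Reymond:
  assumes z: "z \<in> L2 {l<..<r}" and lr: "l < r"
    and o: "\<And>\<phi>. test_fun {l<..<r} \<phi> \<Longrightarrow> ip {l<..<r} z (deriv \<phi>) = 0"
  obtains c where "AE x in lebesgue_on {l<..<r}. z x = c"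
proof -
  let ?D = "{l<..<r}"
  have D: "bounded ?D" "?D \<in> sets lebesgue" by auto
  obtain \<rho> K' where \<rho>: "continuous_on UNIV \<rho>" "compact K'" "K' \<subseteq> ?D"
    "\<And>x. x \<notin> K' \<Longrightarrow> \<rho> x = 0" "integral {l..r} \<rho> = (1::real)" using unit_mass_tent[OF lr] by blast
  have \<rho>L: "\<rho> \<in> L2 ?D" by (rule continuous_Icc_L2) (rule continuous_on_subset[OF \<rho>(1)], simp)
  define c where "c = ip ?D z \<rho>"
  have cL: "(\<lambda>x. c) \<in> L2 ?D" using L2_cmult[OF one_L2[OF D], of c] by simp
  have "AE x in lebesgue_on ?D. z x - c = 0"
  proof (rule fundamental_lemma)
    show "integrable (lebesgue_on ?D) (\<lambda>x. z x - c)"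
      by (rule L2_integrable[OF D L2_diff[OF z cL]])
    fix \<psi> assume t: "test_fun ?D \<psi>"
    note f = test_fun_facts[OF t]
    note \<psi>L = test_fun_L2(1)[OF t D]
    define h where "h = (\<lambda>x. \<psi> x - integral {l..r} \<psi> * \<rho> x)"
    have sub: "closure {x. \<psi> x \<noteq> 0} \<subseteq> ?D" using t by (simp add: test_fun_def)
    note m = mean_corrected_test_fun[OF f(2) f(7) sub f(6) \<rho> lr, folded h_def]
    have "0 = ip ?D z h" using o[OF m(1)] m(2) by simp
    also have "\<dots> = ip ?D z \<psi> - integral {l..r} \<psi> * c"
      unfolding h_def c_def
      by (subst ip_diff2[OF \<psi>L L2_cmult[OF \<rho>L] z]) (simp add: ip_commute[of ?D z] ip_cmult)
    also have "integral {l..r} \<psi> = (LINT x|lebesgue_on ?D. \<psi> x)"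
      by (rule LINT_eq_integral(1)[symmetric]) (rule L2_integrable[OF D \<psi>L])
    finally show "ip ?D (\<lambda>x. z x - c) \<psi> = 0"
      by (subst ip_diff[OF z cL \<psi>L]) (simp add: ip_def mult.commute)
  qed
  then show ?thesis by (intro that[of c]) (auto elim: eventually_mono)
qed

section \<open>Sobolev functions on an interval\<close>

lemma wderiv_AE:
  assumes "has_weak_deriv {l<..<r} u g"
  shows "AE x in lebesgue_on {l<..<r}. wderiv {l<..<r} u x = g x"
  using weak_deriv_unique[OF wderiv[OF H1I[OF assms]] assms] .

lemma H01_weak_deriv: "u \<in> H01 D \<Longrightarrow> has_weak_deriv D u (wderiv D u)"
  by (simp add: H01_def wderiv)

lemma H01_L2: assumes "u \<in> H01 D" shows "u \<in> L2 D" "wderiv D u \<in> L2 D"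
  using H01_weak_deriv[OF assms] by (auto simp: has_weak_deriv_def)

lemma ip_wderiv_eq:
  assumes "has_weak_deriv {l<..<r} u g" "v \<in> L2 {l<..<r}"
  shows "ip {l<..<r} (wderiv {l<..<r} u) v = ip {l<..<r} g v"
  using wderiv_AE[OF assms(1)] assms wderiv[OF H1I[OF assms(1)]]
  by (intro ip_cong_AE) (auto simp: has_weak_deriv_def)

lemma H1_norm_sq:
  assumes "has_weak_deriv {l<..<r} u g"
  shows "(H1_norm {l<..<r} u)\<^sup>2 = ip {l<..<r} u u + ip {l<..<r} g g"
proof -
  have L: "g \<in> L2 {l<..<r}" "wderiv {l<..<r} u \<in> L2 {l<..<r}"
    using assms wderiv[OF H1I[OF assms]] by (auto simp: has_weak_deriv_def)
  have "ip {l<..<r} (wderiv {l<..<r} u) (wderiv {l<..<r} u) = ip {l<..<r} g g"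
    using ip_wderiv_eq[OF assms] L by (metis ip_commute)
  then show ?thesis by (simp add: H1_norm_def L2_norm_sq ip_self_nonneg)
qed

lemma H01I_approx:
  assumes w: "has_weak_deriv {l<..<r} u g" and lr: "l \<le> r"
    and t: "\<And>n::nat. test_fun {l<..<r} (\<phi> n)"
    and 0: "(\<lambda>n. ip {l<..<r} (\<lambda>x. u x - \<phi> n x) (\<lambda>x. u x - \<phi> n x)) \<longlonglongrightarrow> 0"
    and 1: "(\<lambda>n. ip {l<..<r} (\<lambda>x. g x - deriv (\<phi> n) x) (\<lambda>x. g x - deriv (\<phi> n) x)) \<longlonglongrightarrow> 0"
  shows "u \<in> H01 {l<..<r}"
proof -
  let ?D = "{l<..<r}"
  have "has_weak_deriv ?D (\<lambda>x. u x - \<phi> n x) (\<lambda>x. g x - deriv (\<phi> n) x)" for n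
    by (rule has_weak_deriv_diff[OF w test_fun_weak_deriv[OF t lr]]) auto
  note eq = H1_norm_sq[OF this]
  have "(\<lambda>n. (H1_norm ?D (\<lambda>x. u x - \<phi> n x))\<^sup>2) \<longlonglongrightarrow> 0 + 0"
    unfolding eq by (intro tendsto_add 0 1)
  then have "(\<lambda>n. sqrt ((H1_norm ?D (\<lambda>x. u x - \<phi> n x))\<^sup>2)) \<longlonglongrightarrow> sqrt (0 + 0)"
    by (rule tendsto_real_sqrt)
  then have "(\<lambda>n. H1_norm ?D (\<lambda>x. u x - \<phi> n x)) \<longlonglongrightarrow> 0" by (simp add: H1_norm_def)
  then show ?thesis unfolding H01_def using H1I[OF w] t by auto
qed

lemma H01_diff:
  assumes u: "u \<in> H01 {l<..<r}" and v: "v \<in> H01 {l<..<r}" and lr: "l \<le> r"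
  shows "(\<lambda>x. u x - v x) \<in> H01 {l<..<r}"
proof -
  let ?D = "{l<..<r}"
  have D: "bounded ?D" "?D \<in> sets lebesgue" by auto
  obtain \<phi> where p: "\<And>n::nat. test_fun ?D (\<phi> n)"
    "(\<lambda>n. ip ?D (\<lambda>x. u x - \<phi> n x) (\<lambda>x. u x - \<phi> n x)) \<longlonglongrightarrow> 0"
    "(\<lambda>n. ip ?D (\<lambda>x. wderiv ?D u x - deriv (\<phi> n) x) (\<lambda>x. wderiv ?D u x - deriv (\<phi> n) x)) \<longlonglongrightarrow> 0"
    using H01_approx[OF u lr] by auto
  obtain \<psi> where q: "\<And>n::nat. test_fun ?D (\<psi> n)"
    "(\<lambda>n. ip ?D (\<lambda>x. v x - \<psi> n x) (\<lambda>x. v x - \<psi> n x)) \<longlonglongrightarrow> 0"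
    "(\<lambda>n. ip ?D (\<lambda>x. wderiv ?D v x - deriv (\<psi> n) x) (\<lambda>x. wderiv ?D v x - deriv (\<psi> n) x)) \<longlonglongrightarrow> 0"
    using H01_approx[OF v lr] by auto
  have dd: "deriv (\<lambda>x. \<phi> n x - \<psi> n x) = (\<lambda>x. deriv (\<phi> n) x - deriv (\<psi> n) x)" for n
    by (rule ext, rule DERIV_imp_deriv) (auto intro!: derivative_eq_intros test_fun_facts(1)[OF p(1)] test_fun_facts(1)[OF q(1)])
  have t: "test_fun ?D (\<lambda>x. \<phi> n x - \<psi> n x)" for n
  proof -
    have sub: "closure {x. \<phi> n x - \<psi> n x \<noteq> 0} \<subseteq> closure {x. \<phi> n x \<noteq> 0} \<union> closure {x. \<psi> n x \<noteq> 0}"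
      by (subst closure_Un[symmetric]) (rule closure_mono, auto)
    moreover have "bounded (closure {x. \<phi> n x \<noteq> 0} \<union> closure {x. \<psi> n x \<noteq> 0})"
      using test_fun_facts(7)[OF p(1)[of n]] test_fun_facts(7)[OF q(1)[of n]] by (auto intro: compact_imp_bounded)
    ultimately have "compact (closure {x. \<phi> n x - \<psi> n x \<noteq> 0})"
      unfolding compact_eq_bounded_closed by (intro conjI closed_closure) (rule bounded_subset)
    moreover have "closure {x. \<phi> n x - \<psi> n x \<noteq> 0} \<subseteq> ?D"
      using sub p(1)[of n] q(1)[of n] by (auto simp: test_fun_def)
    ultimately show ?thesis using p(1)[of n] q(1)[of n]
      unfolding test_fun_def dd by (auto intro!: continuous_intros derivative_intros)
  qed
  have lim: "(\<lambda>n. ip ?D (\<lambda>x. f x - h x - (a n x - c n x)) (\<lambda>x. f x - h x - (a n x - c n x))) \<longlonglongrightarrow> 0"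
    if "f \<in> L2 ?D" "h \<in> L2 ?D" "\<And>n. a n \<in> L2 ?D" "\<And>n. c n \<in> L2 ?D"
      "(\<lambda>n. ip ?D (\<lambda>x. f x - a n x) (\<lambda>x. f x - a n x)) \<longlonglongrightarrow> 0"
      "(\<lambda>n. ip ?D (\<lambda>x. h x - c n x) (\<lambda>x. h x - c n x)) \<longlonglongrightarrow> 0" for f h and a c :: "nat \<Rightarrow> real \<Rightarrow> real"
  proof (rule tendsto_sandwich[OF _ _ tendsto_const])
    show "(\<lambda>n. 2 * ip ?D (\<lambda>x. f x - a n x) (\<lambda>x. f x - a n x) + 2 * ip ?D (\<lambda>x. h x - c n x) (\<lambda>x. h x - c n x)) \<longlonglongrightarrow> 0"
      using tendsto_add[OF tendsto_mult_left[OF that(5), of 2] tendsto_mult_left[OF that(6), of 2]] by simp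
    have eq: "(\<lambda>x. f x - h x - (a n x - c n x)) = (\<lambda>x. (f x - a n x) - (h x - c n x))" for n by auto
    show "\<forall>\<^sub>F n in sequentially. ip ?D (\<lambda>x. f x - h x - (a n x - c n x)) (\<lambda>x. f x - h x - (a n x - c n x))
       \<le> 2 * ip ?D (\<lambda>x. f x - a n x) (\<lambda>x. f x - a n x) + 2 * ip ?D (\<lambda>x. h x - c n x) (\<lambda>x. h x - c n x)"
      unfolding eq by (intro always_eventually allI ip_diff_self_le L2_diff that)
  qed (simp add: ip_self_nonneg)
  show ?thesis
  proof (rule H01I_approx[OF has_weak_deriv_diff[OF H01_weak_deriv[OF u] H01_weak_deriv[OF v] D] lr t])
    show "(\<lambda>n. ip ?D (\<lambda>x. u x - v x - (\<phi> n x - \<psi> n x)) (\<lambda>x. u x - v x - (\<phi> n x - \<psi> n x))) \<longlonglongrightarrow> 0"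
      by (intro lim H01_L2 u v test_fun_L2(1)[OF _ D] p q)
    show "(\<lambda>n. ip ?D (\<lambda>x. wderiv ?D u x - wderiv ?D v x - deriv (\<lambda>x. \<phi> n x - \<psi> n x) x)
       (\<lambda>x. wderiv ?D u x - wderiv ?D v x - deriv (\<lambda>x. \<phi> n x - \<psi> n x) x)) \<longlonglongrightarrow> 0"
      unfolding dd by (intro lim H01_L2 u v test_fun_L2(2)[OF _ D] p q)
  qed
qed

text \<open>
  The left-hand side is continuous in the \<open>H\<^sup>1\<close> norm, in which the test functions are dense in \<open>H\<^sub>0\<^sup>1\<close>.
\<close>

lemma weak_identity_extends_to_H01:
  assumes p: "p \<in> L2 {l<..<r}" and q: "q \<in> L2 {l<..<r}" and lr: "l \<le> r"
    and t: "\<And>\<phi>. test_fun {l<..<r} \<phi> \<Longrightarrow> ip {l<..<r} p (deriv \<phi>) + ip {l<..<r} q \<phi> = 0"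
    and v: "v \<in> H01 {l<..<r}"
  shows "ip {l<..<r} p (wderiv {l<..<r} v) + ip {l<..<r} q v = 0"
proof -
  let ?D = "{l<..<r}"
  have D: "bounded ?D" "?D \<in> sets lebesgue" by auto
  obtain \<phi> where a: "\<And>n::nat. test_fun ?D (\<phi> n)"
    "(\<lambda>n. ip ?D (\<lambda>x. v x - \<phi> n x) (\<lambda>x. v x - \<phi> n x)) \<longlonglongrightarrow> 0"
    "(\<lambda>n. ip ?D (\<lambda>x. wderiv ?D v x - deriv (\<phi> n) x) (\<lambda>x. wderiv ?D v x - deriv (\<phi> n) x)) \<longlonglongrightarrow> 0"
    using H01_approx[OF v lr] by auto
  note L = H01_L2[OF v] test_fun_L2[OF a(1) D]
  have "(\<lambda>n. ip ?D p (\<lambda>x. wderiv ?D v x - deriv (\<phi> n) x) + ip ?D q (\<lambda>x. v x - \<phi> n x)) \<longlonglongrightarrow> 0 + 0"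
    by (intro tendsto_add ip_tendsto_0 p q L2_diff L a)
  moreover have "ip ?D p (\<lambda>x. wderiv ?D v x - deriv (\<phi> n) x) + ip ?D q (\<lambda>x. v x - \<phi> n x)
     = ip ?D p (wderiv ?D v) + ip ?D q v" for n
    using t[OF a(1)[of n]] by (simp add: ip_diff2 L p q)
  ultimately show ?thesis by (simp add: LIMSEQ_const_iff)
qed

text \<open>
  For two test functions this is the fundamental theorem of calculus; the density of the test functions is then used
  in each argument in turn.
\<close>

lemma H01_integration_by_parts:
  assumes b: "\<And>x. x \<in> {l..r} \<Longrightarrow> (b has_real_derivative b' x) (at x within {l..r})"
    and b': "continuous_on {l..r} b'" and lr: "l \<le> r"
    and u: "u \<in> H01 {l<..<r}" and v: "v \<in> H01 {l<..<r}"
  shows "ip {l<..<r} (\<lambda>x. b x * wderiv {l<..<r} u x) v + ip {l<..<r} (\<lambda>x. b' x * u x) v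
     + ip {l<..<r} (\<lambda>x. b x * u x) (wderiv {l<..<r} v) = 0"
proof -
  let ?D = "{l<..<r}"
  have D: "bounded ?D" "?D \<in> sets lebesgue" by auto
  have bc: "continuous_on {l..r} b" using b by (meson DERIV_continuous continuous_on_eq_continuous_within)
  have bm: "(\<lambda>x. h x * w x) \<in> L2 ?D" if hc: "continuous_on {l..r} h" and wL: "w \<in> L2 ?D" for h w :: "real \<Rightarrow> real"
  proof -
    obtain B where B: "\<And>x. x \<in> {l..r} \<Longrightarrow> \<bar>h x\<bar> \<le> B" using continuous_Icc_bound[OF hc] by blast
    show ?thesis by (rule L2_bounded_mult[OF wL L2_meas[OF continuous_Icc_L2[OF hc]], of B]) (use B in auto)
  qed
  have test: "ip ?D (\<lambda>x. b x * \<psi> x) (deriv \<phi>) + ip ?D (\<lambda>x. b' x * \<psi> x + b x * deriv \<psi> x) \<phi> = 0"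
    if t: "test_fun ?D \<phi>" and s: "test_fun ?D \<psi>" for \<phi> \<psi>
  proof -
    note f = test_fun_facts[OF t] and g = test_fun_facts[OF s]
    note L = test_fun_L2[OF t D] test_fun_L2[OF s D]
    have "ip ?D (\<lambda>x. b x * \<psi> x) (deriv \<phi>) + ip ?D (\<lambda>x. b' x * \<psi> x + b x * deriv \<psi> x) \<phi>
      = (LINT x|lebesgue_on ?D. b x * \<psi> x * deriv \<phi> x + (b' x * \<psi> x + b x * deriv \<psi> x) * \<phi> x)"
      unfolding ip_def by (rule Bochner_Integration.integral_add[symmetric]) (intro L2_mult_integrable bm L2_add bc b' L)+
    also have "\<dots> = b r * \<psi> r * \<phi> r - b l * \<psi> l * \<phi> l"
    proof (rule LINT_FTC[of "{}"])
      show "continuous_on {l..r} (\<lambda>x. b x * \<psi> x * \<phi> x)"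
        by (intro continuous_intros bc continuous_on_subset[OF f(2)] continuous_on_subset[OF g(2)]) auto
      fix x assume x: "x \<in> ?D - {}"
      then have "(b has_real_derivative b' x) (at x)" using DERIV_within_interior[OF b] by simp
      then show "((\<lambda>x. b x * \<psi> x * \<phi> x) has_real_derivative
          b x * \<psi> x * deriv \<phi> x + (b' x * \<psi> x + b x * deriv \<psi> x) * \<phi> x) (at x)"
        by (auto intro!: derivative_eq_intros f(1) g(1) simp: algebra_simps)
    qed (use lr in \<open>auto intro!: Bochner_Integration.integrable_add L2_mult_integrable bm L2_add bc b' L\<close>)
    also have "\<dots> = 0" using f(4)[of l] f(4)[of r] by simp
    finally show ?thesis .
  qed
  have half: "ip ?D (\<lambda>x. b x * \<psi> x) (wderiv ?D v) + ip ?D (\<lambda>x. b' x * \<psi> x + b x * deriv \<psi> x) v = 0"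
    if s: "test_fun ?D \<psi>" for \<psi>
    by (rule weak_identity_extends_to_H01[OF _ _ lr _ v])
      (intro test s L2_add bm bc b' test_fun_L2[OF s D])+
  have eq: "ip ?D (\<lambda>x. h x * w x) z = ip ?D (\<lambda>x. h x * z x) w" for h w z
    by (simp add: ip_def mult_ac)
  have "ip ?D (\<lambda>x. b x * v x) (wderiv ?D u) + ip ?D (\<lambda>x. b' x * v x + b x * wderiv ?D v x) u = 0"
  proof (rule weak_identity_extends_to_H01[OF _ _ lr _ u])
    show "(\<lambda>x. b x * v x) \<in> L2 ?D" "(\<lambda>x. b' x * v x + b x * wderiv ?D v x) \<in> L2 ?D"
      by (intro bm L2_add bc b' H01_L2 v)+
    fix \<psi> assume s: "test_fun ?D \<psi>"
    note L = test_fun_L2[OF s D] H01_L2[OF v]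
    show "ip ?D (\<lambda>x. b x * v x) (deriv \<psi>) + ip ?D (\<lambda>x. b' x * v x + b x * wderiv ?D v x) \<psi> = 0"
      using half[OF s] by (simp add: ip_add bm bc b' L eq[of b "deriv \<psi>" v] eq[of b' \<psi> v] eq[of b \<psi> "wderiv ?D v"])
  qed
  then show ?thesis
    by (simp add: ip_add bm bc b' H01_L2 u v eq[of b _ u] eq[of b' _ u] eq[of b "wderiv ?D u" v])
qed

text \<open>
  The approximating test functions are the antiderivatives of their derivatives, which converge in \<open>L\<^sup>2\<close>, hence in
  \<open>L\<^sup>1\<close>. So they converge uniformly to the antiderivative of the weak derivative, and the boundary values survive.
\<close>

lemma H01_continuous_representative:
  assumes u: "u \<in> H01 {l<..<r}" and lr: "l < r"
  obtains U where "continuous_on {l..r} U" "U l = 0" "U r = 0"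
    "AE x in lebesgue_on {l<..<r}. u x = U x"
    "\<And>x. x \<in> {l..r} \<Longrightarrow> U x = integral {l..x} (wderiv {l<..<r} u)"
proof -
  let ?D = "{l<..<r}"
  have D: "bounded ?D" "?D \<in> sets lebesgue" by auto
  define V where "V = wderiv ?D u"
  define U where "U = (\<lambda>x. integral {l..x} V)"
  obtain \<phi> where a: "\<And>n::nat. test_fun ?D (\<phi> n)"
    "(\<lambda>n. ip ?D (\<lambda>x. u x - \<phi> n x) (\<lambda>x. u x - \<phi> n x)) \<longlonglongrightarrow> 0"
    "(\<lambda>n. ip ?D (\<lambda>x. V x - deriv (\<phi> n) x) (\<lambda>x. V x - deriv (\<phi> n) x)) \<longlonglongrightarrow> 0"
    using H01_approx[OF u] lr unfolding V_def by auto
  note f = test_fun_facts[OF a(1)]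
  have VL: "V \<in> L2 ?D" using H01_L2[OF u] by (simp add: V_def)
  have Vi: "integrable (lebesgue_on ?D) V" by (rule L2_integrable[OF D VL])
  define e where "e = (\<lambda>n x. V x - deriv (\<phi> n) x)"
  have eL: "e n \<in> L2 ?D" for n unfolding e_def by (intro L2_diff VL test_fun_L2[OF a(1) D])
  have eL': "(\<lambda>x. \<bar>e n x\<bar>) \<in> L2 ?D" for n using eL[of n] by (auto simp: L2_def)
  define s where "s = (\<lambda>n. LINT x|lebesgue_on ?D. \<bar>e n x\<bar>)"
  have "(\<lambda>n. ip ?D (\<lambda>x. 1) (\<lambda>x. \<bar>e n x\<bar>)) \<longlonglongrightarrow> 0"
    by (rule ip_tendsto_0[OF one_L2[OF D] eL']) (use a(3) in \<open>simp add: ip_def e_def\<close>)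
  then have s: "s \<longlonglongrightarrow> 0" by (simp add: s_def ip_def)
  have close: "\<bar>U x - \<phi> n x\<bar> \<le> s n" if x: "x \<in> {l..r}" for x n
  proof -
    have "(deriv (\<phi> n) has_integral (\<phi> n x - \<phi> n l)) {l..x}"
      by (rule fundamental_theorem_of_calculus)
        (use x f(1) in \<open>auto simp: has_real_derivative_iff_has_vector_derivative[symmetric] intro: has_field_derivative_at_within\<close>)
    moreover have "\<phi> n l = 0" by (rule f(4)) simp
    moreover have "V integrable_on {l..x}"
      using LINT_eq_integral(2)[OF Vi] x by (auto elim!: integrable_subinterval_real)
    ultimately have "((\<lambda>x. e n x) has_integral (U x - \<phi> n x)) {l..x}"
      unfolding e_def U_def by (intro has_integral_diff integrable_integral) auto
    then show ?thesis
      using abs_integral_le_LINT[OF L2_integrable[OF D eL[of n]] x] by (simp add: integral_unique s_def)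
  qed
  have Uc: "continuous_on {l..r} U" unfolding U_def
    by (rule indefinite_integral_continuous_1[OF LINT_eq_integral(2)[OF Vi]])
  have UL: "U \<in> L2 ?D" by (rule continuous_Icc_L2[OF Uc])
  have "U r = 0"
  proof -
    have "\<phi> n r = 0" for n by (rule f(4)) simp
    then have "\<bar>U r\<bar> \<le> s n" for n using close[of r n] lr by simp
    then have "\<bar>U r\<bar> \<le> 0" by (intro LIMSEQ_le_const[OF s]) auto
    then show ?thesis by simp
  qed
  moreover have "AE x in lebesgue_on ?D. u x = U x"
  proof -
    have pL: "\<phi> n \<in> L2 ?D" for n by (rule test_fun_L2(1)[OF a(1) D])
    have 1: "ip ?D (\<lambda>x. U x - \<phi> n x) (\<lambda>x. U x - \<phi> n x) \<le> (s n)\<^sup>2 * (LINT x|lebesgue_on ?D. 1)" for n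
    proof -
      have "\<bar>(U x - \<phi> n x)\<bar>\<^sup>2 \<le> (s n)\<^sup>2" if "x \<in> ?D" for x using close[of x n] that by (intro power_mono) auto
      then have "ip ?D (\<lambda>x. U x - \<phi> n x) (\<lambda>x. U x - \<phi> n x) \<le> (LINT x|lebesgue_on ?D. (s n)\<^sup>2)"
        by (intro ip_mono_bound L2_diff UL pL AE_I2 integrable_const_interval) auto
      then show ?thesis by (simp add: mult.commute)
    qed
    have 2: "ip ?D (\<lambda>x. u x - U x) (\<lambda>x. u x - U x) \<le> 2 * ip ?D (\<lambda>x. u x - \<phi> n x) (\<lambda>x. u x - \<phi> n x)
       + 2 * ((s n)\<^sup>2 * (LINT x|lebesgue_on ?D. 1))" for n
      using ip_diff_self_le[OF L2_diff[OF H01_L2(1)[OF u] pL[of n]] L2_diff[OF UL pL[of n]]] 1[of n] by simp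
    have "(\<lambda>n. 2 * ip ?D (\<lambda>x. u x - \<phi> n x) (\<lambda>x. u x - \<phi> n x)
       + 2 * ((s n)\<^sup>2 * (LINT x|lebesgue_on ?D. 1))) \<longlonglongrightarrow> 2 * 0 + 2 * (0\<^sup>2 * (LINT x|lebesgue_on ?D. 1))"
      by (intro tendsto_intros a(2) s)
    then have "ip ?D (\<lambda>x. u x - U x) (\<lambda>x. u x - U x) \<le> 2 * 0 + 2 * (0\<^sup>2 * (LINT x|lebesgue_on ?D. 1))"
      by (rule LIMSEQ_le_const) (use 2 in auto)
    then have "ip ?D (\<lambda>x. u x - U x) (\<lambda>x. u x - U x) = 0"
      using ip_self_nonneg[of ?D "\<lambda>x. u x - U x"] by simp
    then show ?thesis
      using ip_nonneg_eq_0_AE[OF L2_diff[OF H01_L2(1)[OF u] UL]] by simp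
  qed
  ultimately show ?thesis by (intro that[of U] Uc) (auto simp: U_def V_def)
qed

lemma piecewise_C1_weak_deriv:
  fixes v g :: "real \<Rightarrow> real"
  assumes T: "finite T" and lr: "l < r" and vc: "continuous_on {l..r} v"
    and d: "\<And>x. x \<in> {l<..<r} - T \<Longrightarrow> (v has_real_derivative g x) (at x)" and gL: "g \<in> L2 {l<..<r}"
  shows "has_weak_deriv {l<..<r} v g"
  unfolding has_weak_deriv_def
proof (intro conjI allI impI gL)
  let ?D = "{l<..<r}"
  show vL: "v \<in> L2 ?D" by (rule continuous_Icc_L2[OF vc])
  fix \<phi> assume t: "test_fun ?D \<phi>"
  note f = test_fun_facts[OF t]
  have L: "\<phi> \<in> L2 ?D" "deriv \<phi> \<in> L2 ?D" by (rule test_fun_L2[OF t]; simp)+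
  have "ip ?D v (deriv \<phi>) + ip ?D g \<phi> = (LINT x|lebesgue_on ?D. v x * deriv \<phi> x + g x * \<phi> x)"
    unfolding ip_def by (rule Bochner_Integration.integral_add[symmetric]) (intro L2_mult_integrable gL vL L)+
  also have "\<dots> = v r * \<phi> r - v l * \<phi> l"
    by (rule LINT_FTC[OF T])
      (use lr d in \<open>auto intro!: derivative_eq_intros continuous_intros vc continuous_on_subset[OF f(2)] f(1)
          Bochner_Integration.integrable_add L2_mult_integrable gL vL L\<close>)
  finally show "ip ?D v (deriv \<phi>) = - ip ?D g \<phi>" using f(4)[of l] f(4)[of r] by simp
qed

text \<open>
  The derivative \<open>g\<close> is cut off near the points of \<open>T\<close>, which makes it continuous with compact support, and corrected to
  mean zero. The antiderivatives of these functions are test functions that approximate \<open>v\<close> in \<open>H\<^sup>1\<close>; the corrections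
  tend to zero because \<open>g\<close> has mean \<open>v r - v l = 0\<close>.
\<close>

lemma piecewise_C1_H01:
  fixes v g :: "real \<Rightarrow> real"
  assumes T: "finite T" and T01: "l \<in> T" "r \<in> T" and lr: "l < r"
    and vc: "continuous_on {l..r} v" and v0: "v l = 0" "v r = 0"
    and d: "\<And>x. x \<in> {l<..<r} - T \<Longrightarrow> (v has_real_derivative g x) (at x)"
    and gc: "\<And>x. x \<in> {l<..<r} - T \<Longrightarrow> isCont g x"
    and B: "\<And>x. x \<in> {l<..<r} - T \<Longrightarrow> \<bar>g x\<bar> \<le> B"
  shows "has_weak_deriv {l<..<r} v g" "v \<in> H01 {l<..<r}"
proof -
  let ?D = "{l<..<r}"
  have D: "bounded ?D" "?D \<in> sets lebesgue" by auto
  have gL: "g \<in> L2 ?D" by (rule piecewise_continuous_L2[OF T gc B])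
  have vL: "v \<in> L2 ?D" by (rule continuous_Icc_L2[OF vc])
  have gi: "integrable (lebesgue_on ?D) g" by (rule L2_integrable[OF D gL])
  show w: "has_weak_deriv ?D v g" by (rule piecewise_C1_weak_deriv[OF T lr vc d gL])
  obtain \<rho> K' where \<rho>: "continuous_on UNIV \<rho>" "compact K'" "K' \<subseteq> ?D"
    "\<And>x. x \<notin> K' \<Longrightarrow> \<rho> x = 0" "integral {l..r} \<rho> = (1::real)" using unit_mass_tent[OF lr] by blast
  obtain R where R: "R \<ge> 0" "\<And>x. x \<in> {l..r} \<Longrightarrow> \<bar>\<rho> x\<bar> \<le> R"
    using continuous_Icc_bound[OF continuous_on_subset[OF \<rho>(1)]] by blast
  \<comment> \<open>The cut-off vanishes within distance \<open>1 / n\<close> of \<open>T\<close> and equals 1 beyond distance \<open>2 / n\<close>.\<close>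
  define cut where "cut = (\<lambda>(n::nat) x. max 0 (min 1 (real n * infdist x T - 1)))"
  define gn where "gn = (\<lambda>n x. if x \<in> ?D - T then g x * cut n x else 0)"
  define K where "K = (\<lambda>n. {x \<in> {l..r}. 1 \<le> real n * infdist x T})"
  have inf: "continuous_on S (\<lambda>x. infdist x T)" for S
    by (intro continuous_on_infdist continuous_on_id)
  have T': "T \<noteq> {}" using T01 by auto
  have Kc: "compact (K n)" for n
  proof -
    have "closed {x. 1 \<le> real n * infdist x T}" by (intro closed_Collect_le continuous_intros inf)
    then have "compact ({l..r} \<inter> {x. 1 \<le> real n * infdist x T})" by (intro compact_Int_closed) auto
    moreover have "K n = {l..r} \<inter> {x. 1 \<le> real n * infdist x T}" by (auto simp: K_def)
    ultimately show ?thesis by simp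
  qed
  have KD: "K n \<subseteq> ?D" for n
  proof
    fix x assume x: "x \<in> K n"
    have "infdist l T = 0" "infdist r T = 0" using T01 by auto
    then have "x \<noteq> l" "x \<noteq> r" using x unfolding K_def by force+
    then show "x \<in> ?D" using x unfolding K_def by simp
  qed
  have K0: "gn n x = 0" if "x \<notin> K n" for n x
  proof (cases "x \<in> ?D - T")
    case True
    then have "real n * infdist x T < 1" using that unfolding K_def by simp
    then show ?thesis by (simp add: gn_def cut_def)
  qed (auto simp: gn_def)
  have gnc: "continuous_on UNIV (gn n)" for n
  proof -
    have o1: "open (?D - T)" using T by (intro open_Diff finite_imp_closed) auto
    have o2: "open (- K n)" using Kc by (simp add: compact_imp_closed open_Compl)
    have "continuous_on (?D - T) (\<lambda>x. g x * cut n x)" unfolding cut_def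
      by (intro continuous_intros inf continuous_at_imp_continuous_on ballI gc)
    then have c1: "continuous_on (?D - T) (gn n)"
      by (rule continuous_on_eq) (simp add: gn_def)
    have "continuous_on (- K n) (\<lambda>x. 0::real)" by simp
    then have c2: "continuous_on (- K n) (gn n)" by (rule continuous_on_eq) (simp add: K0)
    have "K n \<subseteq> ?D - T" using KD[of n] by (auto simp: K_def)
    then have "UNIV = (?D - T) \<union> - K n" by auto
    then show ?thesis using continuous_on_open_Un[OF o1 o2 c1 c2] by simp
  qed
  have chi: "0 \<le> cut n x" "cut n x \<le> 1" for n x by (auto simp: cut_def)
  have B0: "\<bar>gn n x\<bar> \<le> \<bar>B\<bar>" for n x
  proof (cases "x \<in> ?D - T")
    case True
    then have "\<bar>g x\<bar> * cut n x \<le> \<bar>B\<bar> * 1" using B[of x] chi by (intro mult_mono) auto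
    then show ?thesis using True chi by (simp add: gn_def abs_mult)
  qed (auto simp: gn_def)
  have lim: "(\<lambda>n. gn n x) \<longlonglongrightarrow> g x" if x: "x \<in> ?D - T" for x
  proof (rule tendsto_eventually)
    have "infdist x T > 0" using x T T' infdist_pos_not_in_closed[of T x] finite_imp_closed[of T] by auto
    then obtain N :: nat where N: "2 / infdist x T < real N" using reals_Archimedean2 by blast
    show "\<forall>\<^sub>F n in sequentially. gn n x = g x"
      using eventually_ge_at_top[of N]
    proof eventually_elim
      case (elim n)
      then have "2 / infdist x T < real n" using N by linarith
      then have "2 < real n * infdist x T" using \<open>infdist x T > 0\<close> by (simp add: pos_divide_less_eq)
      then have "cut n x = 1" by (simp add: cut_def)
      then show ?case using x by (simp add: gn_def)
    qed
  qed
  have ae: "AE x in lebesgue_on ?D. x \<in> ?D - T"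
    using AE_not_finite[OF T D(2)] AE_space[of "lebesgue_on ?D"] by eventually_elim simp
  have gnL: "gn n \<in> L2 ?D" for n by (rule continuous_Icc_L2) (rule continuous_on_subset[OF gnc], simp)
  have \<rho>L: "\<rho> \<in> L2 ?D" by (rule continuous_Icc_L2) (rule continuous_on_subset[OF \<rho>(1)], simp)
  note const = integrable_const_interval
  define m where "m = (\<lambda>n. integral {l..r} (gn n))"
  have mL: "m n = (LINT x|lebesgue_on ?D. gn n x)" for n
    unfolding m_def by (rule LINT_eq_integral(1)[OF L2_integrable[OF D gnL], symmetric])
  have "(\<lambda>n. LINT x|lebesgue_on ?D. gn n x) \<longlonglongrightarrow> (LINT x|lebesgue_on ?D. g x)"
  proof (rule integral_dominated_convergence[where w = "\<lambda>x. \<bar>B\<bar>"])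
    show "AE x in lebesgue_on ?D. (\<lambda>n. gn n x) \<longlonglongrightarrow> g x"
      using ae by eventually_elim (rule lim)
  qed (use B0 const gnL L2_meas gL in auto)
  moreover have "(LINT x|lebesgue_on ?D. g x) = 0"
    using LINT_FTC[OF T _ vc d gi] lr v0 by simp
  ultimately have m0: "m \<longlonglongrightarrow> 0" by (simp add: mL[symmetric])
  then obtain M where M: "\<And>n. \<bar>m n\<bar> \<le> M" using convergent_imp_Bseq[of m] by (auto simp: convergent_def Bseq_def)
  have M0: "M \<ge> 0" using M[of 0] by linarith
  define h where "h = (\<lambda>n x. gn n x - m n * \<rho> x)"
  define \<phi> where "\<phi> = (\<lambda>n x. integral {l..x} (h n))"
  have t: "test_fun ?D (\<phi> n)" "deriv (\<phi> n) = h n" for n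
    using mean_corrected_test_fun[OF gnc Kc KD K0 \<rho> lr, of n] unfolding \<phi>_def h_def m_def by auto
  have hL: "h n \<in> L2 ?D" for n unfolding h_def by (intro L2_diff gnL L2_cmult \<rho>L)
  define e where "e = (\<lambda>n x. g x - h n x)"
  have eL: "e n \<in> L2 ?D" for n unfolding e_def by (intro L2_diff gL hL)
  define W where "W = \<bar>B\<bar> + (\<bar>B\<bar> + M * R)"
  have eB: "\<bar>e n x\<bar> \<le> W" if x: "x \<in> ?D - T" for n x
  proof -
    have "\<bar>m n * \<rho> x\<bar> \<le> M * R" unfolding abs_mult using M R M0 x by (intro mult_mono) auto
    then show ?thesis using B[OF x] B0[of n x] unfolding e_def h_def W_def by linarith
  qed
  have elim: "(\<lambda>n. e n x) \<longlonglongrightarrow> 0" if x: "x \<in> ?D - T" for x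
    using tendsto_diff[OF tendsto_const tendsto_diff[OF lim[OF x] tendsto_mult_right[OF m0]], of "g x" "\<rho> x"]
    by (simp add: e_def h_def)
  have e2: "(\<lambda>n. ip ?D (e n) (e n)) \<longlonglongrightarrow> 0"
  proof -
    have "(\<lambda>n. ip ?D (e n) (e n)) \<longlonglongrightarrow> (LINT x|lebesgue_on ?D. 0)"
      unfolding ip_def
    proof (rule integral_dominated_convergence[where w = "\<lambda>x. W * W"])
      show "AE x in lebesgue_on ?D. (\<lambda>n. e n x * e n x) \<longlonglongrightarrow> 0"
        using ae by eventually_elim (use tendsto_mult[OF elim elim] in auto)
      show "AE x in lebesgue_on ?D. norm (e n x * e n x) \<le> W * W" for n
        using ae
      proof eventually_elim
        case (elim x)
        then have "\<bar>e n x\<bar> * \<bar>e n x\<bar> \<le> W * W" using eB[OF elim, of n] by (intro mult_mono) linarith+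
        then show ?case by (simp add: abs_mult)
      qed
      show "(\<lambda>x. e n x * e n x) \<in> borel_measurable (lebesgue_on ?D)" for n
        by (intro borel_measurable_times L2_meas eL)
    qed (use const in auto)
    then show ?thesis by simp
  qed
  define s where "s = (\<lambda>n. LINT x|lebesgue_on ?D. \<bar>e n x\<bar>)"
  have eL': "(\<lambda>x. \<bar>e n x\<bar>) \<in> L2 ?D" for n using eL[of n] by (auto simp: L2_def)
  have "(\<lambda>n. ip ?D (\<lambda>x. 1) (\<lambda>x. \<bar>e n x\<bar>)) \<longlonglongrightarrow> 0"
    by (rule ip_tendsto_0[OF one_L2[OF D] eL']) (use e2 in \<open>simp add: ip_def\<close>)
  then have s: "s \<longlonglongrightarrow> 0" by (simp add: s_def ip_def)
  have close: "\<bar>v x - \<phi> n x\<bar> \<le> s n" if x: "x \<in> ?D" for x n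
  proof -
    have "(g has_integral (v x - v l)) {l..x}"
      by (rule fundamental_theorem_of_calculus_interior_strong[OF T])
        (use x d in \<open>auto simp: has_real_derivative_iff_has_vector_derivative[symmetric] intro: continuous_on_subset[OF vc]\<close>)
    moreover have "h n integrable_on {l..x}"
      by (rule integrable_subinterval_real[OF LINT_eq_integral(2)[OF L2_integrable[OF D hL]]]) (use x in auto)
    ultimately have "((\<lambda>x. e n x) has_integral (v x - \<phi> n x)) {l..x}"
      unfolding e_def \<phi>_def using v0 by (intro has_integral_diff integrable_integral) auto
    then show ?thesis
      using abs_integral_le_LINT[OF L2_integrable[OF D eL[of n]], of x] x by (simp add: integral_unique s_def)
  qed
  have L0: "(\<lambda>n. ip ?D (\<lambda>x. v x - \<phi> n x) (\<lambda>x. v x - \<phi> n x)) \<longlonglongrightarrow> 0"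
  proof (rule tendsto_sandwich[OF _ _ tendsto_const])
    show "(\<lambda>n. (s n)\<^sup>2 * (LINT x|lebesgue_on ?D. 1)) \<longlonglongrightarrow> 0"
      using tendsto_mult_right[OF tendsto_power[OF s, of 2], of "LINT x|lebesgue_on ?D. 1"] by simp
    have "ip ?D (\<lambda>x. v x - \<phi> n x) (\<lambda>x. v x - \<phi> n x) \<le> (s n)\<^sup>2 * (LINT x|lebesgue_on ?D. 1)" for n
    proof -
      have "\<bar>(v x - \<phi> n x)\<bar>\<^sup>2 \<le> (s n)\<^sup>2" if "x \<in> ?D" for x using close[of x n] that by (intro power_mono) auto
      then have "ip ?D (\<lambda>x. v x - \<phi> n x) (\<lambda>x. v x - \<phi> n x) \<le> (LINT x|lebesgue_on ?D. (s n)\<^sup>2)"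
        by (intro ip_mono_bound L2_diff vL const test_fun_L2(1)[OF t(1) D] AE_I2) auto
      then show ?thesis by (simp add: mult.commute)
    qed
    then show "\<forall>\<^sub>F n in sequentially. ip ?D (\<lambda>x. v x - \<phi> n x) (\<lambda>x. v x - \<phi> n x) \<le> (s n)\<^sup>2 * (LINT x|lebesgue_on ?D. 1)"
      by simp
  qed (simp add: ip_self_nonneg)
  show "v \<in> H01 ?D"
    by (rule H01I_approx[OF w _ t(1) L0]) (use lr e2 in \<open>simp_all add: t(2) e_def\<close>)
qed

section \<open>Coercivity and regularity\<close>

lemma L2_subset:
  assumes u: "u \<in> L2 D" and E: "E \<subseteq> D" "E \<in> sets lebesgue" and D: "D \<in> sets lebesgue"
  shows "u \<in> L2 E"
proof -
  have eq: "indicator E x * u x = indicator E x * (indicator D x * u x)" for x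
    using E(1) by (auto simp: indicator_def)
  have "integrable lebesgue (\<lambda>x. indicator E x *\<^sub>R (indicator D x * u x)\<^sup>2)"
    by (rule integrable_mult_indicator) (use u D E in \<open>auto simp: L2_iff\<close>)
  moreover have "indicator E x *\<^sub>R (indicator D x * u x)\<^sup>2 = (indicator E x * u x)\<^sup>2" for x
    using E(1) by (auto simp: indicator_def)
  moreover have "(\<lambda>x. indicator E x * (indicator D x * u x)) \<in> borel_measurable lebesgue"
    by (rule borel_measurable_times[OF borel_measurable_indicator]) (use u D E in \<open>auto simp: L2_iff\<close>)
  ultimately show ?thesis using E by (simp add: L2_iff eq[symmetric])
qed

lemma shift_L2:
  assumes u: "u \<in> L2 \<Omega>"
  shows "(\<lambda>x. u (x - 1)) \<in> L2 {1<..<2}"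
    "ip {1<..<2} (\<lambda>x. u (x - 1)) (\<lambda>x. u (x - 1)) = ip {0<..<1} u u"
proof -
  have "(\<lambda>x. indicator \<Omega> (x - 1) * u (x - 1)) \<in> L2 {1<..<2}"
    by (rule L2_subset[OF L2_shift[OF u]]) auto
  then show "(\<lambda>x. u (x - 1)) \<in> L2 {1<..<2}"
    by (rule L2_cong) auto
  have "ip {1<..<2} (\<lambda>x. u (x - 1)) (\<lambda>x. u (x - 1))
      = (LINT x|lebesgue. indicator {0<..<1} (-1 + 1 * x) * (u (-1 + 1 * x) * u (-1 + 1 * x)))"
    unfolding ip_def by (subst integral_restrict_space) (auto intro!: Bochner_Integration.integral_cong simp: indicator_def)
  also have "\<dots> = (LINT x|lebesgue. indicator {0<..<1} x * (u x * u x))"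
    by (subst (2) lebesgue_integral_real_affine[of 1 _ "-1"]) auto
  also have "\<dots> = ip {0<..<1} u u"
    unfolding ip_def by (subst integral_restrict_space) auto
  finally show "ip {1<..<2} (\<lambda>x. u (x - 1)) (\<lambda>x. u (x - 1)) = ip {0<..<1} u u" .
qed

lemma ip_halves: assumes "u \<in> L2 \<Omega>" "v \<in> L2 \<Omega>" shows "ip \<Omega> u v = ip {0<..<1} u v + ip {1<..<2} u v"
  unfolding ip_def by (rule ip_split[OF L2_mult_integrable[OF assms]])

lemma AE_shift:
  assumes "u \<in> L2 \<Omega>" "v \<in> L2 \<Omega>" and ae: "AE x in lebesgue_on \<Omega>. u x = v x"
  shows "AE x in lebesgue_on {1<..<2}. u (x - 1) = v (x - 1)"
proof -
  define e where "e = (\<lambda>x. u x - v x)"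
  have e: "e \<in> L2 \<Omega>" unfolding e_def by (intro L2_diff assms)
  have "ip \<Omega> e e = ip \<Omega> (\<lambda>x. 0) (\<lambda>x. 0)"
    by (rule ip_cong_AE) (use ae e in \<open>auto simp: e_def L2_def\<close>)
  then have "ip \<Omega> e e = 0" by (simp add: ip_def)
  then have "ip {0<..<1} e e = 0"
    using ip_halves[OF e e] ip_self_nonneg[of "{0<..<1}" e] ip_self_nonneg[of "{1<..<2}" e] by simp
  then have "AE x in lebesgue_on {1<..<2}. e (x - 1) = 0"
    using shift_L2[OF e] by (intro ip_nonneg_eq_0_AE) auto
  then show ?thesis by (simp add: e_def)
qed

lemma has_weak_deriv_cong_AE:
  assumes w: "has_weak_deriv {l<..<r} u g" and U: "U \<in> L2 {l<..<r}" and ae: "AE x in lebesgue_on {l<..<r}. u x = U x"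
  shows "has_weak_deriv {l<..<r} U g"
proof -
  have "ip {l<..<r} U (deriv \<phi>) = ip {l<..<r} u (deriv \<phi>)" if t: "test_fun {l<..<r} \<phi>" for \<phi>
    by (rule ip_cong_AE) (use ae w U test_fun_L2[OF t] in \<open>auto simp: has_weak_deriv_def elim: eventually_mono\<close>)
  then show ?thesis using w U by (simp add: has_weak_deriv_def)
qed

lemma L2_mult_cont:
  assumes h: "continuous_on {l..r} h" and "w \<in> L2 {l<..<r}"
  shows "(\<lambda>x. h x * w x) \<in> L2 {l<..<r}"
proof -
  obtain B where "\<And>x. x \<in> {l..r} \<Longrightarrow> \<bar>h x\<bar> \<le> B" using continuous_Icc_bound[OF h] by blast
  then show ?thesis by (intro L2_bounded_mult[OF assms(2) L2_meas[OF continuous_Icc_L2[OF h]], of B]) auto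
qed

lemma AE_le_Linf_norm:
  assumes d: "continuous_on {l..r} d"
  shows "AE x in lebesgue_on {l<..<r}. \<bar>d x\<bar> \<le> Linf_norm {l<..<r} d"
proof -
  let ?M = "lebesgue_on {l<..<r}"
  obtain B where B: "B \<ge> 0" "\<And>x. x \<in> {l..r} \<Longrightarrow> \<bar>d x\<bar> \<le> B" using continuous_Icc_bound[OF d] by blast
  have m: "(\<lambda>x. ereal \<bar>d x\<bar>) \<in> borel_measurable ?M"
    using L2_meas[OF continuous_Icc_L2[OF d]] by auto
  have "esssup ?M (\<lambda>x. ereal \<bar>d x\<bar>) \<le> ereal B"
    by (rule esssup_I[OF m]) (use B in \<open>auto intro!: AE_I2\<close>)
  then have fin: "esssup ?M (\<lambda>x. ereal \<bar>d x\<bar>) \<noteq> \<infinity>" by auto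
  have "AE x in ?M. ereal \<bar>d x\<bar> \<le> esssup ?M (\<lambda>x. ereal \<bar>d x\<bar>)" by (rule esssup_AE)
  then show ?thesis
  proof eventually_elim
    case (elim x)
    then have "\<bar>esssup ?M (\<lambda>x. ereal \<bar>d x\<bar>)\<bar> \<noteq> \<infinity>"
      using fin by (cases "esssup ?M (\<lambda>x. ereal \<bar>d x\<bar>)") auto
    then show ?case using elim unfolding Linf_norm_def by (metis ereal_less_eq(3) ereal_real)
  qed
qed

text \<open>
  Under these assumptions a solution is classical and bounded uniformly in \<open>\<epsilon>\<close>. The lemmas on higher derivatives add
  smoothness of the data.
\<close>

locale convection_diffusion =
  fixes \<beta> \<gamma> :: real and b b' c d f \<Phi> :: "real \<Rightarrow> real"
  assumes b_deriv: "\<And>x. x \<in> {0..2} \<Longrightarrow> (b has_real_derivative b' x) (at x within {0..2})"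
    and cont: "continuous_on {0..2} b'" "continuous_on {0..2} c" "continuous_on {0..2} d"
      "continuous_on {0..2} f" "continuous_on {-1..0} \<Phi>"
    and \<beta>: "\<beta> > 0" "\<And>x. x \<in> {0..2} \<Longrightarrow> \<beta> \<le> b x"
    and \<gamma>: "\<gamma> > 0" "\<And>x. x \<in> {0..2} \<Longrightarrow> \<gamma> \<le> c x + b' x / 2 - Linf_norm {1<..<2} d / 2"
    and \<Phi>0: "\<Phi> 0 = 0"
begin

lemma b_cont: "continuous_on {0..2} b"
  using b_deriv by (meson DERIV_continuous continuous_on_eq_continuous_within)

text \<open>
  Extending the delayed term by zero to \<open>(0,1)\<close> writes all lower-order terms as one scalar product over \<open>\<Omega>\<close>.
\<close>

lemma bilin_shifted:
  assumes u: "u \<in> H01 \<Omega>"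
  defines "G \<equiv> \<lambda>x. c x * u x - b x * wderiv \<Omega> u x + d x * shifted (\<lambda>_. 0) u x"
  shows "G \<in> L2 \<Omega>"
    "v \<in> L2 \<Omega> \<Longrightarrow> bilin \<epsilon> b c d u v = \<epsilon> * ip \<Omega> (wderiv \<Omega> u) (wderiv \<Omega> v) + ip \<Omega> G v"
proof -
  note * = bilin_rhs[OF b_cont cont(2,3) continuous_on_const[of _ 0] continuous_on_const[of _ 0] H01_L2[OF u]]
  show "G \<in> L2 \<Omega>" "v \<in> L2 \<Omega> \<Longrightarrow> bilin \<epsilon> b c d u v = \<epsilon> * ip \<Omega> (wderiv \<Omega> u) (wderiv \<Omega> v) + ip \<Omega> G v"
    using *(1) *(2)[of v \<epsilon>] by (simp_all add: G_def rhs_def ip_def)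
qed

lemma bilin_diff_left:
  assumes u: "u \<in> H01 \<Omega>" and v: "v \<in> H01 \<Omega>" and w: "w \<in> H01 \<Omega>"
  shows "bilin \<epsilon> b c d (\<lambda>x. u x - v x) w = bilin \<epsilon> b c d u w - bilin \<epsilon> b c d v w"
proof -
  let ?U = "wderiv \<Omega> u" and ?V = "wderiv \<Omega> v"
  note L = H01_L2[OF u] H01_L2[OF v] H01_L2[OF w]
  have uv: "(\<lambda>x. u x - v x) \<in> H01 \<Omega>" by (rule H01_diff[OF u v]) simp
  have wd: "has_weak_deriv \<Omega> (\<lambda>x. u x - v x) (\<lambda>x. ?U x - ?V x)"
    by (rule has_weak_deriv_diff[OF H01_weak_deriv[OF u] H01_weak_deriv[OF v]]) auto
  let ?G = "\<lambda>u x. c x * u x - b x * wderiv \<Omega> u x + d x * shifted (\<lambda>_. 0) u x"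
  have "AE x in lebesgue_on \<Omega>. ?G (\<lambda>x. u x - v x) x = ?G u x - ?G v x"
    using wderiv_AE[OF wd]
  proof eventually_elim
    case (elim x)
    show ?case unfolding elim by (auto simp: algebra_simps)
  qed
  then have "ip \<Omega> (?G (\<lambda>x. u x - v x)) w = ip \<Omega> (\<lambda>x. ?G u x - ?G v x) w"
    by (intro ip_cong_AE bilin_shifted(1) u v uv L2_diff L) auto
  also have "\<dots> = ip \<Omega> (?G u) w - ip \<Omega> (?G v) w"
    by (intro ip_diff bilin_shifted(1) u v L)
  finally have 1: "ip \<Omega> (?G (\<lambda>x. u x - v x)) w = ip \<Omega> (?G u) w - ip \<Omega> (?G v) w" .
  have 2: "ip \<Omega> (wderiv \<Omega> (\<lambda>x. u x - v x)) (wderiv \<Omega> w)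
      = ip \<Omega> ?U (wderiv \<Omega> w) - ip \<Omega> ?V (wderiv \<Omega> w)"
    using ip_wderiv_eq[OF wd L(6)] by (simp add: ip_diff L)
  have "\<epsilon> * (p - q) + (s - t) = (\<epsilon> * p + s) - (\<epsilon> * q + t)" for p q s t :: real
    by (simp add: algebra_simps)
  then show ?thesis
    unfolding bilin_shifted(2)[OF uv L(5)] bilin_shifted(2)[OF u L(5)] bilin_shifted(2)[OF v L(5)] 1 2 .
qed

text \<open>
  The convective term equals \<open>ip (b' v) v / 2\<close> after integration by parts. In the delayed term,
  \<open>2 v(x - 1) v(x) \<le> v(x - 1)\<^sup>2 + v(x)\<^sup>2\<close> on \<open>(1,2)\<close>, and the two squares together fill exactly \<open>\<Omega>\<close>.
\<close>

lemma coercive: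
  assumes v: "v \<in> H01 \<Omega>"
  shows "\<epsilon> * ip \<Omega> (wderiv \<Omega> v) (wderiv \<Omega> v) + \<gamma> * ip \<Omega> v v \<le> bilin \<epsilon> b c d v v"
proof -
  let ?V = "wderiv \<Omega> v" and ?D = "Linf_norm {1<..<2} d"
  note L = H01_L2[OF v]
  note M = cont_mult_L2[OF cont(1) L(1)] cont_mult_L2[OF cont(2) L(1)] cont_mult_L2[OF b_cont L(2)] cont_mult_L2[OF b_cont L(1)]
  have "2 * ip \<Omega> (\<lambda>x. b x * ?V x) v + ip \<Omega> (\<lambda>x. b' x * v x) v = 0"
    using H01_integration_by_parts[OF b_deriv cont(1) _ v v] by (simp add: ip_def mult_ac)
  then have conv: "ip \<Omega> (\<lambda>x. c x * v x - b x * ?V x) v = ip \<Omega> (\<lambda>x. c x * v x) v + ip \<Omega> (\<lambda>x. b' x * v x) v / 2"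
    by (simp add: ip_diff M L)
  have dc: "continuous_on {1..2} d" by (rule continuous_on_subset[OF cont(3)]) auto
  define s where "s = (\<lambda>x. v (x - 1))"
  have s: "s \<in> L2 {1<..<2}" "ip {1<..<2} s s = ip {0<..<1} v v" using shift_L2[OF L(1)] by (auto simp: s_def)
  have v2: "v \<in> L2 {1<..<2}" by (rule L2_subset[OF L(1)]) auto
  have "(LINT x|lebesgue_on {1<..<2}. - (?D / 2) * (s x * s x + v x * v x)) \<le> ip {1<..<2} (\<lambda>x. d x * s x) v"
    unfolding ip_def
  proof (rule integral_mono_AE)
    show "AE x in lebesgue_on {1<..<2}. - (?D / 2) * (s x * s x + v x * v x) \<le> d x * s x * v x"
      using AE_le_Linf_norm[OF dc]
    proof eventually_elim
      case (elim x)
      have "\<bar>2 * (s x * v x)\<bar> \<le> s x * s x + v x * v x"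
        using sum_squares_bound[of "\<bar>s x\<bar>" "\<bar>v x\<bar>"] by (simp add: abs_mult power2_eq_square)
      then have "\<bar>d x\<bar> * \<bar>2 * (s x * v x)\<bar> \<le> ?D * (s x * s x + v x * v x)" using elim by (intro mult_mono) auto
      then have "\<bar>2 * (d x * s x * v x)\<bar> \<le> ?D * (s x * s x + v x * v x)" by (simp add: abs_mult)
      then show ?case by (simp add: abs_le_iff)
    qed
  qed (intro integrable_mult_right Bochner_Integration.integrable_add L2_mult_integrable L2_mult_cont[OF dc] s v2)+
  also have "(LINT x|lebesgue_on {1<..<2}. - (?D / 2) * (s x * s x + v x * v x)) = - (?D / 2) * ip \<Omega> v v"
    using s v2 ip_halves[OF L(1) L(1)] by (simp add: L2_mult_integrable ip_def)
  finally have delay: "- (?D / 2) * ip \<Omega> v v \<le> ip {1<..<2} (\<lambda>x. d x * v (x - 1)) v" by (simp add: s_def)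
  have "\<gamma> * ip \<Omega> v v = (LINT x|lebesgue_on \<Omega>. \<gamma> * (v x * v x))" by (simp add: ip_def)
  also have "\<dots> \<le> (LINT x|lebesgue_on \<Omega>. c x * v x * v x + b' x * v x * v x / 2 + - (?D / 2) * (v x * v x))"
  proof (rule integral_mono)
    fix x assume "x \<in> space (lebesgue_on \<Omega>)"
    then have "\<gamma> * (v x * v x) \<le> (c x + b' x / 2 - ?D / 2) * (v x * v x)"
      using \<gamma>(2)[of x] by (intro mult_right_mono) auto
    then show "\<gamma> * (v x * v x) \<le> c x * v x * v x + b' x * v x * v x / 2 + - (?D / 2) * (v x * v x)"
      by (simp add: algebra_simps)
  qed (intro integrable_mult_right integrable_divide Bochner_Integration.integrable_add L2_mult_integrable M L)+
  also have "\<dots> = ip \<Omega> (\<lambda>x. c x * v x) v + ip \<Omega> (\<lambda>x. b' x * v x) v / 2 - ?D / 2 * ip \<Omega> v v"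
    unfolding ip_def by (simp add: L2_mult_integrable M L)
  finally show ?thesis using conv delay unfolding bilin_def by simp
qed

lemma solution_L2_bound:
  obtains C where "C \<ge> 0" "\<And>\<epsilon> u. \<epsilon> > 0 \<Longrightarrow> weak_solution \<epsilon> b c d f \<Phi> u \<Longrightarrow> ip \<Omega> u u \<le> C"
proof -
  define g where "g = (\<lambda>x. d x * \<Phi> (x - 1))"
  have c01: "continuous_on {0..1} g" unfolding g_def
    by (intro continuous_intros continuous_on_subset[OF cont(3)] continuous_on_compose2[OF cont(5)]) auto
  have gL: "g \<in> L2 {0<..<1}" by (rule continuous_Icc_L2[OF c01])
  have fL: "f \<in> L2 \<Omega>" by (rule continuous_Icc_L2[OF cont(4)])
  define K where "K = 4 / \<gamma> * ip \<Omega> f f + 4 / \<gamma> * ip {0<..<1} g g"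
  show ?thesis
  proof (rule that[of "2 / \<gamma> * K"])
    show "2 / \<gamma> * K \<ge> 0" using \<gamma> by (simp add: K_def ip_self_nonneg)
    fix \<epsilon> u assume e: "\<epsilon> > (0::real)" and "weak_solution \<epsilon> b c d f \<Phi> u"
    then have u: "u \<in> H01 \<Omega>" and eq: "bilin \<epsilon> b c d u u = rhs d f \<Phi> u" by (auto simp: weak_solution_def)
    note L = H01_L2[OF u]
    have u1: "u \<in> L2 {0<..<1}" by (rule L2_subset[OF L(1)]) auto
    have "\<gamma> * ip \<Omega> u u \<le> rhs d f \<Phi> u"
      using coercive[OF u, of \<epsilon>] eq e ip_self_nonneg[of \<Omega> "wderiv \<Omega> u"]
      by (smt (verit) mult_nonneg_nonneg)
    also have "\<dots> \<le> \<bar>ip \<Omega> f u\<bar> + \<bar>ip {0<..<1} g u\<bar>" by (simp add: rhs_def g_def)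
    also have "\<dots> \<le> (4 / \<gamma> * ip \<Omega> f f + ip \<Omega> u u / (4 / \<gamma>)) + (4 / \<gamma> * ip {0<..<1} g g + ip {0<..<1} u u / (4 / \<gamma>))"
      by (intro add_mono ip_bound fL L gL u1) (use \<gamma> in auto)
    also have "\<dots> \<le> K + \<gamma> / 2 * ip \<Omega> u u"
    proof -
      have "ip {0<..<1} u u \<le> ip \<Omega> u u" using ip_halves[OF L(1) L(1)] ip_self_nonneg[of "{1<..<2}" u] by simp
      then have "\<gamma> * ip {0<..<1} u u \<le> \<gamma> * ip \<Omega> u u" using \<gamma> by simp
      then show ?thesis by (simp add: K_def mult.commute)
    qed
    finally have "\<gamma> / 2 * ip \<Omega> u u \<le> K" by simp
    then show "ip \<Omega> u u \<le> 2 / \<gamma> * K" using \<gamma> by (simp add: field_simps)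
  qed
qed

text \<open>
  The two branches fit together at 1 because of the compatibility condition \<open>\<Phi> 0 = 0\<close>.
\<close>

lemma shifted_continuous:
  assumes U: "continuous_on {0..2} U" "U 0 = 0"
  shows "continuous_on {0..2} (shifted \<Phi> U)"
proof -
  have "continuous_on ({0..1} \<union> {1..2}) (\<lambda>x. if x < 1 then \<Phi> (x - 1) else U (x - 1))"
  proof (rule continuous_on_cases)
    show "continuous_on {0..1} (\<lambda>x. \<Phi> (x - 1))"
      by (rule continuous_on_compose2[OF cont(5)]) (auto intro!: continuous_intros)
    show "continuous_on {1..2} (\<lambda>x. U (x - 1))"
      by (rule continuous_on_compose2[OF U(1)]) (auto intro!: continuous_intros)
    show "\<forall>x. x \<in> {0..1} \<and> \<not> x < 1 \<or> x \<in> {1..2} \<and> x < 1 \<longrightarrow> \<Phi> (x - 1) = U (x - 1)"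
      using U(2) \<Phi>0 by force
  qed auto
  moreover have "{0..2::real} = {0..1} \<union> {1..2}" by auto
  ultimately show ?thesis by simp
qed

text \<open>
  \<open>Y\<close> is the derivative of \<open>U\<close>, one-sided at 0 and 2; the second derivative is expressed by the equation.
\<close>

definition classical_solution :: "real \<Rightarrow> (real \<Rightarrow> real) \<Rightarrow> (real \<Rightarrow> real) \<Rightarrow> bool" where
  "classical_solution \<epsilon> U Y \<longleftrightarrow> U 0 = 0 \<and> U 2 = 0
     \<and> (\<forall>x\<in>{0..2}. (U has_real_derivative Y x) (at x within {0..2}))
     \<and> (\<forall>x\<in>{0..2}. (Y has_real_derivative (c x * U x + d x * shifted \<Phi> U x - f x - b x * Y x) / \<epsilon>) (at x within {0..2}))"

lemma classical_solution_H01: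
  assumes "classical_solution \<epsilon> U Y"
  shows "has_weak_deriv \<Omega> U Y" "U \<in> H01 \<Omega>" "continuous_on {0..2} U" "continuous_on {0..2} Y"
proof -
  note cs = assms[unfolded classical_solution_def]
  show Uc: "continuous_on {0..2} U" by (rule DERIV_within_imp_continuous) (use cs in blast)
  show Yc: "continuous_on {0..2} Y" by (rule DERIV_within_imp_continuous) (use cs in blast)
  obtain B where B: "\<And>x. x \<in> {0..2} \<Longrightarrow> \<bar>Y x\<bar> \<le> B" using continuous_Icc_bound[OF Yc] by blast
  have d: "(U has_real_derivative Y x) (at x)" if "x \<in> \<Omega> - {0, 2}" for x
    using that cs by (intro DERIV_within_interior[of U "Y x" x 0 2]) auto
  have i: "isCont Y x" if "x \<in> \<Omega> - {0, 2}" for x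
    using that Yc by (intro continuous_on_interior[of "{0..2}"]) auto
  show "has_weak_deriv \<Omega> U Y" "U \<in> H01 \<Omega>"
    using piecewise_C1_H01[of "{0, 2}" 0 2 U Y B, OF _ _ _ _ Uc _ _ d i] B cs by auto
qed

lemma classical_solution_weak:
  assumes cs: "classical_solution \<epsilon> U Y" and e: "\<epsilon> > 0"
  shows "weak_solution \<epsilon> b c d f \<Phi> U"
proof -
  note U = classical_solution_H01[OF cs]
  define W where "W = (\<lambda>x. (c x * U x + d x * shifted \<Phi> U x - f x - b x * Y x) / \<epsilon>)"
  have "continuous_on {0..2} W" unfolding W_def
    using e cs by (intro continuous_on_divide continuous_on_add continuous_on_diff continuous_on_mult
        continuous_on_const shifted_continuous cont b_cont U) (auto simp: classical_solution_def)
  moreover have "(Y has_real_derivative W x) (at x)" if "x \<in> \<Omega> - {}" for x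
    using that cs by (intro DERIV_within_interior[of Y "W x" x 0 2]) (auto simp: classical_solution_def W_def)
  ultimately have "has_weak_deriv \<Omega> Y W"
    using piecewise_C1_weak_deriv[of "{}" 0 2 Y W, OF _ _ U(4)] continuous_Icc_L2 by auto
  moreover have ae: "AE x in lebesgue_on \<Omega>. Y x = wderiv \<Omega> U x"
    using wderiv_AE[OF U(1)] by (auto elim: eventually_mono)
  ultimately have "has_weak_deriv \<Omega> (wderiv \<Omega> U) W"
    using has_weak_deriv_cong_AE H01_L2(2)[OF U(2)] by blast
  moreover have "AE x in lebesgue_on \<Omega>. - \<epsilon> * W x - b x * wderiv \<Omega> U x + c x * U x + d x * shifted \<Phi> U x = f x"
    using ae by eventually_elim (use e in \<open>simp add: W_def\<close>)
  ultimately have "bvp_solution \<epsilon> b c d f \<Phi> U" using U(2) unfolding bvp_solution_def by blast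
  then show ?thesis using bvp_solution_iff_weak_solution[OF b_cont cont(2-5) e] by simp
qed

text \<open>
  Written as \<open>(\<epsilon> u' + b u)' = R\<close> with \<open>R = (b' + c) u + d u(\<cdot> - 1) - f\<close>, the equation has a continuous right-hand side.
  Hence \<open>\<epsilon> u' + b u\<close> is \<open>C\<^sup>1\<close> up to a constant by the du Bois-Reymond lemma, and \<open>u'\<close> inherits this regularity.
\<close>

lemma bvp_solution_classical:
  assumes e: "\<epsilon> > 0" and bvp: "bvp_solution \<epsilon> b c d f \<Phi> u"
  obtains U Y where "classical_solution \<epsilon> U Y" "AE x in lebesgue_on \<Omega>. u x = U x"
proof -
  let ?I = "{0..2::real}"
  have D: "bounded \<Omega>" "\<Omega> \<in> sets lebesgue" by auto
  have "weak_solution \<epsilon> b c d f \<Phi> u"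
    using bvp bvp_solution_iff_weak_solution[OF b_cont cont(2-5) e] by simp
  then have u: "u \<in> H01 \<Omega>" and eq: "\<And>v. v \<in> H01 \<Omega> \<Longrightarrow> bilin \<epsilon> b c d u v = rhs d f \<Phi> v" by (auto simp: weak_solution_def)
  note L = H01_L2[OF u]
  obtain U where U: "continuous_on ?I U" "U 0 = 0" "U 2 = 0" "AE x in lebesgue_on \<Omega>. u x = U x"
    "\<And>x. x \<in> ?I \<Longrightarrow> U x = integral {0..x} (wderiv \<Omega> u)" using H01_continuous_representative[OF u] by auto
  define V where "V = wderiv \<Omega> u"
  define R where "R = (\<lambda>x. b' x * U x + c x * U x + d x * shifted \<Phi> U x - f x)"
  define P where "P = (\<lambda>x. integral {0..x} R)"
  have Rc: "continuous_on ?I R" unfolding R_def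
    by (intro continuous_on_add continuous_on_diff continuous_on_mult shifted_continuous cont U)
  have Pd: "(P has_real_derivative R x) (at x within ?I)" if "x \<in> ?I" for x
    unfolding P_def by (rule integral_has_real_derivative[OF Rc that])
  have Pc: "continuous_on ?I P" using Pd by (meson DERIV_continuous continuous_on_eq_continuous_within)
  have VL: "V \<in> L2 \<Omega>" using L by (simp add: V_def)
  have UL: "U \<in> L2 \<Omega>" by (rule continuous_Icc_L2[OF U(1)])
  have PL: "P \<in> L2 \<Omega>" by (rule continuous_Icc_L2[OF Pc])
  have RL: "R \<in> L2 \<Omega>" by (rule continuous_Icc_L2[OF Rc])
  note M = cont_mult_L2[OF b_cont VL] cont_mult_L2[OF b_cont L(1)] cont_mult_L2[OF cont(1) L(1)]
  \<comment> \<open>Testing the weak formulation with \<open>\<phi>\<close> says that \<open>z\<close> is orthogonal to every \<open>\<phi>'\<close>.\<close>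
  define z where "z = (\<lambda>x. \<epsilon> * V x + b x * u x - P x)"
  have zL: "z \<in> L2 \<Omega>" unfolding z_def by (intro L2_diff L2_add L2_cmult VL M PL)
  have "ip \<Omega> z (deriv \<phi>) = 0" if t: "test_fun \<Omega> \<phi>" for \<phi>
  proof -
    note f = test_fun_facts[OF t] and p = test_fun_L2[OF t D]
    have h: "\<phi> \<in> H01 \<Omega>" by (rule test_fun_H01[OF t]) simp
    have wd: "has_weak_deriv \<Omega> \<phi> (deriv \<phi>)" by (rule test_fun_weak_deriv[OF t]) simp
    have wp: "ip \<Omega> w (wderiv \<Omega> \<phi>) = ip \<Omega> w (deriv \<phi>)" if "w \<in> L2 \<Omega>" for w
      using ip_wderiv_eq[OF wd that] by (simp add: ip_commute[of _ w])
    define G where "G = (\<lambda>x. c x * u x - b x * V x + d x * shifted \<Phi> u x - f x)"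
    note bb = bilin_rhs[OF b_cont cont(2-5) L]
    have GL: "G \<in> L2 \<Omega>" unfolding G_def V_def by (rule bb(1))
    have 1: "\<epsilon> * ip \<Omega> V (deriv \<phi>) + ip \<Omega> G \<phi> = 0"
      using bb(2)[OF p(1), of \<epsilon>] eq[OF h] wp[OF VL] by (simp add: G_def V_def)
    have 2: "ip \<Omega> (\<lambda>x. b x * V x) \<phi> + ip \<Omega> (\<lambda>x. b' x * u x) \<phi> + ip \<Omega> (\<lambda>x. b x * u x) (deriv \<phi>) = 0"
      using H01_integration_by_parts[OF b_deriv cont(1) _ u h] wp[OF M(2)] by (simp add: V_def)
    have "(LINT x|lebesgue_on \<Omega>. P x * deriv \<phi> x + R x * \<phi> x) = P 2 * \<phi> 2 - P 0 * \<phi> 0"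
    proof (rule LINT_FTC[of "{}"])
      show "continuous_on ?I (\<lambda>x. P x * \<phi> x)" by (intro continuous_intros Pc continuous_on_subset[OF f(2)]) auto
      fix x assume x: "x \<in> \<Omega> - {}"
      then have "(P has_real_derivative R x) (at x)" using DERIV_within_interior[OF Pd] by simp
      then show "((\<lambda>x. P x * \<phi> x) has_real_derivative P x * deriv \<phi> x + R x * \<phi> x) (at x)"
        by (auto intro!: derivative_eq_intros f(1))
    qed (auto intro!: Bochner_Integration.integrable_add L2_mult_integrable PL RL p)
    then have 3: "ip \<Omega> P (deriv \<phi>) + ip \<Omega> R \<phi> = 0"
      using f(4)[of 0] f(4)[of 2] by (simp add: ip_def L2_mult_integrable PL RL p)
    have "AE x in lebesgue_on \<Omega>. shifted \<Phi> u x = shifted \<Phi> U x"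
    proof -
      have "AE x in lebesgue. x \<in> {1<..<2} \<longrightarrow> u (x - 1) = U (x - 1)"
        using AE_shift[OF L(1) UL U(4)] by (subst (asm) AE_restrict_space_iff) auto
      then have "AE x in lebesgue. x \<in> \<Omega> - {1} \<longrightarrow> shifted \<Phi> u x = shifted \<Phi> U x"
        by eventually_elim auto
      moreover have "AE x in lebesgue. x \<noteq> (1::real)" by (rule AE_completion[OF AE_lborel_singleton])
      ultimately have "AE x in lebesgue. x \<in> \<Omega> \<longrightarrow> shifted \<Phi> u x = shifted \<Phi> U x"
        by eventually_elim auto
      then show ?thesis by (subst AE_restrict_space_iff) auto
    qed
    then have "AE x in lebesgue_on \<Omega>. R x = G x + b x * V x + b' x * u x"
      using U(4) by eventually_elim (simp add: R_def G_def)
    then have "ip \<Omega> R \<phi> = ip \<Omega> (\<lambda>x. G x + b x * V x + b' x * u x) \<phi>"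
      by (intro ip_cong_AE RL p L2_add GL M) auto
    then have 4: "ip \<Omega> R \<phi> = ip \<Omega> G \<phi> + ip \<Omega> (\<lambda>x. b x * V x) \<phi> + ip \<Omega> (\<lambda>x. b' x * u x) \<phi>"
      by (simp add: ip_add GL M p L2_add)
    have "ip \<Omega> z (deriv \<phi>) = \<epsilon> * ip \<Omega> V (deriv \<phi>) + ip \<Omega> (\<lambda>x. b x * u x) (deriv \<phi>) - ip \<Omega> P (deriv \<phi>)"
      unfolding z_def by (simp add: ip_add ip_diff ip_cmult L2_add L2_cmult VL M PL p)
    then show ?thesis using 1 2 3 4 by linarith
  qed
  then obtain \<kappa> where \<kappa>: "AE x in lebesgue_on \<Omega>. z x = \<kappa>" using du_Bois_Reymond[OF zL] by auto
  define Y where "Y = (\<lambda>x. (\<kappa> + P x - b x * U x) / \<epsilon>)"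
  have Yc: "continuous_on ?I Y" unfolding Y_def
    using e by (intro continuous_on_divide continuous_on_add continuous_on_diff continuous_on_mult continuous_on_const Pc b_cont U) auto
  have YL: "Y \<in> L2 \<Omega>" by (rule continuous_Icc_L2[OF Yc])
  have VY: "AE x in lebesgue_on \<Omega>. V x = Y x"
    using \<kappa> U(4)
  proof eventually_elim
    case (elim x)
    then have "\<epsilon> * V x = \<kappa> + P x - b x * U x" by (simp add: z_def)
    then show ?case using e by (simp add: Y_def field_simps)
  qed
  have UY: "U x = integral {0..x} Y" if x: "x \<in> ?I" for x
  proof -
    have i: "integrable (lebesgue_on \<Omega>) (\<lambda>x. V x - Y x)" by (rule L2_integrable[OF D L2_diff[OF VL YL]])
    have "(LINT x|lebesgue_on \<Omega>. \<bar>V x - Y x\<bar>) = (LINT x|lebesgue_on \<Omega>. 0)"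
      by (rule integral_cong_AE) (use VY i in auto)
    then have "integral {0..x} (\<lambda>x. V x - Y x) = 0" using abs_integral_le_LINT[OF i x] by simp
    moreover have "V integrable_on {0..x}" "Y integrable_on {0..x}"
      by (rule integrable_subinterval_real[OF LINT_eq_integral(2)[OF L2_integrable[OF D]]]; use x VL YL in auto)+
    ultimately show ?thesis using U(5)[OF x]
      by (subst (asm) Henstock_Kurzweil_Integration.integral_diff) (auto simp: V_def)
  qed
  have Ud: "(U has_real_derivative Y x) (at x within ?I)" if x: "x \<in> ?I" for x
    by (rule has_field_derivative_transform_within[OF integral_has_real_derivative[OF Yc x], of 1]) (use x UY in auto)
  have "(Y has_real_derivative (c x * U x + d x * shifted \<Phi> U x - f x - b x * Y x) / \<epsilon>) (at x within ?I)"
    if x: "x \<in> ?I" for x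
  proof -
    have "((\<lambda>x. (\<kappa> + P x - b x * U x) / \<epsilon>) has_real_derivative (0 + R x - (b' x * U x + b x * Y x)) / \<epsilon>) (at x within ?I)"
      using e by (auto intro!: derivative_eq_intros Pd x b_deriv Ud)
    then show ?thesis unfolding Y_def[symmetric] by (simp add: R_def algebra_simps)
  qed
  then show ?thesis using that[of U Y] Ud U by (auto simp: classical_solution_def)
qed

end

section \<open>Comparison principle and uniform bounds\<close>

text \<open>
  With the integrating factor \<open>E\<close>, the function \<open>w * E\<close> is nondecreasing.
\<close>

lemma first_order_comparison:
  fixes w w' b :: "real \<Rightarrow> real"
  assumes b: "continuous_on {p..q} b" and e: "\<epsilon> > 0"
    and d: "\<And>x. x \<in> {p..q} \<Longrightarrow> (w has_real_derivative w' x) (at x within {p..q})"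
    and ge: "\<And>x. x \<in> {p..q} \<Longrightarrow> 0 \<le> \<epsilon> * w' x + b x * w x"
    and w0: "0 \<le> w p" and x: "x \<in> {p..q}"
  shows "0 \<le> w x"
proof -
  define E where "E = (\<lambda>x. exp (integral {p..x} b / \<epsilon>))"
  have dE: "(E has_real_derivative E y * (b y / \<epsilon>)) (at y within {p..q})" if "y \<in> {p..q}" for y
    unfolding E_def using e by (auto intro!: derivative_eq_intros integral_has_real_derivative[OF b that])
  have "w p * E p \<le> w x * E x"
  proof (rule DERIV_nonneg_imp_increasing_open[where f = "\<lambda>x. w x * E x" and a = p and b = x])
    show "p \<le> x" using x by simp
    show "continuous_on {p..x} (\<lambda>x. w x * E x)"
      using x by (intro continuous_on_subset[OF continuous_on_mult[OF DERIV_within_imp_continuous[OF d] DERIV_within_imp_continuous[OF dE]]]) auto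
    fix y assume y: "p < y" "y < x"
    then have yi: "y \<in> {p..q}" "at y within {p..q} = at y" using x at_within_interior[of y "{p..q}"] by auto
    have "((\<lambda>x. w x * E x) has_real_derivative w y * (E y * (b y / \<epsilon>)) + w' y * E y) (at y)"
      using DERIV_mult'[OF d[OF yi(1)] dE[OF yi(1)]] yi(2) by simp
    moreover have "w y * (E y * (b y / \<epsilon>)) + w' y * E y = E y / \<epsilon> * (\<epsilon> * w' y + b y * w y)"
      using e by (simp add: field_simps)
    moreover have "E y / \<epsilon> * (\<epsilon> * w' y + b y * w y) \<ge> 0"
      using ge[OF yi(1)] e by (intro mult_nonneg_nonneg) (auto simp: E_def)
    ultimately show "\<exists>z. ((\<lambda>x. w x * E x) has_real_derivative z) (at y) \<and> 0 \<le> z" by auto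
  qed
  moreover have "0 \<le> w p * E p" using w0 by (simp add: E_def)
  ultimately have "0 \<le> w x * E x" by linarith
  then show ?thesis by (simp add: E_def zero_le_mult_iff)
qed

lemma first_order_barrier:
  fixes y y' b z z' :: "real \<Rightarrow> real"
  assumes b: "continuous_on {p..q} b" and e: "\<epsilon> > 0"
    and d: "\<And>x. x \<in> {p..q} \<Longrightarrow> (y has_real_derivative y' x) (at x within {p..q})"
    and dz: "\<And>x. x \<in> {p..q} \<Longrightarrow> (z has_real_derivative z' x) (at x within {p..q})"
    and ge: "\<And>x. x \<in> {p..q} \<Longrightarrow> \<bar>\<epsilon> * y' x + b x * y x\<bar> \<le> \<epsilon> * z' x + b x * z x"
    and w0: "\<bar>y p\<bar> \<le> z p" and x: "x \<in> {p..q}"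
  shows "\<bar>y x\<bar> \<le> z x"
proof -
  have "0 \<le> z x - y x"
    by (rule first_order_comparison[OF b e DERIV_diff[OF dz d] _ _ x])
      (use ge w0 in \<open>force simp: algebra_simps abs_le_iff\<close>)+
  moreover have "0 \<le> z x + y x"
    by (rule first_order_comparison[OF b e DERIV_add[OF dz d] _ _ x])
      (use ge w0 in \<open>force simp: algebra_simps abs_le_iff\<close>)+
  ultimately show ?thesis by (simp add: abs_le_iff)
qed

context convection_diffusion
begin

text \<open>
  If \<open>\<epsilon> U' + b U\<close> were bounded below by some \<open>\<delta> > 0\<close>, the linear function \<open>q * x\<close> would be a subsolution and force
  \<open>U 2 > 0\<close>.
\<close>

lemma flux_sign:
  assumes e: "0 < \<epsilon>" "\<epsilon> < 1" and B: "\<And>x. x \<in> {0..2} \<Longrightarrow> b x \<le> B"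
    and d: "\<And>x. x \<in> {0..2} \<Longrightarrow> (U has_real_derivative Y x) (at x within {0..2})"
    and g: "\<And>x. x \<in> {0..2} \<Longrightarrow> \<delta> \<le> \<epsilon> * Y x + b x * U x" and U: "U 0 = 0" "U 2 = 0"
  shows "\<delta> \<le> 0"
proof (rule ccontr)
  assume "\<not> \<delta> \<le> 0"
  then have \<delta>: "\<delta> > 0" by simp
  have B0: "B > 0" using B[of 0] \<beta>(1) \<beta>(2)[of 0] by auto
  define q where "q = \<delta> / (2 * B + 1)"
  have q: "q > 0" "q * (2 * B + 1) = \<delta>" using \<delta> B0 by (auto simp: q_def)
  have "0 \<le> U 2 - q * 2"
  proof (rule first_order_comparison[of 0 2 b \<epsilon> "\<lambda>x. U x - q * x" "\<lambda>x. Y x - q"])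
    fix x :: real assume x: "x \<in> {0..2}"
    show "((\<lambda>x. U x - q * x) has_real_derivative Y x - q) (at x within {0..2})"
      by (auto intro!: derivative_eq_intros d x)
    have "\<epsilon> + b x * x \<le> 1 + B * 2"
      using x e B[OF x] B0 \<beta>(2)[OF x] \<beta>(1) by (intro add_mono mult_mono) auto
    then have "q * (\<epsilon> + b x * x) \<le> \<delta>" using q(1) unfolding q(2)[symmetric] by (intro mult_left_mono) auto
    then show "0 \<le> \<epsilon> * (Y x - q) + b x * (U x - q * x)" using g[OF x] by (simp add: algebra_simps)
  qed (use e U b_cont in auto)
  then show False using U q by simp
qed

text \<open>
  The flux \<open>\<epsilon> Y + b U\<close> stays within distance \<open>G\<close> of its value \<open>\<kappa>\<close> at 0, because its derivative \<open>R\<close> is bounded in \<open>L\<^sup>1\<close>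
  by the \<open>L\<^sup>2\<close> bound of the solution. Both boundary values are zero, so \<open>flux_sign\<close>, applied to \<open>U\<close> and \<open>-U\<close>, excludes
  \<open>\<bar>\<kappa>\<bar> > G\<close>. With a bounded flux, the constant \<open>2 * G / \<beta>\<close> is a barrier for \<open>U\<close>.
\<close>

lemma solution_bounds:
  obtains C where "C \<ge> 0"
    "\<And>\<epsilon> U Y x. \<lbrakk>0 < \<epsilon>; \<epsilon> < 1; classical_solution \<epsilon> U Y; x \<in> {0..2}\<rbrakk> \<Longrightarrow> \<bar>U x\<bar> \<le> C \<and> \<bar>Y x\<bar> \<le> C / \<epsilon>"
proof -
  have D: "bounded \<Omega>" "\<Omega> \<in> sets lebesgue" by auto
  obtain C0 where C0: "C0 \<ge> 0" "\<And>\<epsilon> u. \<epsilon> > 0 \<Longrightarrow> weak_solution \<epsilon> b c d f \<Phi> u \<Longrightarrow> ip \<Omega> u u \<le> C0"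
    using solution_L2_bound by blast
  obtain B where B: "\<And>x. x \<in> {0..2} \<Longrightarrow> \<bar>b x\<bar> \<le> B" using continuous_Icc_bound[OF b_cont] by blast
  have B0: "B > 0" using B[of 0] \<beta>(1) \<beta>(2)[of 0] by auto
  obtain K1 where K1: "K1 \<ge> 0" "\<And>x. x \<in> {0..2} \<Longrightarrow> \<bar>b' x + c x\<bar> \<le> K1"
    using continuous_Icc_bound[OF continuous_on_add[OF cont(1,2)]] by blast
  obtain K2 where K2: "K2 \<ge> 0" "\<And>x. x \<in> {0..2} \<Longrightarrow> \<bar>d x\<bar> \<le> K2" using continuous_Icc_bound[OF cont(3)] by blast
  obtain K3 where K3: "K3 \<ge> 0" "\<And>x. x \<in> {0..2} \<Longrightarrow> \<bar>f x\<bar> \<le> K3" using continuous_Icc_bound[OF cont(4)] by blast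
  define F where "F = ip {0<..<1} (\<lambda>x. \<Phi> (x - 1)) (\<lambda>x. \<Phi> (x - 1))"
  have F0: "F \<ge> 0" by (simp add: F_def ip_self_nonneg)
  define G where "G = K1 * C0 + K2 * (F + C0) + 2 * (K1 + K2 + K3)"
  have G0: "G \<ge> 0" using C0 K1 K2 K3 F0 by (simp add: G_def)
  define C where "C = 2 * G / \<beta> + (2 * G + B * (2 * G / \<beta>))"
  have C1: "2 * G / \<beta> \<ge> 0" using G0 \<beta> by simp
  show ?thesis
  proof (rule that[of C])
    show "C \<ge> 0" unfolding C_def using C1 G0 B0 by (intro add_nonneg_nonneg mult_nonneg_nonneg) auto
    fix \<epsilon> U Y x assume e: "0 < \<epsilon>" "\<epsilon> < (1::real)" and cs: "classical_solution \<epsilon> U Y" and x: "x \<in> {0..2::real}"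
    have U: "U 0 = 0" "U 2 = 0" and dU: "\<And>x. x \<in> {0..2} \<Longrightarrow> (U has_real_derivative Y x) (at x within {0..2})"
      and dY: "\<And>x. x \<in> {0..2} \<Longrightarrow> (Y has_real_derivative (c x * U x + d x * shifted \<Phi> U x - f x - b x * Y x) / \<epsilon>) (at x within {0..2})"
      using cs by (auto simp: classical_solution_def)
    have Uc: "continuous_on {0..2} U" by (rule DERIV_within_imp_continuous[OF dU])
    have sc: "continuous_on {0..2} (shifted \<Phi> U)" by (rule shifted_continuous[OF Uc U(1)])
    have UL: "U \<in> L2 \<Omega>" and sL: "shifted \<Phi> U \<in> L2 \<Omega>" by (rule continuous_Icc_L2; fact)+
    have U2: "ip \<Omega> U U \<le> C0" by (rule C0(2)[OF e(1) classical_solution_weak[OF cs e(1)]])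
    have s2: "ip \<Omega> (shifted \<Phi> U) (shifted \<Phi> U) \<le> F + C0"
    proof -
      have "ip {0<..<1} (shifted \<Phi> U) (shifted \<Phi> U) = F"
        unfolding F_def ip_def by (intro Bochner_Integration.integral_cong) auto
      moreover have "ip {1<..<2} (shifted \<Phi> U) (shifted \<Phi> U) = ip {1<..<2} (\<lambda>x. U (x - 1)) (\<lambda>x. U (x - 1))"
        unfolding ip_def by (intro Bochner_Integration.integral_cong) auto
      moreover have "ip {0<..<1} U U \<le> C0"
        using ip_halves[OF UL UL] U2 ip_self_nonneg[of "{1<..<2}" U] by simp
      ultimately show ?thesis using ip_halves[OF sL sL] shift_L2(2)[OF UL] by simp
    qed
    define R where "R = (\<lambda>x. (b' x + c x) * U x + d x * shifted \<Phi> U x - f x)"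
    have Rc: "continuous_on {0..2} R" unfolding R_def
      by (intro continuous_on_add continuous_on_diff continuous_on_mult cont Uc sc)
    have Ri: "integrable (lebesgue_on \<Omega>) R" by (rule L2_integrable[OF D continuous_Icc_L2[OF Rc]])
    have RG: "(LINT x|lebesgue_on \<Omega>. \<bar>R x\<bar>) \<le> G"
    proof -
      have ab: "\<bar>t\<bar> \<le> t * t + 1" for t :: real
        using sum_squares_bound[of "\<bar>t\<bar>" 1] by (simp add: power2_eq_square)
      have i: "integrable (lebesgue_on \<Omega>) (\<lambda>x. U x * U x)" "integrable (lebesgue_on \<Omega>) (\<lambda>x. shifted \<Phi> U x * shifted \<Phi> U x)"
        by (intro L2_mult_integrable UL sL)+
      have "(LINT x|lebesgue_on \<Omega>. \<bar>R x\<bar>) \<le> (LINT x|lebesgue_on \<Omega>. (K1 * (U x * U x) + K2 * (shifted \<Phi> U x * shifted \<Phi> U x)) + (K1 + K2 + K3))"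
      proof (rule integral_mono)
        show "integrable (lebesgue_on \<Omega>) (\<lambda>x. \<bar>R x\<bar>)" using Ri by simp
        fix x assume "x \<in> space (lebesgue_on \<Omega>)"
        then have x: "x \<in> {0..2}" by simp
        have "\<bar>R x\<bar> \<le> \<bar>b' x + c x\<bar> * \<bar>U x\<bar> + \<bar>d x\<bar> * \<bar>shifted \<Phi> U x\<bar> + \<bar>f x\<bar>"
          unfolding R_def abs_mult[symmetric] by linarith
        also have "\<dots> \<le> K1 * (U x * U x + 1) + K2 * (shifted \<Phi> U x * shifted \<Phi> U x + 1) + K3"
          by (intro add_mono mult_mono ab K1 K2 K3 x) auto
        finally show "\<bar>R x\<bar> \<le> (K1 * (U x * U x) + K2 * (shifted \<Phi> U x * shifted \<Phi> U x)) + (K1 + K2 + K3)"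
          by (simp only: distrib_left)
      qed (intro Bochner_Integration.integrable_add integrable_mult_right i integrable_const_interval)
      also have "\<dots> = (LINT x|lebesgue_on \<Omega>. K1 * (U x * U x) + K2 * (shifted \<Phi> U x * shifted \<Phi> U x)) + (LINT x|lebesgue_on \<Omega>. K1 + K2 + K3)"
        by (rule Bochner_Integration.integral_add) (intro Bochner_Integration.integrable_add integrable_mult_right i integrable_const_interval)+
      also have "(LINT x|lebesgue_on \<Omega>. K1 * (U x * U x) + K2 * (shifted \<Phi> U x * shifted \<Phi> U x))
          = K1 * ip \<Omega> U U + K2 * ip \<Omega> (shifted \<Phi> U) (shifted \<Phi> U)"
        by (simp only: ip_def integral_mult_right_zero
            Bochner_Integration.integral_add[OF integrable_mult_right[OF i(1)] integrable_mult_right[OF i(2)]])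
      also have "(LINT x|lebesgue_on \<Omega>. K1 + K2 + K3) = 2 * (K1 + K2 + K3)"
        by (simp only: LINT_eq_integral(1)[OF integrable_const_interval]) simp
      also have "K1 * ip \<Omega> U U + K2 * ip \<Omega> (shifted \<Phi> U) (shifted \<Phi> U) \<le> K1 * C0 + K2 * (F + C0)"
        by (intro add_mono mult_left_mono U2 s2 K1 K2)
      finally show ?thesis by (simp add: G_def)
    qed
    define \<kappa> where "\<kappa> = \<epsilon> * Y 0"
    have flux: "\<bar>\<epsilon> * Y x + b x * U x - \<kappa>\<bar> \<le> G" if x: "x \<in> {0..2}" for x
    proof -
      have "(R has_integral (\<epsilon> * Y x + b x * U x) - (\<epsilon> * Y 0 + b 0 * U 0)) {0..x}"
      proof (rule fundamental_theorem_of_calculus)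
        fix y assume y: "y \<in> {0..x}"
        then have y2: "y \<in> {0..2}" using x by auto
        have "((\<lambda>x. \<epsilon> * Y x + b x * U x) has_real_derivative R y) (at y within {0..2})"
        proof -
          have "\<epsilon> * ((c y * U y + d y * shifted \<Phi> U y - f y - b y * Y y) / \<epsilon>) + (b y * Y y + b' y * U y) = R y"
            using e by (simp add: R_def distrib_right)
          then show ?thesis
            using DERIV_add[OF DERIV_cmult[OF dY[OF y2], of \<epsilon>] DERIV_mult'[OF b_deriv[OF y2] dU[OF y2]]] by (simp only:)
        qed
        then have "((\<lambda>x. \<epsilon> * Y x + b x * U x) has_real_derivative R y) (at y within {0..x})"
          by (rule DERIV_subset) (use x in auto)
        then show "((\<lambda>x. \<epsilon> * Y x + b x * U x) has_vector_derivative R y) (at y within {0..x})"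
          by (simp add: has_real_derivative_iff_has_vector_derivative)
      qed (use x in auto)
      then have "\<epsilon> * Y x + b x * U x - \<kappa> = integral {0..x} R" using U by (simp add: \<kappa>_def integral_unique)
      then show ?thesis using abs_integral_le_LINT[OF Ri x] RG by simp
    qed
    have "\<kappa> - G \<le> 0"
      by (rule flux_sign[OF e _ dU _ U, of B]) (use B flux in \<open>force simp: abs_le_iff\<close>)+
    moreover have "- \<kappa> - G \<le> 0"
      by (rule flux_sign[OF e, of B "\<lambda>x. - U x" "\<lambda>x. - Y x"])
        (use B flux U dU in \<open>force simp: abs_le_iff intro: DERIV_minus\<close>)+
    ultimately have \<kappa>: "\<bar>\<kappa>\<bar> \<le> G" by linarith
    have fl: "\<bar>\<epsilon> * Y x + b x * U x\<bar> \<le> 2 * G" if "x \<in> {0..2}" for x using flux[OF that] \<kappa> by linarith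
    have Ub: "\<bar>U x\<bar> \<le> 2 * G / \<beta>"
    proof (rule first_order_barrier[OF b_cont e(1) dU _ _ _ x, where z' = "\<lambda>_. 0"])
      fix y :: real assume y: "y \<in> {0..2}"
      have "\<beta> * (2 * G / \<beta>) \<le> b y * (2 * G / \<beta>)" using \<beta>(2)[OF y] C1 by (rule mult_right_mono)
      then show "\<bar>\<epsilon> * Y y + b y * U y\<bar> \<le> \<epsilon> * 0 + b y * (2 * G / \<beta>)" using fl[OF y] \<beta>(1) by simp
    qed (use U C1 in auto)
    have "\<bar>b x * U x\<bar> \<le> B * (2 * G / \<beta>)" unfolding abs_mult using B[OF x] Ub B0 by (intro mult_mono) auto
    then have "\<bar>\<epsilon> * Y x\<bar> \<le> 2 * G + B * (2 * G / \<beta>)" using fl[OF x] by linarith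
    then have "\<bar>\<epsilon> * Y x\<bar> \<le> C" using C1 by (simp add: C_def)
    then have "\<bar>Y x\<bar> \<le> C / \<epsilon>" using e by (simp add: abs_mult field_simps)
    moreover have "0 \<le> B * (2 * G / \<beta>)" using B0 C1 by (intro mult_nonneg_nonneg) auto
    then have "2 * G / \<beta> \<le> C" using G0 unfolding C_def by linarith
    ultimately show "\<bar>U x\<bar> \<le> C \<and> \<bar>Y x\<bar> \<le> C / \<epsilon>" using Ub by linarith
  qed
qed

end

section \<open>Layer bounds for higher derivatives\<close>

lemma Cm_on_Suc:
  assumes "Cm_on (Suc n) I h"
  obtains h' where "\<And>x. x \<in> I \<Longrightarrow> (h has_real_derivative h' x) (at x within I)" "Cm_on n I h'"
proof -
  obtain g :: "nat \<Rightarrow> real \<Rightarrow> real" where g: "\<And>x. x \<in> I \<Longrightarrow> g 0 x = h x"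
    "\<And>i x. i < Suc n \<Longrightarrow> x \<in> I \<Longrightarrow> (g i has_real_derivative g (Suc i) x) (at x within I)" "continuous_on I (g (Suc n))"
    using assms unfolding Cm_on_def by blast
  show ?thesis
  proof (rule that[of "g (Suc 0)"])
    show "(h has_real_derivative g (Suc 0) x) (at x within I)" if "x \<in> I" for x
      by (rule has_field_derivative_transform_within[OF g(2)[of 0 x], of 1])
        (use g(1) that in auto)
    show "Cm_on n I (g (Suc 0))" unfolding Cm_on_def using g by (intro exI[of _ "\<lambda>i. g (Suc i)"]) auto
  qed
qed

lemma Cm_on_continuous: assumes "Cm_on n I h" shows "continuous_on I h"
proof (cases n)
  case 0
  then show ?thesis using assms by (auto simp: Cm_on_def cong: continuous_on_cong)
next
  case (Suc m)
  then show ?thesis using assms by (metis Cm_on_Suc DERIV_within_imp_continuous)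
qed

lemma Cm_on_mono:
  assumes "Cm_on n I h" "m \<le> n" "J \<subseteq> I" shows "Cm_on m J h"
proof -
  obtain g :: "nat \<Rightarrow> real \<Rightarrow> real" where g: "\<And>x. x \<in> I \<Longrightarrow> g 0 x = h x"
    "\<And>i x. i < n \<Longrightarrow> x \<in> I \<Longrightarrow> (g i has_real_derivative g (Suc i) x) (at x within I)" "continuous_on I (g n)"
    using assms unfolding Cm_on_def by blast
  have "continuous_on I (g m)"
    using assms(2) g(2)[of m] g(3) by (cases "m = n") (auto intro!: DERIV_within_imp_continuous)
  moreover have "(g i has_real_derivative g (Suc i) x) (at x within J)" if "i < m" "x \<in> J" for i x
    by (rule DERIV_subset[OF g(2)]) (use that assms in auto)
  ultimately show ?thesis unfolding Cm_on_def
    using g(1) assms by (intro exI[of _ g]) (auto intro: continuous_on_subset)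
qed

lemma has_real_derivative_shift:
  assumes "(h has_real_derivative D) (at (x - 1) within {p..q})"
  shows "((\<lambda>x. h (x - 1)) has_real_derivative D) (at x within {p+1..q+1})"
proof -
  have "(\<lambda>x::real. x - 1) ` {p+1..q+1} = {p..q}"
  proof
    show "{p..q} \<subseteq> (\<lambda>x. x - 1) ` {p+1..q+1}"
    proof
      fix y assume "y \<in> {p..q}"
      then show "y \<in> (\<lambda>x. x - 1) ` {p+1..q+1}" by (intro image_eqI[of _ _ "y + 1"]) auto
    qed
  qed auto
  then have "((h \<circ> (\<lambda>x. x - 1)) has_real_derivative D * 1) (at x within {p+1..q+1})"
    using assms by (intro DERIV_image_chain) (auto intro!: derivative_eq_intros)
  then show ?thesis by (simp add: o_def)
qed

lemma Cm_on_shift: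
  assumes "Cm_on n {p..q} h" shows "Cm_on n {p+1..q+1} (\<lambda>x. h (x - 1))"
proof -
  obtain g :: "nat \<Rightarrow> real \<Rightarrow> real" where g: "\<And>x. x \<in> {p..q} \<Longrightarrow> g 0 x = h x"
    "\<And>i x. i < n \<Longrightarrow> x \<in> {p..q} \<Longrightarrow> (g i has_real_derivative g (Suc i) x) (at x within {p..q})" "continuous_on {p..q} (g n)"
    using assms unfolding Cm_on_def by blast
  show ?thesis unfolding Cm_on_def
  proof (intro exI[of _ "\<lambda>i x. g i (x - 1)"] conjI ballI allI impI)
    show "continuous_on {p+1..q+1} (\<lambda>x. g n (x - 1))"
      by (rule continuous_on_compose2[OF g(3)]) (auto intro!: continuous_intros)
  qed (use g in \<open>auto intro!: has_real_derivative_shift\<close>)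
qed

text \<open>
  The size of an \<open>s\<close>-th derivative of a smooth function plus a boundary layer of width \<open>\<epsilon>\<close> that is attached to \<open>a\<close> on the
  right.
\<close>

definition layer :: "real \<Rightarrow> real \<Rightarrow> real \<Rightarrow> nat \<Rightarrow> real \<Rightarrow> real" where
  "layer \<beta> \<epsilon> a s x = 1 + exp (- \<beta> * (x - a) / \<epsilon>) / \<epsilon> ^ s"

lemma layer_ge_1: "\<epsilon> > 0 \<Longrightarrow> 1 \<le> layer \<beta> \<epsilon> a s x"
  by (simp add: layer_def)

lemma layer_Suc: assumes "0 < \<epsilon>" "\<epsilon> < 1" shows "layer \<beta> \<epsilon> a s x \<le> layer \<beta> \<epsilon> a (Suc s) x"
proof -
  have "\<epsilon> ^ Suc s \<le> \<epsilon> ^ s" using assms by (intro power_decreasing) auto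
  then show ?thesis unfolding layer_def using assms by (intro add_left_mono divide_left_mono) auto
qed

text \<open>
  To make "with a constant independent of \<open>\<epsilon>\<close>" a property closed under sums, products and differentiation, functions
  are replaced by families indexed by \<open>p \<in> S\<close>; the index carries the perturbation parameter \<open>eps p\<close>.
\<close>

locale small_parameter =
  fixes S :: "'p set" and eps :: "'p \<Rightarrow> real" and \<beta> :: real
  assumes eps: "\<And>p. p \<in> S \<Longrightarrow> 0 < eps p" "\<And>p. p \<in> S \<Longrightarrow> eps p < 1" and beta: "\<beta> > 0"
begin

definition layer_bounded :: "real \<Rightarrow> nat \<Rightarrow> ('p \<Rightarrow> real \<Rightarrow> real) \<Rightarrow> bool" where
  "layer_bounded a s h \<longleftrightarrow> (\<exists>C\<ge>0. \<forall>p\<in>S. \<forall>x\<in>{a..a+1}. \<bar>h p x\<bar> \<le> C * layer \<beta> (eps p) a s x)"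

text \<open>
  The derivatives of \<open>h\<close> up to order \<open>n\<close> exist on \<open>[a,a+1]\<close>, and each differentiation of \<open>h\<close> costs one more power of
  \<open>1 / \<epsilon>\<close> in the layer part.
\<close>

fun layered :: "real \<Rightarrow> nat \<Rightarrow> nat \<Rightarrow> ('p \<Rightarrow> real \<Rightarrow> real) \<Rightarrow> bool" where
  "layered a 0 s h \<longleftrightarrow> layer_bounded a s h"
| "layered a (Suc n) s h \<longleftrightarrow> layer_bounded a s h
     \<and> (\<exists>h'. (\<forall>p\<in>S. \<forall>x\<in>{a..a+1}. (h p has_real_derivative h' p x) (at x within {a..a+1})) \<and> layered a n (Suc s) h')"

lemma layered_SucI:
  assumes "layer_bounded a s h" "layered a n (Suc s) h'"
    "\<And>p x. p \<in> S \<Longrightarrow> x \<in> {a..a+1} \<Longrightarrow> (h p has_real_derivative h' p x) (at x within {a..a+1})"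
  shows "layered a (Suc n) s h"
  unfolding layered.simps using assms by blast

lemma layered_SucE:
  assumes "layered a (Suc n) s h"
  obtains h' where "layer_bounded a s h" "layered a n (Suc s) h'"
    "\<And>p x. p \<in> S \<Longrightarrow> x \<in> {a..a+1} \<Longrightarrow> (h p has_real_derivative h' p x) (at x within {a..a+1})"
  using assms unfolding layered.simps by blast

lemma layered_bounded: "layered a n s h \<Longrightarrow> layer_bounded a s h"
  by (cases n) auto

lemma layered_Suc_D: "layered a (Suc n) s h \<Longrightarrow> layered a n s h"
proof (induction n arbitrary: s h)
  case (Suc n)
  from Suc.prems obtain h' where "layer_bounded a s h" "layered a (Suc n) (Suc s) h'"
    "\<And>p x. p \<in> S \<Longrightarrow> x \<in> {a..a+1} \<Longrightarrow> (h p has_real_derivative h' p x) (at x within {a..a+1})" by (rule layered_SucE) blast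
  then show ?case by (intro layered_SucI[of a s h n h'] Suc.IH)
qed simp

lemma layer_bounded_Suc: assumes "layer_bounded a s h" shows "layer_bounded a (Suc s) h"
proof -
  obtain C where C: "C \<ge> 0" "\<And>p x. p \<in> S \<Longrightarrow> x \<in> {a..a+1} \<Longrightarrow> \<bar>h p x\<bar> \<le> C * layer \<beta> (eps p) a s x"
    using assms unfolding layer_bounded_def by blast
  have "C * layer \<beta> (eps p) a s x \<le> C * layer \<beta> (eps p) a (Suc s) x" if "p \<in> S" for p x
    using C(1) layer_Suc eps that by (intro mult_left_mono) auto
  then show ?thesis unfolding layer_bounded_def using C by (meson order_trans)
qed

lemma layered_weaken: "layered a n s h \<Longrightarrow> layered a n (Suc s) h"
proof (induction n arbitrary: s h)
  case (Suc n)
  from Suc.prems obtain h' where h: "layer_bounded a s h" "layered a n (Suc s) h'"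
    "\<And>p x. p \<in> S \<Longrightarrow> x \<in> {a..a+1} \<Longrightarrow> (h p has_real_derivative h' p x) (at x within {a..a+1})" by (rule layered_SucE) blast
  show ?case by (rule layered_SucI[OF layer_bounded_Suc[OF h(1)] Suc.IH[OF h(2)] h(3)])
qed (simp add: layer_bounded_Suc)

lemma layer_bounded_add:
  assumes "layer_bounded a s h" "layer_bounded a s g" shows "layer_bounded a s (\<lambda>p x. h p x + g p x)"
proof -
  obtain C where C: "C \<ge> 0" "\<And>p x. p \<in> S \<Longrightarrow> x \<in> {a..a+1} \<Longrightarrow> \<bar>h p x\<bar> \<le> C * layer \<beta> (eps p) a s x"
    using assms unfolding layer_bounded_def by blast
  obtain D where D: "D \<ge> 0" "\<And>p x. p \<in> S \<Longrightarrow> x \<in> {a..a+1} \<Longrightarrow> \<bar>g p x\<bar> \<le> D * layer \<beta> (eps p) a s x"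
    using assms unfolding layer_bounded_def by blast
  have "\<bar>h p x + g p x\<bar> \<le> (C + D) * layer \<beta> (eps p) a s x" if "p \<in> S" "x \<in> {a..a+1}" for p x
    using C(2)[OF that] D(2)[OF that] by (simp add: distrib_right)
  then show ?thesis unfolding layer_bounded_def using C D by (intro exI[of _ "C + D"]) auto
qed

lemma layered_add: "layered a n s h \<Longrightarrow> layered a n s g \<Longrightarrow> layered a n s (\<lambda>p x. h p x + g p x)"
proof (induction n arbitrary: s h g)
  case (Suc n)
  from Suc.prems(1) obtain h' where h: "layer_bounded a s h"
    "\<forall>p\<in>S. \<forall>x\<in>{a..a+1}. (h p has_real_derivative h' p x) (at x within {a..a+1})" "layered a n (Suc s) h'" by auto
  from Suc.prems(2) obtain g' where g: "layer_bounded a s g"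
    "\<forall>p\<in>S. \<forall>x\<in>{a..a+1}. (g p has_real_derivative g' p x) (at x within {a..a+1})" "layered a n (Suc s) g'" by auto
  show ?case
    by (rule layered_SucI[OF layer_bounded_add[OF h(1) g(1)] Suc.IH[OF h(3) g(3)]])
      (use h(2) g(2) in \<open>auto intro!: derivative_intros\<close>)
qed (simp add: layer_bounded_add)

lemma layer_bounded_mult:
  assumes b: "continuous_on {a..a+1} b" and "layer_bounded a s h" shows "layer_bounded a s (\<lambda>p x. b x * h p x)"
proof -
  obtain C where C: "C \<ge> 0" "\<And>p x. p \<in> S \<Longrightarrow> x \<in> {a..a+1} \<Longrightarrow> \<bar>h p x\<bar> \<le> C * layer \<beta> (eps p) a s x"
    using assms unfolding layer_bounded_def by blast
  obtain B where B: "B \<ge> 0" "\<And>x. x \<in> {a..a+1} \<Longrightarrow> \<bar>b x\<bar> \<le> B" using continuous_Icc_bound[OF b] by blast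
  have "\<bar>b x * h p x\<bar> \<le> (B * C) * layer \<beta> (eps p) a s x" if "p \<in> S" "x \<in> {a..a+1}" for p x
    unfolding abs_mult mult.assoc using B C that by (intro mult_mono) auto
  then show ?thesis unfolding layer_bounded_def using B C by (intro exI[of _ "B * C"]) auto
qed

text \<open>
  The coefficient \<open>b\<close> does not vary with the parameter. By the product rule the derivative is \<open>b' h + b h'\<close>, where \<open>b' h\<close>
  even satisfies the layer bounds with one power of \<open>1 / \<epsilon>\<close> less.
\<close>

lemma layered_mult: "Cm_on n {a..a+1} b \<Longrightarrow> layered a n s h \<Longrightarrow> layered a n s (\<lambda>p x. b x * h p x)"
proof (induction n arbitrary: s h b)
  case (Suc n)
  obtain b' where b: "\<And>x. x \<in> {a..a+1} \<Longrightarrow> (b has_real_derivative b' x) (at x within {a..a+1})" "Cm_on n {a..a+1} b'"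
    using Cm_on_Suc[OF Suc.prems(1)] by blast
  from Suc.prems(2) obtain h' where h: "layer_bounded a s h"
    "\<forall>p\<in>S. \<forall>x\<in>{a..a+1}. (h p has_real_derivative h' p x) (at x within {a..a+1})" "layered a n (Suc s) h'" by auto
  have "Cm_on n {a..a+1} b" by (rule Cm_on_mono[OF Suc.prems(1)]) auto
  moreover have "layered a n (Suc s) h" by (rule layered_weaken[OF layered_Suc_D[OF Suc.prems(2)]])
  ultimately have "layered a n (Suc s) (\<lambda>p x. b' x * h p x + b x * h' p x)"
    using Suc.IH b(2) h(3) by (intro layered_add) auto
  moreover have "((\<lambda>x. b x * h p x) has_real_derivative b' x * h p x + b x * h' p x) (at x within {a..a+1})"
    if "p \<in> S" "x \<in> {a..a+1}" for p x
    using DERIV_mult'[OF b(1)[OF that(2)] h(2)[rule_format, OF that]] by (simp add: add.commute)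
  moreover have "layer_bounded a s (\<lambda>p x. b x * h p x)"
    by (rule layer_bounded_mult[OF Cm_on_continuous[OF Suc.prems(1)] h(1)])
  ultimately show ?case by (intro layered_SucI)
qed (simp add: layer_bounded_mult Cm_on_continuous)

lemma layered_const: "layered a n s (\<lambda>p x. k)"
proof (induction n arbitrary: s k)
  have "layer_bounded a s (\<lambda>p x. k)" for s k
    unfolding layer_bounded_def
  proof (intro exI[of _ "\<bar>k\<bar>"] conjI ballI)
    fix p x assume "p \<in> S"
    then show "\<bar>k\<bar> \<le> \<bar>k\<bar> * layer \<beta> (eps p) a s x" using layer_ge_1[OF eps(1)] mult_left_mono[of 1 _ "\<bar>k\<bar>"] by fastforce
  qed simp
  note * = this
  { case 0 show ?case using * by simp }
  { case (Suc n) then show ?case using * by (auto intro!: exI[of _ "\<lambda>_ _. 0"]) }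
qed

lemma layered_smooth: "Cm_on n {a..a+1} g \<Longrightarrow> layered a n s (\<lambda>p. g)"
  using layered_mult[OF _ layered_const[of a n s 1]] by simp

lemma layered_cong:
  assumes "layered a n s h" and eq: "\<And>p x. p \<in> S \<Longrightarrow> x \<in> {a..a+1} \<Longrightarrow> h p x = g p x"
  shows "layered a n s g"
proof -
  have b: "layer_bounded a s g" using layered_bounded[OF assms(1)] eq by (simp add: layer_bounded_def)
  show ?thesis
  proof (cases n)
    case (Suc m)
    then obtain h' where h: "\<forall>p\<in>S. \<forall>x\<in>{a..a+1}. (h p has_real_derivative h' p x) (at x within {a..a+1})" "layered a m (Suc s) h'"
      using assms(1) by auto
    have "(g p has_real_derivative h' p x) (at x within {a..a+1})" if "p \<in> S" "x \<in> {a..a+1}" for p x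
      by (rule has_field_derivative_transform_within[OF h(1)[rule_format, OF that], of 1]) (use eq that in auto)
    then show ?thesis unfolding Suc by (rule layered_SucI[OF b h(2)])
  qed (use b in simp)
qed

lemma layered_shift:
  "layered a n s h \<Longrightarrow> layered (a + 1) n s (\<lambda>p x. h p (x - 1))"
proof (induction n arbitrary: s h)
  have b: "layer_bounded (a + 1) s (\<lambda>p x. h p (x - 1))" if lb: "layer_bounded a s h" for s h
  proof -
    obtain C where C: "C \<ge> 0" "\<And>p x. p \<in> S \<Longrightarrow> x \<in> {a..a+1} \<Longrightarrow> \<bar>h p x\<bar> \<le> C * layer \<beta> (eps p) a s x"
      using lb unfolding layer_bounded_def by blast
    have "layer \<beta> (eps p) (a + 1) s x = layer \<beta> (eps p) a s (x - 1)" for p x by (simp add: layer_def algebra_simps)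
    then show ?thesis unfolding layer_bounded_def using C by (intro exI[of _ C]) auto
  qed
  { case 0 then show ?case using b by simp }
  { case (Suc n)
    then obtain h' where h: "layer_bounded a s h"
      "\<forall>p\<in>S. \<forall>x\<in>{a..a+1}. (h p has_real_derivative h' p x) (at x within {a..a+1})" "layered a n (Suc s) h'" by auto
    have "((\<lambda>x. h p (x - 1)) has_real_derivative h' p (x - 1)) (at x within {a+1..a+1+1})"
      if "p \<in> S" "x \<in> {a+1..a+1+1}" for p x
      by (rule has_real_derivative_shift) (use h(2) that in auto)
    then show ?case by (rule layered_SucI[OF b[OF h(1)] Suc.IH[OF h(3)]]) }
qed

lemma layered_derivatives:
  "layered a n s h \<Longrightarrow> \<exists>C\<ge>0. \<forall>p\<in>S. \<exists>g. g 0 = h p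
     \<and> (\<forall>i<n. \<forall>x\<in>{a..a+1}. (g i has_real_derivative g (Suc i) x) (at x within {a..a+1}))
     \<and> (\<forall>x\<in>{a..a+1}. \<bar>g n x\<bar> \<le> C * layer \<beta> (eps p) a (s + n) x)"
proof (induction n arbitrary: s h)
  case 0
  then obtain C where "C \<ge> 0" "\<forall>p\<in>S. \<forall>x\<in>{a..a+1}. \<bar>h p x\<bar> \<le> C * layer \<beta> (eps p) a s x"
    by (auto simp: layer_bounded_def)
  then show ?case by (intro exI[of _ C]) (auto intro!: exI[of _ "\<lambda>_. h _"])
next
  case (Suc n)
  then obtain h' where h: "\<forall>p\<in>S. \<forall>x\<in>{a..a+1}. (h p has_real_derivative h' p x) (at x within {a..a+1})" "layered a n (Suc s) h'"
    by auto
  obtain C where C: "C \<ge> 0" "\<forall>p\<in>S. \<exists>g. g 0 = h' p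
     \<and> (\<forall>i<n. \<forall>x\<in>{a..a+1}. (g i has_real_derivative g (Suc i) x) (at x within {a..a+1}))
     \<and> (\<forall>x\<in>{a..a+1}. \<bar>g n x\<bar> \<le> C * layer \<beta> (eps p) a (Suc s + n) x)" using Suc.IH[OF h(2)] by blast
  show ?case
  proof (intro exI[of _ C] conjI ballI C(1))
    fix p assume p: "p \<in> S"
    then obtain g where g: "g 0 = h' p"
     "\<forall>i<n. \<forall>x\<in>{a..a+1}. (g i has_real_derivative g (Suc i) x) (at x within {a..a+1})"
     "\<forall>x\<in>{a..a+1}. \<bar>g n x\<bar> \<le> C * layer \<beta> (eps p) a (Suc s + n) x" using C(2) by blast
    define G where "G = case_nat (h p) g"
    have "(G i has_real_derivative G (Suc i) x) (at x within {a..a+1})" if "i < Suc n" "x \<in> {a..a+1}" for i x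
      using that g h(1) p by (cases i) (auto simp: G_def)
    then show "\<exists>g. g 0 = h p \<and> (\<forall>i<Suc n. \<forall>x\<in>{a..a+1}. (g i has_real_derivative g (Suc i) x) (at x within {a..a+1}))
     \<and> (\<forall>x\<in>{a..a+1}. \<bar>g (Suc n) x\<bar> \<le> C * layer \<beta> (eps p) a (s + Suc n) x)"
      using g(3) by (intro exI[of _ G]) (auto simp: G_def)
  qed
qed

text \<open>
  The barrier is the sum of a constant \<open>M / \<beta>\<close>, which absorbs the smooth part of \<open>G\<close>, and \<open>M (1 + (x - a)) E(x)\<close>, where
  \<open>E\<close> solves \<open>\<epsilon> E' + \<beta> E = 0\<close>. The linear factor is needed since the layer part of \<open>G\<close> decays at the same rate as \<open>E\<close>:
  differentiating it produces the term \<open>\<epsilon> M E\<close> that dominates this part.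
\<close>

lemma layer_bounded_transport:
  assumes b: "continuous_on {a..a+1} b" and bb: "\<And>x. x \<in> {a..a+1} \<Longrightarrow> \<beta> \<le> b x"
    and d: "\<And>p x. p \<in> S \<Longrightarrow> x \<in> {a..a+1} \<Longrightarrow> (y p has_real_derivative y' p x) (at x within {a..a+1})"
    and eq: "\<And>p x. p \<in> S \<Longrightarrow> x \<in> {a..a+1} \<Longrightarrow> eps p * y' p x + b x * y p x = G p x"
    and G: "layer_bounded a s G" and K: "\<And>p. p \<in> S \<Longrightarrow> \<bar>y p a\<bar> \<le> K / eps p ^ Suc s"
  shows "layer_bounded a (Suc s) y"
proof -
  obtain C where C: "C \<ge> 0" "\<And>p x. p \<in> S \<Longrightarrow> x \<in> {a..a+1} \<Longrightarrow> \<bar>G p x\<bar> \<le> C * layer \<beta> (eps p) a s x"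
    using G unfolding layer_bounded_def by blast
  \<comment> \<open>One constant for the right-hand side and for the initial value.\<close>
  define M where "M = max C \<bar>K\<bar>"
  have M: "M \<ge> 0" "C \<le> M" "K \<le> M" using C by (auto simp: M_def)
  have main: "\<bar>y p x\<bar> \<le> M / \<beta> + M * (1 + (x - a)) * (exp (- \<beta> * (x - a) / eps p) / eps p ^ Suc s)"
    if p: "p \<in> S" and x: "x \<in> {a..a+1}" for p x
  proof -
    define e where "e = eps p"
    have e: "e > 0" using eps p by (simp add: e_def)
    define E where "E = (\<lambda>x. exp (- \<beta> * (x - a) / e) / e ^ Suc s)"
    have E0: "E x \<ge> 0" for x using e by (simp add: E_def)
    have dE: "(E has_real_derivative - \<beta> / e * E x) (at x within A)" for x A
      unfolding E_def using e by (auto intro!: derivative_eq_intros simp: field_simps)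
    have "\<bar>y p x\<bar> \<le> M / \<beta> + M * (1 + (x - a)) * E x"
    proof (rule first_order_barrier[OF b e d[OF p] _ _ _ x])
      fix x assume x: "x \<in> {a..a+1}"
      show "((\<lambda>x. M / \<beta> + M * (1 + (x - a)) * E x) has_real_derivative M * E x + M * (1 + (x - a)) * (- \<beta> / e * E x)) (at x within {a..a+1})"
        by (auto intro!: derivative_eq_intros dE)
      have "M = \<beta> * (M / \<beta>)" using beta by simp
      also have "\<dots> \<le> b x * (M / \<beta>)" using bb[OF x] M beta by (intro mult_right_mono) auto
      finally have 1: "M \<le> b x * (M / \<beta>)" .
      have 2: "\<beta> * (M * (1 + (x - a)) * E x) \<le> b x * (M * (1 + (x - a)) * E x)"
        using bb[OF x] M E0[of x] x by (intro mult_right_mono mult_nonneg_nonneg) auto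
      have "\<bar>e * y' p x + b x * y p x\<bar> \<le> C * layer \<beta> e a s x" using eq[OF p x] C(2)[OF p x] by (simp add: e_def)
      also have "\<dots> \<le> M * layer \<beta> e a s x" using M layer_ge_1[OF e, of \<beta> a s x] by (intro mult_right_mono) auto
      also have "layer \<beta> e a s x = 1 + e * E x" using e by (simp add: layer_def E_def)
      also have "M * (1 + e * E x) \<le> e * (M * E x + M * (1 + (x - a)) * (- \<beta> / e * E x)) + b x * (M / \<beta> + M * (1 + (x - a)) * E x)"
      proof -
        have "e * (M * E x + M * (1 + (x - a)) * (- \<beta> / e * E x)) = e * M * E x - \<beta> * (M * (1 + (x - a)) * E x)"
          using e by (simp add: field_simps)
        then show ?thesis using 1 2 by (simp only: distrib_left mult_1_right mult.left_commute[of M e] mult.assoc)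
      qed
      finally show "\<bar>e * y' p x + b x * y p x\<bar> \<le> e * (M * E x + M * (1 + (x - a)) * (- \<beta> / e * E x)) + b x * (M / \<beta> + M * (1 + (x - a)) * E x)" .
    next
      have "\<bar>y p a\<bar> \<le> K / e ^ Suc s" using K[OF p] by (simp add: e_def)
      also have "\<dots> \<le> M / e ^ Suc s" using M e by (intro divide_right_mono) auto
      finally have "\<bar>y p a\<bar> \<le> M * (1 + (a - a)) * E a" by (simp add: E_def)
      moreover have "M / \<beta> \<ge> 0" using M beta by simp
      ultimately show "\<bar>y p a\<bar> \<le> M / \<beta> + M * (1 + (a - a)) * E a" by linarith
    qed
    then show ?thesis by (simp add: E_def e_def)
  qed
  have "\<bar>y p x\<bar> \<le> (M / \<beta> + 2 * M) * layer \<beta> (eps p) a (Suc s) x" if p: "p \<in> S" and x: "x \<in> {a..a+1}" for p x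
  proof -
    define E where "E = exp (- \<beta> * (x - a) / eps p) / eps p ^ Suc s"
    have E: "E \<ge> 0" using eps(1)[OF p] by (simp add: E_def)
    have "M * (1 + (x - a)) * E \<le> M * 2 * E" using x M E by (intro mult_right_mono mult_left_mono) auto
    moreover have "0 \<le> M / \<beta> * E" using M beta by (intro mult_nonneg_nonneg E) auto
    ultimately show ?thesis using main[OF p x, folded E_def] M
      by (simp only: layer_def E_def[symmetric] distrib_left distrib_right mult_1_right)
  qed
  moreover have "M / \<beta> + 2 * M \<ge> 0" using M beta by simp
  ultimately show ?thesis unfolding layer_bounded_def by blast
qed

text \<open>
  Differentiating \<open>\<epsilon> y' + b y = G\<close> gives \<open>\<epsilon> y'' + b y' = G' - b' y\<close>, an equation of the same kind whose right-hand side
  is bounded with one more power of \<open>1 / \<epsilon>\<close>; the initial value of \<open>y'\<close> is read off the original equation. So the bounds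
  follow by induction on the number of derivatives.
\<close>

lemma layered_transport:
  assumes bb: "\<And>x. x \<in> {a..a+1} \<Longrightarrow> \<beta> \<le> b x"
  shows "Cm_on n {a..a+1} b \<Longrightarrow> layered a n s G \<Longrightarrow>
    (\<And>p x. p \<in> S \<Longrightarrow> x \<in> {a..a+1} \<Longrightarrow> (y p has_real_derivative y' p x) (at x within {a..a+1})) \<Longrightarrow>
    (\<And>p x. p \<in> S \<Longrightarrow> x \<in> {a..a+1} \<Longrightarrow> eps p * y' p x + b x * y p x = G p x) \<Longrightarrow>
    (\<And>p. p \<in> S \<Longrightarrow> \<bar>y p a\<bar> \<le> K / eps p ^ Suc s) \<Longrightarrow> layered a n (Suc s) y"
proof (induction n arbitrary: s G y y' K)
  case 0
  show ?case
    using 0(2) layer_bounded_transport[OF Cm_on_continuous[OF 0(1)] bb 0(3) 0(4) _ 0(5)] by simp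
next
  case (Suc n)
  note d = Suc.prems(3) and eq = Suc.prems(4) and K = Suc.prems(5)
  have a: "a \<in> {a..a+1}" by simp
  have bn: "Cm_on n {a..a+1} b" by (rule Cm_on_mono[OF Suc.prems(1)]) auto
  obtain b' where b: "\<And>x. x \<in> {a..a+1} \<Longrightarrow> (b has_real_derivative b' x) (at x within {a..a+1})" "Cm_on n {a..a+1} b'"
    using Cm_on_Suc[OF Suc.prems(1)] by blast
  obtain G' where G: "layer_bounded a s G"
    "\<forall>p\<in>S. \<forall>x\<in>{a..a+1}. (G p has_real_derivative G' p x) (at x within {a..a+1})" "layered a n (Suc s) G'"
    using Suc.prems(2) by auto
  have y: "layered a n (Suc s) y" by (rule Suc.IH[OF bn layered_Suc_D[OF Suc.prems(2)] d eq K])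
  \<comment> \<open>The right-hand side of the differentiated equation.\<close>
  define G1 where "G1 = (\<lambda>p x. G' p x + (- 1) * (b' x * y p x))"
  have "layered a n (Suc s) (\<lambda>p x. (-1) * (b' x * y p x))"
    by (rule layered_mult[OF _ layered_mult[OF b(2) y]]) (auto simp: Cm_on_def intro!: exI[of _ "\<lambda>i x. if i = 0 then -1 else 0"])
  then have G1: "layered a n (Suc s) G1" unfolding G1_def by (rule layered_add[OF G(3)])
  define y'' where "y'' = (\<lambda>p x. (G1 p x - b x * y' p x) / eps p)"
  have d2: "(y' p has_real_derivative y'' p x) (at x within {a..a+1})" if p: "p \<in> S" and x: "x \<in> {a..a+1}" for p x
  proof -
    have e: "eps p \<noteq> 0" using eps(1)[OF p] by simp
    have "((\<lambda>x. (G p x - b x * y p x) / eps p) has_real_derivative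
       (G' p x - (b' x * y p x + b x * y' p x)) / eps p) (at x within {a..a+1})"
      using e by (auto intro!: derivative_eq_intros G(2)[rule_format, OF p x] b(1)[OF x] d[OF p x])
    then have D: "((\<lambda>x. (G p x - b x * y p x) / eps p) has_real_derivative y'' p x) (at x within {a..a+1})"
      by (simp add: y''_def G1_def algebra_simps)
    have "(G p x - b x * y p x) / eps p = y' p x" if "x \<in> {a..a+1}" for x
      using eq[OF p that] e by (simp add: field_simps)
    then show ?thesis by (intro has_field_derivative_transform_within[OF D, of 1]) (use x in auto)
  qed
  have eq2: "eps p * y'' p x + b x * y' p x = G1 p x" if "p \<in> S" for p x
    using eps(1)[OF that] by (simp add: y''_def)
  obtain C where C: "C \<ge> 0" "\<And>p x. p \<in> S \<Longrightarrow> x \<in> {a..a+1} \<Longrightarrow> \<bar>G p x\<bar> \<le> C * layer \<beta> (eps p) a s x"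
    using G unfolding layer_bounded_def by blast
  have K2: "\<bar>y' p a\<bar> \<le> (2 * C + \<bar>b a\<bar> * K) / eps p ^ Suc (Suc s)" if p: "p \<in> S" for p
  proof -
    define e where "e = eps p"
    have e: "0 < e" "e < 1" using eps p by (auto simp: e_def)
    have pw: "1 \<le> 1 / e ^ Suc s" "1 / e ^ s \<le> 1 / e ^ Suc s"
      using e power_le_one[of e "Suc s"] power_decreasing[of s "Suc s" e] by (auto intro!: divide_left_mono simp del: power_Suc)
    have "\<bar>G p a\<bar> \<le> C * (1 + 1 / e ^ s)" using C(2)[OF p a] by (simp add: layer_def e_def)
    also have "\<dots> \<le> C * (2 * (1 / e ^ Suc s))" using C(1) pw by (intro mult_left_mono) linarith+
    also have "\<dots> = 2 * C * (1 / e ^ Suc s)" by (simp only: mult_ac)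
    finally have 1: "\<bar>G p a\<bar> \<le> 2 * C * (1 / e ^ Suc s)" .
    have "\<bar>b a * y p a\<bar> \<le> \<bar>b a\<bar> * (K / e ^ Suc s)" unfolding abs_mult using K[OF p] by (intro mult_left_mono) (auto simp: e_def)
    then have "\<bar>b a * y p a\<bar> \<le> \<bar>b a\<bar> * K * (1 / e ^ Suc s)" by simp
    then have "\<bar>G p a - b a * y p a\<bar> \<le> (2 * C + \<bar>b a\<bar> * K) * (1 / e ^ Suc s)" using 1 unfolding distrib_right by linarith
    moreover have "e * y' p a = G p a - b a * y p a" using eq[OF p a] by (simp add: e_def)
    ultimately have "e * \<bar>y' p a\<bar> \<le> (2 * C + \<bar>b a\<bar> * K) * (1 / e ^ Suc s)" using e by (metis abs_mult abs_of_pos)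
    then have "\<bar>y' p a\<bar> \<le> (2 * C + \<bar>b a\<bar> * K) * (1 / e ^ Suc s) / e"
      by (subst pos_le_divide_eq[OF e(1)]) (simp only: mult.commute)
    then show ?thesis by (simp add: e_def mult.commute)
  qed
  have "layered a n (Suc (Suc s)) y'" by (rule Suc.IH[OF bn G1 d2 eq2 K2])
  then show ?case using layered_bounded[OF y] d by (intro layered_SucI)
qed

text \<open>
  For \<open>Y = U'\<close> the equation is \<open>\<epsilon> Y' + b Y = c U + g\<close>. Bounds for \<open>j\<close> derivatives of \<open>U\<close> give bounds for \<open>j\<close> derivatives
  of the right-hand side, hence of \<open>Y\<close>, hence for \<open>j + 1\<close> derivatives of \<open>U\<close>.
\<close>

lemma layered_convection_diffusion:
  assumes bb: "\<And>x. x \<in> {a..a+1} \<Longrightarrow> \<beta> \<le> b x"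
    and b: "Cm_on n {a..a+1} b" and c: "Cm_on n {a..a+1} c" and g: "layered a n 0 g"
    and dU: "\<And>p x. p \<in> S \<Longrightarrow> x \<in> {a..a+1} \<Longrightarrow> (U p has_real_derivative Y p x) (at x within {a..a+1})"
    and dY: "\<And>p x. p \<in> S \<Longrightarrow> x \<in> {a..a+1} \<Longrightarrow> (Y p has_real_derivative Y' p x) (at x within {a..a+1})"
    and eq: "\<And>p x. p \<in> S \<Longrightarrow> x \<in> {a..a+1} \<Longrightarrow> eps p * Y' p x + b x * Y p x = c x * U p x + g p x"
    and bd: "\<And>p x. p \<in> S \<Longrightarrow> x \<in> {a..a+1} \<Longrightarrow> \<bar>U p x\<bar> \<le> K" "\<And>p. p \<in> S \<Longrightarrow> \<bar>Y p a\<bar> \<le> K / eps p"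
  shows "layered a n (Suc 0) Y"
proof -
  have U0: "layer_bounded a 0 U" unfolding layer_bounded_def
  proof (intro exI[of _ "\<bar>K\<bar>"] conjI ballI)
    fix p x assume p: "p \<in> S" and x: "x \<in> {a..a+1}"
    have "\<bar>K\<bar> * 1 \<le> \<bar>K\<bar> * layer \<beta> (eps p) a 0 x" using layer_ge_1[OF eps(1)[OF p]] by (intro mult_left_mono) auto
    then show "\<bar>U p x\<bar> \<le> \<bar>K\<bar> * layer \<beta> (eps p) a 0 x" using bd(1)[OF p x] by linarith
  qed simp
  have down: "layered a j s h" if "layered a (i + j) s h" for i j s h
    using that by (induction i) (auto simp del: layered.simps dest: layered_Suc_D)
  have Y: "layered a j (Suc 0) Y" if j: "j \<le> n" and U: "layered a j 0 U" for j
  proof -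
    have bj: "Cm_on j {a..a+1} b" and cj: "Cm_on j {a..a+1} c"
      using Cm_on_mono[OF b j] Cm_on_mono[OF c j] by auto
    have gj: "layered a j 0 g" using down[of "n - j" j] g j by simp
    have "layered a j 0 (\<lambda>p x. c x * U p x + g p x)" by (intro layered_add layered_mult cj U gj)
    then show ?thesis
      using bd(2) by (intro layered_transport[OF bb bj _ dY eq, where K = K]) auto
  qed
  have U: "layered a j 0 U" if "j \<le> n" for j
    using that
  proof (induction j)
    case (Suc j)
    then have "layered a j (Suc 0) Y" by (intro Y) auto
    then show ?case using U0 dU by (intro layered_SucI)
  qed (simp add: U0)
  show ?thesis by (rule Y[OF order_refl U[OF order_refl]])
qed

end

section \<open>Piecewise functions on a mesh\<close>

definition consecutive :: "real set \<Rightarrow> real \<Rightarrow> real \<Rightarrow> bool" where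
  "consecutive T l r \<longleftrightarrow> l \<in> T \<and> r \<in> T \<and> l < r \<and> {l<..<r} \<inter> T = {}"

definition lo :: "real set \<Rightarrow> real \<Rightarrow> real" where "lo T x = Max {t \<in> T. t < x}"
definition hi :: "real set \<Rightarrow> real \<Rightarrow> real" where "hi T x = Min {t \<in> T. x < t}"

text \<open>
  \<open>F l r\<close> is meant for the cell between the consecutive mesh points \<open>l\<close> and \<open>r\<close>. The value 0 at mesh points suits
  pieces that vanish at both ends of their cell, for which gluing preserves continuity.
\<close>

definition glue :: "real set \<Rightarrow> (real \<Rightarrow> real \<Rightarrow> real \<Rightarrow> real) \<Rightarrow> real \<Rightarrow> real" where
  "glue T F x = (if x \<in> T then 0 else F (lo T x) (hi T x) x)"

lemma consecutive_lo_hi: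
  assumes T: "finite T" "p \<in> T" "q \<in> T" and x: "x \<in> {p<..<q} - T"
  shows "consecutive T (lo T x) (hi T x)" "lo T x < x" "x < hi T x"
proof -
  have l: "lo T x \<in> {t \<in> T. t < x}" unfolding lo_def using T x by (intro Max_in) auto
  have h: "hi T x \<in> {t \<in> T. x < t}" unfolding hi_def using T x by (intro Min_in) auto
  have "t \<notin> {lo T x<..<hi T x}" if "t \<in> T" for t
  proof (cases "t < x")
    case True
    then have "t \<le> lo T x" unfolding lo_def using T that by (intro Max_ge) auto
    then show ?thesis by simp
  next
    case False
    then have "x < t" using x that by (cases "t = x") auto
    then have "hi T x \<le> t" unfolding hi_def using T that by (intro Min_le) auto
    then show ?thesis by simp
  qed
  then show "consecutive T (lo T x) (hi T x)" "lo T x < x" "x < hi T x"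
    using l h by (auto simp: consecutive_def)
qed

lemma lo_hi_eq:
  assumes T: "finite T" and c: "consecutive T l r" and x: "x \<in> {l<..<r}"
  shows "lo T x = l" "hi T x = r" "x \<notin> T"
proof -
  have n: "t \<notin> {l<..<r}" if "t \<in> T" for t using c that by (auto simp: consecutive_def)
  show "lo T x = l" unfolding lo_def
  proof (rule Max_eqI)
    show "t \<le> l" if "t \<in> {t \<in> T. t < x}" for t using n[of t] that x by force
  qed (use T c x in \<open>auto simp: consecutive_def\<close>)
  show "hi T x = r" unfolding hi_def
  proof (rule Min_eqI)
    show "r \<le> t" if "t \<in> {t \<in> T. x < t}" for t using n[of t] that x by force
  qed (use T c x in \<open>auto simp: consecutive_def\<close>)
  show "x \<notin> T" using n x by blast
qed

lemma glue_interior: "finite T \<Longrightarrow> consecutive T l r \<Longrightarrow> x \<in> {l<..<r} \<Longrightarrow> glue T F x = F l r x"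
  by (simp add: glue_def lo_hi_eq)

lemma glue_H01:
  assumes T: "finite T" "0 \<in> T" "2 \<in> T" "T \<subseteq> {0..2}"
    and c: "\<And>l r. consecutive T l r \<Longrightarrow> continuous_on {l..r} (F l r)"
    and z: "\<And>l r. consecutive T l r \<Longrightarrow> F l r l = 0" "\<And>l r. consecutive T l r \<Longrightarrow> F l r r = 0"
    and d: "\<And>l r x. consecutive T l r \<Longrightarrow> x \<in> {l<..<r} \<Longrightarrow> (F l r has_real_derivative F' l r x) (at x)"
    and c': "\<And>l r x. consecutive T l r \<Longrightarrow> x \<in> {l<..<r} \<Longrightarrow> isCont (F' l r) x"
    and B: "\<And>l r x. consecutive T l r \<Longrightarrow> x \<in> {l<..<r} \<Longrightarrow> \<bar>F' l r x\<bar> \<le> B"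
  shows "has_weak_deriv \<Omega> (glue T F) (glue T F')" "glue T F \<in> H01 \<Omega>"
proof -
  let ?I = "{(l, r). consecutive T l r}"
  have cell: "\<exists>l r. consecutive T l r \<and> x \<in> {l<..<r}" if "x \<in> \<Omega> - T" for x
    using consecutive_lo_hi[OF T(1-3) that] by auto
  have local: "\<forall>\<^sub>F y in nhds x. glue T G y = G l r y" if "consecutive T l r" "x \<in> {l<..<r}" for G l r x
    using eventually_nhds_in_open[of "{l<..<r}" x] that glue_interior[OF T(1)] by (auto elim!: eventually_mono)
  have "continuous_on (\<Union>i\<in>?I. {fst i..snd i}) (glue T F)"
  proof (rule continuous_on_closed_Union)
    show "finite ?I" by (rule finite_subset[of _ "T \<times> T"]) (use T in \<open>auto simp: consecutive_def\<close>)
    fix i assume i: "i \<in> ?I"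
    then obtain l r where lr: "i = (l, r)" "consecutive T l r" by auto
    have "glue T F x = F l r x" if "x \<in> {l..r}" for x
    proof (cases "x \<in> {l<..<r}")
      case True then show ?thesis by (rule glue_interior[OF T(1) lr(2)])
    next
      case False
      then have "x = l \<or> x = r" using that by auto
      then show ?thesis using z[OF lr(2)] lr(2) by (auto simp: glue_def consecutive_def)
    qed
    then have "continuous_on {l..r} (glue T F)" by (intro continuous_on_eq[OF c[OF lr(2)]]) simp
    then show "continuous_on {fst i..snd i} (glue T F)" using lr by simp
  qed auto
  moreover have "{0..2} \<subseteq> (\<Union>i\<in>?I. {fst i..snd i})"
  proof
    fix x :: real assume x: "x \<in> {0..2}"
    have "\<exists>l r. consecutive T l r \<and> x \<in> {l..r}"
    proof (cases "x \<in> T")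
      case False
      then have "x \<in> \<Omega> - T" using x T by (cases "x = 0"; cases "x = 2") auto
      then show ?thesis using cell[of x] by fastforce
    next
      case True
      show ?thesis
      proof (cases "x = 0")
        case True
        define r where "r = Min {t \<in> T. 0 < t}"
        have r: "r \<in> {t \<in> T. 0 < t}" unfolding r_def using T by (intro Min_in) auto
        have "r \<le> t" if "t \<in> T" "0 < t" for t unfolding r_def using T that by (intro Min_le) auto
        then have "consecutive T 0 r" using r T by (force simp: consecutive_def)
        then show ?thesis using True r by (intro exI[of _ 0] exI[of _ r]) auto
      next
        case False
        define l where "l = Max {t \<in> T. t < x}"
        have l: "l \<in> {t \<in> T. t < x}" unfolding l_def using T x False by (intro Max_in) auto
        have "t \<le> l" if "t \<in> T" "t < x" for t unfolding l_def using T that by (intro Max_ge) auto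
        then have "consecutive T l x" using l True by (force simp: consecutive_def)
        then show ?thesis using l by (intro exI[of _ l] exI[of _ x]) auto
      qed
    qed
    then show "x \<in> (\<Union>i\<in>?I. {fst i..snd i})" by force
  qed
  ultimately have cont: "continuous_on {0..2} (glue T F)" by (rule continuous_on_subset)
  have z0: "glue T F 0 = 0" "glue T F 2 = 0" using T by (auto simp: glue_def)
  have D: "(glue T F has_real_derivative glue T F' x) (at x)" "isCont (glue T F') x" "\<bar>glue T F' x\<bar> \<le> B"
    if x: "x \<in> \<Omega> - T" for x
  proof -
    obtain l r where lr: "consecutive T l r" "x \<in> {l<..<r}" using cell[OF x] by blast
    note g = glue_interior[OF T(1) lr]
    show "(glue T F has_real_derivative glue T F' x) (at x)"
      unfolding g using d[OF lr] by (subst DERIV_cong_ev[OF refl local[OF lr] refl])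
    show "isCont (glue T F') x" using c'[OF lr] by (subst isCont_cong[OF local[OF lr]])
    show "\<bar>glue T F' x\<bar> \<le> B" unfolding g by (rule B[OF lr])
  qed
  show "has_weak_deriv \<Omega> (glue T F) (glue T F')" "glue T F \<in> H01 \<Omega>"
    using piecewise_C1_H01[OF T(1-3) _ cont z0 D] by auto
qed

section \<open>Local mesh width of the Duran mesh\<close>

text \<open>
  A cell that begins at distance \<open>q\<close> from the closest of the points 0, 1 on its left, where layers start, is at most
  \<open>3 * H * max \<epsilon> q\<close> long. The factor 3 leaves room for the omission of a mesh point.
\<close>

definition layer_mesh :: "real \<Rightarrow> real \<Rightarrow> real set \<Rightarrow> bool" where
  "layer_mesh H \<epsilon> T \<longleftrightarrow> finite T \<and> {0, 1, 2} \<subseteq> T \<and> T \<subseteq> {0..2}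
     \<and> (\<forall>l r. consecutive T l r \<longrightarrow> r - l \<le> 3 * H * max \<epsilon> (l - (if l < 1 then 0 else 1)))"

lemma duran_graded_uniform: "int i \<le> \<lceil>1 / H\<rceil> \<Longrightarrow> duran_graded H \<epsilon> i = real i * H * \<epsilon>"
  by (cases i) auto

lemma duran_graded_geometric:
  assumes "H > 0"
  shows "duran_graded H \<epsilon> (nat \<lceil>1 / H\<rceil> + j) = real (nat \<lceil>1 / H\<rceil>) * H * \<epsilon> * (1 + H) ^ j"
proof (induction j)
  case 0
  have "0 < \<lceil>1 / H\<rceil>" using assms by (simp add: zero_less_ceiling)
  then have "int (nat \<lceil>1 / H\<rceil>) = \<lceil>1 / H\<rceil>" by linarith
  then show ?case by (simp only: add_0_right power_0 mult_1_right duran_graded_uniform order_refl)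
next
  case (Suc j)
  have "\<not> int (Suc (nat \<lceil>1 / H\<rceil> + j)) \<le> \<lceil>1 / H\<rceil>" by linarith
  then show ?case using Suc by (simp add: mult_ac)
qed

lemma duran_graded_nonneg: "H > 0 \<Longrightarrow> \<epsilon> > 0 \<Longrightarrow> 0 \<le> duran_graded H \<epsilon> i"
  by (induction i) auto

lemma duran_graded_pos: assumes "H > 0" "\<epsilon> > 0" shows "0 < duran_graded H \<epsilon> (Suc i)"
proof (induction i)
  case 0
  have "1 \<le> \<lceil>1 / H\<rceil>" using assms by (simp add: one_le_ceiling)
  then show ?case using assms by simp
next
  case (Suc i) then show ?case using assms by simp
qed

lemma duran_graded_step:
  assumes "H > 0" "\<epsilon> > 0"
  shows "duran_graded H \<epsilon> i < duran_graded H \<epsilon> (Suc i)"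
    "duran_graded H \<epsilon> (Suc i) \<le> duran_graded H \<epsilon> i + H * max \<epsilon> (duran_graded H \<epsilon> i)"
proof -
  let ?g = "duran_graded H \<epsilon>"
  have "?g i < ?g (Suc i) \<and> ?g (Suc i) \<le> ?g i + H * max \<epsilon> (?g i)"
  proof (cases "int (Suc i) \<le> \<lceil>1 / H\<rceil>")
    case True
    then have "?g i = real i * H * \<epsilon>" "?g (Suc i) = real (Suc i) * H * \<epsilon>"
      by (intro duran_graded_uniform; simp)+
    moreover have "H * \<epsilon> \<le> H * max \<epsilon> (?g i)" using assms by (intro mult_left_mono) auto
    ultimately show ?thesis using assms by (simp add: algebra_simps)
  next
    case False
    have "1 \<le> \<lceil>1 / H\<rceil>" using assms by (simp add: one_le_ceiling)
    then have "i \<noteq> 0" using False by (intro notI) simp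
    then have "?g i > 0" using duran_graded_pos[OF assms, of "i - 1"] by simp
    moreover have "H * ?g i \<le> H * max \<epsilon> (?g i)" using assms by (intro mult_left_mono) auto
    moreover have "?g (Suc i) = ?g i + H * ?g i" using False by (simp add: distrib_right)
    ultimately show ?thesis using assms by simp
  qed
  then show "?g i < ?g (Suc i)" "?g (Suc i) \<le> ?g i + H * max \<epsilon> (?g i)" by auto
qed

text \<open>
  The index \<open>M\<close> is the first one at which the graded sequence, continued without end, reaches 1. So
  the sequence stays below 1 before \<open>M\<close>, and the interval that ends in 1 is no longer than a graded one.
\<close>

lemma duran_M_bounds:
  assumes H: "0 < H" "H < 1" and e: "0 < \<epsilon>" "\<epsilon> < 1"
  shows "2 \<le> duran_M H \<epsilon>" "duran_graded H \<epsilon> (duran_M H \<epsilon> - 1) < 1" "1 \<le> duran_graded H \<epsilon> (duran_M H \<epsilon>)"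
proof -
  define n where "n = nat \<lceil>1 / H\<rceil>"
  have n1: "1 < \<lceil>1 / H\<rceil>" using H by (simp add: less_ceiling_iff)
  then have cn: "real_of_int \<lceil>1 / H\<rceil> = real n" "2 \<le> n" unfolding n_def by linarith+
  have "real n < 1 / H + 1" unfolding cn(1)[symmetric] by linarith
  then have nH: "real n * H < 1 + H" using H by (simp add: field_simps)
  define A where "A = H * \<epsilon> * real n"
  have A: "A > 0" using H e cn by (simp add: A_def)
  have l: "ln (1 + H) > 0" using H by simp
  define L where "L = ln A / ln (1 + H)"
  have "real n * H * \<epsilon> < (1 + H) * 1" using nH e H cn by (intro mult_strict_mono) auto
  then have "A < 1 + H" by (simp add: A_def mult_ac)
  then have "ln A < ln (1 + H)" using A H by simp
  then have L1: "L < 1" using l by (simp add: L_def)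
  have Mdef: "duran_M H \<epsilon> = nat \<lceil>real n - L\<rceil>" by (simp add: duran_M_def cn L_def A_def)
  define M where "M = duran_M H \<epsilon>"
  have "int n \<le> \<lceil>real n - L\<rceil>" using L1 by (simp add: le_ceiling_iff)
  then have M: "n \<le> M" "int M = \<lceil>real n - L\<rceil>" unfolding M_def Mdef by linarith+
  then have Mr: "real n - L \<le> real M" "real M - 1 < real n - L" by linarith+
  have lnA: "ln (A * (1 + H) ^ j) = (L + real j) * ln (1 + H)" for j
    using A H l by (simp add: ln_mult ln_realpow L_def distrib_right)
  have geo: "duran_graded H \<epsilon> (n + j) = A * (1 + H) ^ j" for j
    using duran_graded_geometric[OF H(1), of \<epsilon> j] by (simp add: n_def A_def mult_ac)
  have pos: "A * (1 + H) ^ j > 0" for j using A H by simp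
  have "1 \<le> duran_graded H \<epsilon> M"
  proof -
    have "0 \<le> (L + real (M - n)) * ln (1 + H)" using Mr M l by (intro mult_nonneg_nonneg) auto
    then have "0 \<le> ln (A * (1 + H) ^ (M - n))" by (simp only: lnA)
    then have "1 \<le> A * (1 + H) ^ (M - n)" using pos[of "M - n"] by (simp only: ln_ge_zero_iff)
    then show ?thesis using geo[of "M - n"] M by simp
  qed
  moreover have "duran_graded H \<epsilon> (M - 1) < 1"
  proof (cases "M = n")
    case True
    have "duran_graded H \<epsilon> (n - 1) = real (n - 1) * H * \<epsilon>" by (rule duran_graded_uniform) (use cn in linarith)
    also have "\<dots> = (real n * H - H) * \<epsilon>" using cn by (simp add: of_nat_diff left_diff_distrib)
    also have "\<dots> < 1 * 1"
    proof -
      have "1 * H \<le> real n * H" using H cn by (intro mult_right_mono) auto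
      then show ?thesis using nH e by (intro mult_strict_mono) auto
    qed
    finally show ?thesis using True by simp
  next
    case False
    then have j: "n + (M - 1 - n) = M - 1" using M by simp
    have "(L + real (M - 1 - n)) * ln (1 + H) < 0" using Mr M False l by (intro mult_neg_pos) auto
    then have "ln (A * (1 + H) ^ (M - 1 - n)) < 0" by (simp only: lnA)
    then have "A * (1 + H) ^ (M - 1 - n) < 1" using pos[of "M - 1 - n"] by (simp only: ln_less_zero_iff)
    then show ?thesis using geo[of "M - 1 - n"] unfolding j by simp
  qed
  ultimately show "2 \<le> duran_M H \<epsilon>" "duran_graded H \<epsilon> (duran_M H \<epsilon> - 1) < 1" "1 \<le> duran_graded H \<epsilon> (duran_M H \<epsilon>)"
    using M cn by (auto simp: M_def)
qed

text \<open>
  A single interval of the full mesh is at most \<open>H * max \<epsilon> q\<close> long. If the point after \<open>l\<close> has been omitted, two intervals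
  are merged. The second one begins at a distance of at most \<open>q + H * max \<epsilon> q \<le> 2 * max \<epsilon> q\<close>, so the union is at most
  \<open>3 * H * max \<epsilon> q\<close> long.
\<close>

lemma duran_mesh_layer_mesh:
  assumes H: "0 < H" "H < 1" and e: "0 < \<epsilon>" "\<epsilon> < 1" and T: "T \<in> duran_meshes H \<epsilon>"
  shows "layer_mesh H \<epsilon> T"
proof -
  define M where "M = duran_M H \<epsilon>"
  define y where "y = (\<lambda>j. if j < M then duran_graded H \<epsilon> j else 1)"
  note M = duran_M_bounds[OF H e, folded M_def]
  note st = duran_graded_step[OF H(1) e(1)]
  have y0: "y 0 = 0" "y M = 1" using M by (auto simp: y_def)
  have sm: "strict_mono (duran_graded H \<epsilon>)" unfolding strict_mono_Suc_iff using st(1) by blast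
  have y1: "y j < 1" if "j < M" for j
  proof -
    have "j \<le> M - 1" using that by simp
    then have "duran_graded H \<epsilon> j \<le> duran_graded H \<epsilon> (M - 1)" by (rule monoD[OF strict_mono_mono[OF sm]])
    then show ?thesis using M(2) that by (simp add: y_def)
  qed
  have ynn: "0 \<le> y j" for j using duran_graded_nonneg[OF H(1) e(1)] by (auto simp: y_def)
  have step: "y j < y (Suc j)" "y (Suc j) \<le> y j + H * max \<epsilon> (y j)" if "j < M" for j
  proof -
    have "y j < y (Suc j) \<and> y (Suc j) \<le> y j + H * max \<epsilon> (y j)"
    proof (cases "Suc j = M")
      case True
      then have "y (Suc j) = 1" by (simp add: y_def)
      moreover have "1 \<le> y j + H * max \<epsilon> (y j)" using st(2)[of j] M(3) True that by (auto simp: y_def)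
      ultimately show ?thesis using y1[OF that] by simp
    next
      case False
      then show ?thesis using st[of j] that by (auto simp: y_def)
    qed
    then show "y j < y (Suc j)" "y (Suc j) \<le> y j + H * max \<epsilon> (y j)" by auto
  qed
  define g where "g = duran_graded H \<epsilon> (M - 1)"
  have g: "g = y (M - 1)" "0 < g" "g < 1"
    using M duran_graded_pos[OF H(1) e(1), of "M - 2"] by (auto simp: g_def y_def Suc_diff_Suc numeral_2_eq_2)
  have pt1: "duran_pt H \<epsilon> i = y i" if "i \<le> M" for i using that by (auto simp: duran_pt_def M_def[symmetric] y_def)
  have pt2: "duran_pt H \<epsilon> (M + j) = 1 + y j" if "j \<le> M" for j
    using that M by (auto simp: duran_pt_def M_def[symmetric] y_def)
  have X: "duran_pt H \<epsilon> ` {0..2 * M} = y ` {..M} \<union> (\<lambda>j. 1 + y j) ` {..M}"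
  proof -
    have "{0..2 * M} = {..M} \<union> (+) M ` {..M}"
      by (auto simp: image_iff) (metis add_diff_inverse_nat atMost_iff le_add_diff_inverse mult_2 nat_add_left_cancel_le nat_le_linear)
    moreover have "duran_pt H \<epsilon> ` {..M} = y ` {..M}" by (intro image_cong) (auto simp: pt1)
    moreover have "(\<lambda>j. duran_pt H \<epsilon> (M + j)) ` {..M} = (\<lambda>j. 1 + y j) ` {..M}"
      by (intro image_cong) (auto simp: pt2)
    ultimately show ?thesis by (simp add: image_Un image_image)
  qed
  have pM: "duran_pt H \<epsilon> (M - 1) = g" using pt1[of "M - 1"] g by simp
  have p2: "duran_pt H \<epsilon> (2 * M - 1) = 1 + g"
    using pt2[of "M - 1"] g M by (simp add: numeral_2_eq_2 mult_2)
  obtain P where P: "T = (y ` {..M} \<union> (\<lambda>j. 1 + y j) ` {..M}) - P" "P \<subseteq> {g, 1 + g}"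
    using T unfolding duran_meshes_def Let_def M_def[symmetric] X pM p2 by auto
  have gy: "y j \<noteq> g" if "j \<le> M" "j \<noteq> M - 1" for j
  proof (cases "j = M")
    case False
    then show ?thesis using that strict_mono_eq[OF sm, of j "M - 1"] M by (auto simp: y_def g_def)
  qed (use g y0 in auto)
  have yle: "y j \<le> 1" if "j \<le> M" for j using y1[of j] y0 that by (cases "j = M") auto
  have inT: "a + y j \<in> T" if "j \<le> M" "j \<noteq> M - 1" "a = 0 \<or> a = 1" for j a
  proof -
    have "a + y j \<noteq> g" "a + y j \<noteq> 1 + g"
      using gy[OF that(1,2)] that(3) g ynn[of j] yle[OF that(1)] by auto
    then show ?thesis using that P by auto
  qed
  have T012: "{0, 1, 2} \<subseteq> T"
    using inT[of 0 0] inT[of M 0] inT[of M 1] y0 M by auto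
  have fin: "finite T" using P by simp
  have sub: "T \<subseteq> {0..2}" using P ynn yle by force
  have "r - l \<le> 3 * H * max \<epsilon> (l - (if l < 1 then 0 else 1))" if c: "consecutive T l r" for l r
  proof -
    have lT: "l \<in> T" and rT: "r \<in> T" and lr: "l < r" using c by (auto simp: consecutive_def)
    have r2: "r \<le> 2" using sub rT by auto
    obtain i a where ia: "l = a + y i" "i < M" "a = 0 \<or> a = 1"
    proof -
      obtain i where i: "i \<le> M" "l = y i \<or> l = 1 + y i" using lT P by auto
      show ?thesis
      proof (cases "i = M")
        case True
        then have "l = 1 + y 0" using i y0 lr r2 by auto
        then show ?thesis using that[of 1 0] M by simp
      next
        case False
        then show ?thesis using i that[of 0 i] that[of 1 i] by auto
      qed
    qed
    have off: "l - (if l < 1 then 0 else 1) = y i" using ia y1[of i] ynn[of i] by auto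
    define m where "m = max \<epsilon> (y i)"
    have m: "m > 0" "y i \<le> m" using e by (auto simp: m_def)
    have "\<exists>t\<in>T. l < t \<and> t \<le> l + 3 * H * m"
    proof (cases "Suc i = M - 1")
      case False
      have "H * m \<le> 3 * H * m" using H m by simp
      then show ?thesis using inT[of "Suc i" a] ia False step[of i] by (intro bexI[of _ "a + y (Suc i)"]) (auto simp: m_def)
    next
      case True
      then have s: "Suc i < M" "Suc (Suc i) = M" using M by auto
      have a1: "y (Suc i) \<le> y i + H * m" using step(2)[OF ia(2)] by (simp add: m_def)
      have Hm: "H * m \<le> 1 * m" using H m by (intro mult_right_mono) auto
      have "y (Suc i) \<le> 2 * m" using a1 Hm m by linarith
      moreover have "\<epsilon> \<le> m" by (simp add: m_def)
      ultimately have "max \<epsilon> (y (Suc i)) \<le> 2 * m" using m by simp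
      then have "H * max \<epsilon> (y (Suc i)) \<le> H * (2 * m)" using H by (intro mult_left_mono) auto
      then have "y (Suc (Suc i)) \<le> y i + 3 * H * m" using step(2)[OF s(1)] a1 by simp
      moreover have "y i < y (Suc (Suc i))" using step(1)[OF s(1)] step(1)[OF ia(2)] by simp
      ultimately show ?thesis using inT[of "Suc (Suc i)" a] ia s M by (intro bexI[of _ "a + y (Suc (Suc i))"]) auto
    qed
    then obtain t where t: "t \<in> T" "l < t" "t \<le> l + 3 * H * m" by blast
    have "r \<le> t" using c t by (force simp: consecutive_def)
    then show ?thesis using t by (simp add: off m_def)
  qed
  then show ?thesis using fin T012 sub by (auto simp: layer_mesh_def)
qed

section \<open>Interpolation on a cell\<close>

text \<open>
  The Taylor polynomial at \<open>l\<close> has the right order of approximation on the cell for the function and its derivative. A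
  linear correction, whose slope \<open>\<delta>\<close> is of the order of the derivative error, restores the value at \<open>r\<close>.
\<close>

lemma taylor_interpolant:
  fixes g :: "nat \<Rightarrow> real \<Rightarrow> real"
  assumes lr: "l < r" and k: "k \<ge> 1"
    and d: "\<And>i x. i \<le> k \<Longrightarrow> x \<in> {l..r} \<Longrightarrow> (g i has_real_derivative g (Suc i) x) (at x within {l..r})"
    and M: "\<And>x. x \<in> {l..r} \<Longrightarrow> \<bar>g (Suc k) x\<bar> \<le> M"
  obtains p :: "real poly" where "degree p \<le> k" "poly p l = g 0 l" "poly p r = g 0 r"
    "\<And>x. x \<in> {l..r} \<Longrightarrow> \<bar>poly p x - g 0 x\<bar> \<le> 2 * M * (r - l) ^ Suc k"
    "\<And>x. x \<in> {l..r} \<Longrightarrow> \<bar>poly (pderiv p) x - g 1 x\<bar> \<le> 2 * M * (r - l) ^ k"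
proof -
  define h where "h = r - l"
  have h: "h > 0" using lr by (simp add: h_def)
  have M0: "M \<ge> 0" using M[of l] lr by (smt (verit) abs_ge_zero atLeastAtMost_iff)
  define t where "t = (\<Sum>i\<le>k. smult (g i l / fact i) ([:-l, 1:] ^ i))"
  have pt: "poly t x = (\<Sum>i\<le>k. g i l * (x - l) ^ i / fact i)" for x
    by (simp add: t_def poly_sum poly_power)
  obtain k' where k': "k = Suc k'" using k by (cases k) auto
  have dt: "poly (pderiv t) x = (\<Sum>i\<le>k'. g (Suc i) l * (x - l) ^ i / fact i)" for x
  proof -
    have "((\<lambda>x. \<Sum>i\<le>k. g i l * (x - l) ^ i / fact i) has_real_derivative
        (\<Sum>i\<le>k. g i l * (real i * (x - l) ^ (i - 1)) / fact i)) (at x)"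
      by (rule DERIV_sum) (auto intro!: derivative_eq_intros)
    then have "poly (pderiv t) x = (\<Sum>i\<le>k. g i l * (real i * (x - l) ^ (i - 1)) / fact i)"
      using poly_DERIV[of t x] unfolding pt by (rule DERIV_unique[symmetric])
    also have "\<dots> = (\<Sum>i\<le>k'. g (Suc i) l * (real (Suc i) * (x - l) ^ i) / fact (Suc i))"
      unfolding k' by (subst sum.atMost_Suc_shift) simp
    also have "\<dots> = (\<Sum>i\<le>k'. g (Suc i) l * (x - l) ^ i / fact i)"
    proof (rule sum.cong[OF refl])
      fix i
      have "g (Suc i) l * (real (Suc i) * (x - l) ^ i) / fact (Suc i)
          = (real (Suc i) * (g (Suc i) l * (x - l) ^ i)) / (real (Suc i) * fact i)" by (simp add: mult_ac)
      then show "g (Suc i) l * (real (Suc i) * (x - l) ^ i) / fact (Suc i) = g (Suc i) l * (x - l) ^ i / fact i"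
        by (simp only: mult_divide_mult_cancel_left_if) simp
    qed
    finally show ?thesis .
  qed
  have pw: "M * \<bar>x - l\<bar> ^ j / fact i \<le> M * h ^ j" if "x \<in> {l..r}" for x i j
  proof -
    have "\<bar>x - l\<bar> ^ j \<le> h ^ j" using that by (intro power_mono) (auto simp: h_def)
    then have "M * \<bar>x - l\<bar> ^ j \<le> M * h ^ j" using M0 by (rule mult_left_mono)
    moreover have "M * \<bar>x - l\<bar> ^ j / fact i \<le> M * \<bar>x - l\<bar> ^ j / 1"
      using M0 by (intro divide_left_mono) auto
    ultimately show ?thesis by simp
  qed
  have l: "l \<in> {l..r}" and r: "r \<in> {l..r}" using lr by auto
  have e0: "\<bar>g 0 x - poly t x\<bar> \<le> M * h ^ Suc k" if x: "x \<in> {l..r}" for x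
    using field_Taylor[of "{l..r}" k g M l x] d M l x pw[OF x, of "Suc k" k] unfolding pt by simp
  have e1: "\<bar>g 1 x - poly (pderiv t) x\<bar> \<le> M * h ^ k" if x: "x \<in> {l..r}" for x
    using field_Taylor[of "{l..r}" k' "\<lambda>i. g (Suc i)" M l x] d M l x pw[OF x, of k k'] k' unfolding dt by simp
  \<comment> \<open>The slope of the linear correction, which vanishes at \<open>l\<close>.\<close>
  define \<delta> where "\<delta> = (g 0 r - poly t r) / h"
  have \<delta>: "\<bar>\<delta>\<bar> \<le> M * h ^ k"
  proof -
    have "\<bar>g 0 r - poly t r\<bar> \<le> M * h ^ k * h" using e0[OF r] by (simp add: mult_ac)
    then show ?thesis using h by (simp add: \<delta>_def abs_divide pos_divide_le_eq)
  qed
  define p where "p = t + smult \<delta> [:-l, 1:]"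
  have pp: "poly p x = poly t x + \<delta> * (x - l)" for x by (simp add: p_def algebra_simps)
  have dp: "poly (pderiv p) x = poly (pderiv t) x + \<delta>" for x
    by (simp add: p_def pderiv_add pderiv_smult pderiv_pCons)
  show ?thesis
  proof (rule that[of p])
    have "degree (smult (g i l / fact i) ([:-l, 1:] ^ i)) \<le> k" if "i \<le> k" for i
      using that degree_linear_power[of "-l" i] by (intro order_trans[OF degree_smult_le]) simp
    then have "degree t \<le> k" unfolding t_def by (intro degree_sum_le) auto
    moreover have "degree (smult \<delta> [:-l, 1:]) \<le> k" using k by (intro order_trans[OF degree_smult_le]) simp
    ultimately show "degree p \<le> k" unfolding p_def by (rule degree_add_le)
    have "poly t l = g 0 l" unfolding pt k' by (subst sum.atMost_Suc_shift) simp
    then show "poly p l = g 0 l" by (simp add: pp)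
    show "poly p r = g 0 r" using h by (simp add: pp \<delta>_def h_def[symmetric])
    fix x assume x: "x \<in> {l..r}"
    have "\<bar>\<delta> * (x - l)\<bar> \<le> (M * h ^ k) * h" unfolding abs_mult using \<delta> x h M0 by (intro mult_mono) (auto simp: h_def)
    then show "\<bar>poly p x - g 0 x\<bar> \<le> 2 * M * (r - l) ^ Suc k"
      using e0[OF x] unfolding pp h_def[symmetric] by (simp add: mult_ac abs_le_iff)
    show "\<bar>poly (pderiv p) x - g 1 x\<bar> \<le> 2 * M * (r - l) ^ k"
      using e1[OF x] \<delta> unfolding dp h_def[symmetric] by (simp add: abs_le_iff)
  qed
qed

section \<open>Layer functions against the mesh width\<close>

lemma power_le_exp: assumes "0 \<le> (y::real)" shows "y ^ j \<le> real j ^ j * exp y"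
proof (cases "j = 0")
  case False
  have "(y / real j) ^ j \<le> (1 + y / real j) ^ j" using assms by (intro power_mono) auto
  also have "\<dots> \<le> exp y" using False assms by (intro exp_ge_one_plus_x_over_n_power_n) auto
  finally show ?thesis using False by (simp add: power_divide pos_divide_le_eq mult.commute)
qed (use assms in auto)

text \<open>
  The left-hand sides are the interpolation error bounds, for the derivative and for the function, on a cell of length
  \<open>h\<close> that begins at distance \<open>q\<close> from the layer; \<open>t\<close> is the distance of a point of the cell. All three right-hand sides
  have the form \<open>C * H ^ k * (p + r * \<omega>)\<close> with the same, slower exponential \<open>\<omega>\<close>; hence the factors 1 and 0.
\<close>

definition cell_estimates :: "real \<Rightarrow> nat \<Rightarrow> real \<Rightarrow> real \<Rightarrow> real \<Rightarrow> real \<Rightarrow> real \<Rightarrow> real \<Rightarrow> bool" where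
  "cell_estimates \<beta> k C \<epsilon> H q t h \<longleftrightarrow>
      h ^ k * (1 + exp (- \<beta> * q / \<epsilon>) / \<epsilon> ^ Suc k) \<le> C * H ^ k * (1 + 1 / \<epsilon> * exp (- (\<beta> / 8) * t / \<epsilon>))
      \<and> h ^ Suc k * (1 + exp (- \<beta> * q / \<epsilon>) / \<epsilon> ^ Suc k) \<le> C * H ^ k * (max \<epsilon> q + 1 * exp (- (\<beta> / 8) * t / \<epsilon>))
      \<and> (sqrt \<epsilon> < q \<longrightarrow> h ^ k * (1 + exp (- \<beta> * q / \<epsilon>) / \<epsilon> ^ Suc k) \<le> C * H ^ k * (1 + 0 * exp (- (\<beta> / 8) * t / \<epsilon>)))"

text \<open>
  Let \<open>z = q / \<epsilon>\<close>. The length satisfies \<open>h \<le> 3 * H * \<epsilon> * (1 + z)\<close>, so \<open>h ^ j\<close> gains \<open>\<epsilon> ^ j\<close> at the price of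
  \<open>(1 + z) ^ j\<close>, which half of the exponential absorbs. The other half still decays in \<open>t\<close>, because \<open>t \<le> 4 * q + 3 * \<epsilon>\<close> on the
  cell; this gives the rate \<open>\<beta> / 8\<close>. For \<open>q > sqrt \<epsilon>\<close> the layer term is at most \<open>exp (- \<beta> / sqrt \<epsilon>)\<close>, smaller than any
  power of \<open>\<epsilon>\<close>.
\<close>

lemma layer_cell_bounds:
  fixes \<beta> :: real and k :: nat
  assumes \<beta>: "\<beta> > 0"
  obtains C where "C \<ge> 0"
    "\<And>\<epsilon> H q t h. \<lbrakk>0 < \<epsilon>; \<epsilon> < 1; 0 < H; H < 1; 0 \<le> q; q \<le> 1; t \<le> q + h; 0 \<le> h; h \<le> 3 * H * max \<epsilon> q\<rbrakk> \<Longrightarrow>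
      cell_estimates \<beta> k C \<epsilon> H q t h"
proof -
  \<comment> \<open>The constant \<open>A j\<close> absorbs \<open>(1 + z) ^ j\<close> into half of the exponential.\<close>
  define A where "A = (\<lambda>j::nat. real j ^ j * exp (\<beta> / 2) * (2 / \<beta>) ^ j)"
  have A0: "A j \<ge> 0" for j using \<beta> by (simp add: A_def)
  have A: "(1 + z) ^ j * exp (- \<beta> * z) \<le> A j * exp (- \<beta> * z / 2)" if "z \<ge> 0" for z j
  proof -
    have "(\<beta> / 2 * (1 + z)) ^ j \<le> real j ^ j * exp (\<beta> / 2 * (1 + z))" using that \<beta> by (intro power_le_exp) auto
    then have "(2 / \<beta>) ^ j * (\<beta> / 2 * (1 + z)) ^ j \<le> (2 / \<beta>) ^ j * (real j ^ j * exp (\<beta> / 2 * (1 + z)))"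
      using \<beta> by (intro mult_left_mono) auto
    also have "(2 / \<beta>) ^ j * (\<beta> / 2 * (1 + z)) ^ j = (1 + z) ^ j"
    proof -
      have "2 / \<beta> * (\<beta> / 2 * (1 + z)) = 1 + z" using \<beta> by simp
      then show ?thesis by (simp only: power_mult_distrib[symmetric])
    qed
    also have "exp (\<beta> / 2 * (1 + z)) = exp (\<beta> / 2) * exp (\<beta> * z / 2)" by (simp add: exp_add[symmetric] algebra_simps)
    finally have "(1 + z) ^ j \<le> A j * exp (\<beta> * z / 2)" by (simp add: A_def mult_ac)
    then have "(1 + z) ^ j * exp (- \<beta> * z) \<le> A j * exp (\<beta> * z / 2) * exp (- \<beta> * z)" by (intro mult_right_mono) auto
    also have "\<dots> = A j * exp (- \<beta> * z / 2)" by (simp add: mult.assoc exp_add[symmetric])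
    finally show ?thesis .
  qed
  define F where "F = (\<lambda>j. 3 ^ j * (1 + A j * exp (3 * \<beta> / 8)))"
  define G where "G = real (2 * Suc k) ^ (2 * Suc k) / \<beta> ^ (2 * Suc k)"
  define C where "C = F k + F (Suc k) + 3 ^ k * (1 + G)"
  have F0: "F j \<ge> 0" for j using A0[of j] by (simp add: F_def)
  have G0: "G \<ge> 0" using \<beta> by (simp add: G_def)
  show ?thesis
  proof (rule that[of C])
    show "C \<ge> 0" using F0 G0 by (simp add: C_def)
    fix \<epsilon> H q t h :: real
    assume e: "0 < \<epsilon>" "\<epsilon> < 1" and H: "0 < H" "H < 1" and q: "0 \<le> q" "q \<le> 1" and t: "t \<le> q + h"
      and h: "0 \<le> h" "h \<le> 3 * H * max \<epsilon> q"
    define m z w where "m = max \<epsilon> q" and "z = q / \<epsilon>" and "w = exp (- (\<beta> / 8) * t / \<epsilon>)"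
    have w0: "w \<ge> 0" by (simp add: w_def)
    have m: "0 \<le> m" "m \<le> 1" using e q by (auto simp: m_def)
    have mz: "m \<le> \<epsilon> * (1 + z)" using e q by (simp add: m_def z_def distrib_left)
    have z: "z \<ge> 0" using e q by (simp add: z_def)
    have hp: "h ^ j \<le> 3 ^ j * H ^ j * m ^ j" for j
      unfolding power_mult_distrib[symmetric] using h by (intro power_mono) (auto simp: m_def)
    have decay: "exp (- \<beta> * z / 2) \<le> exp (3 * \<beta> / 8) * w"
    proof -
      have "H * m \<le> 1 * m" using H m by (intro mult_right_mono) auto
      then have "t \<le> q + 3 * m" using t h by (simp add: m_def)
      also have "m \<le> \<epsilon> + q" using e q by (simp add: m_def)
      finally have "t \<le> 4 * q + 3 * \<epsilon>" by simp
      then have "t / \<epsilon> \<le> 4 * z + 3" using e by (simp add: z_def field_simps)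
      then have "\<beta> / 8 * (t / \<epsilon>) \<le> \<beta> / 8 * (4 * z + 3)" using \<beta> by (intro mult_left_mono) auto
      then show ?thesis unfolding w_def exp_add[symmetric] by (simp add: algebra_simps)
    qed
    have key: "h ^ j * (exp (- \<beta> * q / \<epsilon>) / \<epsilon> ^ Suc k) \<le> 3 ^ j * H ^ j * (A j * exp (3 * \<beta> / 8) * w) * (\<epsilon> ^ j / \<epsilon> ^ Suc k)" for j
    proof -
      have "h ^ j * exp (- \<beta> * z) \<le> (3 ^ j * H ^ j * (\<epsilon> * (1 + z)) ^ j) * exp (- \<beta> * z)"
      proof (intro mult_right_mono order_trans[OF hp])
        show "3 ^ j * H ^ j * m ^ j \<le> 3 ^ j * H ^ j * (\<epsilon> * (1 + z)) ^ j"
          using m mz H by (intro mult_left_mono power_mono) auto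
      qed simp
      also have "\<dots> = 3 ^ j * H ^ j * \<epsilon> ^ j * ((1 + z) ^ j * exp (- \<beta> * z))" by (simp add: power_mult_distrib)
      also have "\<dots> \<le> 3 ^ j * H ^ j * \<epsilon> ^ j * (A j * (exp (3 * \<beta> / 8) * w))"
        using H e by (intro mult_left_mono order_trans[OF A[OF z]] decay A0) auto
      finally have "h ^ j * exp (- \<beta> * z) / \<epsilon> ^ Suc k \<le> 3 ^ j * H ^ j * \<epsilon> ^ j * (A j * (exp (3 * \<beta> / 8) * w)) / \<epsilon> ^ Suc k"
        using e by (intro divide_right_mono) auto
      then show ?thesis by (simp add: z_def mult_ac)
    qed
    have FC: "F k \<le> C" "F (Suc k) \<le> C" "3 ^ k * (1 + G) \<le> C" using F0[of k] F0[of "Suc k"] G0 by (auto simp: C_def)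
    have Hk: "0 \<le> H ^ k" "H ^ Suc k \<le> H ^ k" using H by (auto intro: power_decreasing)
    have 1: "h ^ k * (1 + exp (- \<beta> * q / \<epsilon>) / \<epsilon> ^ Suc k) \<le> C * H ^ k * (1 + 1 / \<epsilon> * w)"
    proof -
      have "m ^ k \<le> 1" using m by (intro power_le_one)
      then have "3 ^ k * H ^ k * m ^ k \<le> 3 ^ k * H ^ k * 1" using Hk by (intro mult_left_mono) auto
      then have a: "h ^ k \<le> 3 ^ k * H ^ k" using hp[of k] by linarith
      have b: "h ^ k * (exp (- \<beta> * q / \<epsilon>) / \<epsilon> ^ Suc k) \<le> 3 ^ k * H ^ k * (A k * exp (3 * \<beta> / 8)) * (w / \<epsilon>)"
        using key[of k] e by (simp add: field_simps)
      have "h ^ k * (1 + exp (- \<beta> * q / \<epsilon>) / \<epsilon> ^ Suc k) \<le> 3 ^ k * H ^ k + 3 ^ k * H ^ k * (A k * exp (3 * \<beta> / 8)) * (w / \<epsilon>)"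
        unfolding distrib_left using a b by simp
      also have "\<dots> \<le> F k * H ^ k * 1 + F k * H ^ k * (w / \<epsilon>)"
        unfolding F_def using A0[of k] Hk w0 e by (intro add_mono mult_right_mono) (auto simp: algebra_simps)
      also have "\<dots> \<le> C * H ^ k * 1 + C * H ^ k * (w / \<epsilon>)"
        using FC Hk w0 e by (intro add_mono mult_right_mono) auto
      finally show ?thesis by (simp add: distrib_left)
    qed
    have 2: "h ^ Suc k * (1 + exp (- \<beta> * q / \<epsilon>) / \<epsilon> ^ Suc k) \<le> C * H ^ k * (m + 1 * w)"
    proof -
      have "m ^ Suc k \<le> m ^ 1" using m by (intro power_decreasing) auto
      then have "3 ^ Suc k * H ^ Suc k * m ^ Suc k \<le> 3 ^ Suc k * H ^ k * m"
        using Hk H m by (intro mult_mono) auto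
      then have a: "h ^ Suc k \<le> 3 ^ Suc k * H ^ k * m" using hp[of "Suc k"] by linarith
      have "h ^ Suc k * (exp (- \<beta> * q / \<epsilon>) / \<epsilon> ^ Suc k) \<le> 3 ^ Suc k * H ^ Suc k * (A (Suc k) * exp (3 * \<beta> / 8) * w)"
        using key[of "Suc k"] e by simp
      also have "\<dots> \<le> 3 ^ Suc k * H ^ k * (A (Suc k) * exp (3 * \<beta> / 8) * w)"
        using Hk A0 w0 by (intro mult_right_mono mult_left_mono mult_nonneg_nonneg) auto
      finally have "h ^ Suc k * (1 + exp (- \<beta> * q / \<epsilon>) / \<epsilon> ^ Suc k)
          \<le> 3 ^ Suc k * H ^ k * m + 3 ^ Suc k * H ^ k * (A (Suc k) * exp (3 * \<beta> / 8)) * w"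
        unfolding distrib_left using a by (simp add: mult.assoc)
      also have "\<dots> \<le> F (Suc k) * H ^ k * m + F (Suc k) * H ^ k * w"
        unfolding F_def using A0[of "Suc k"] Hk w0 m by (intro add_mono mult_right_mono) (auto simp: algebra_simps)
      also have "\<dots> \<le> C * H ^ k * m + C * H ^ k * w"
        using FC Hk w0 m by (intro add_mono mult_right_mono) auto
      finally show ?thesis by (simp add: distrib_left)
    qed
    have 3: "h ^ k * (1 + exp (- \<beta> * q / \<epsilon>) / \<epsilon> ^ Suc k) \<le> C * H ^ k * (1 + 0 * w)" if far: "sqrt \<epsilon> < q"
    proof -
      define y where "y = \<beta> / sqrt \<epsilon>"
      have se: "sqrt \<epsilon> > 0" "sqrt \<epsilon> * sqrt \<epsilon> = \<epsilon>" using e by auto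
      have y: "y > 0" using \<beta> se by (simp add: y_def)
      have "\<beta> * sqrt \<epsilon> / \<epsilon> = y" using se e by (simp add: y_def field_simps)
      then have "y \<le> \<beta> * q / \<epsilon>" using far \<beta> e by (metis divide_right_mono less_imp_le mult_left_mono)
      then have "exp (- \<beta> * q / \<epsilon>) \<le> exp (- y)" by simp
      also have "\<dots> \<le> real (2 * Suc k) ^ (2 * Suc k) / y ^ (2 * Suc k)"
        using power_le_exp[of y "2 * Suc k"] y by (simp only: exp_minus pos_le_divide_eq zero_less_power) (simp add: field_simps)
      also have "y ^ (2 * Suc k) = \<beta> ^ (2 * Suc k) / \<epsilon> ^ Suc k"
      proof -
        have "y * y = \<beta> * \<beta> / \<epsilon>" by (simp only: y_def times_divide_times_eq se(2))
        then show ?thesis by (simp only: power_mult power2_eq_square power_divide)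
      qed
      also have "real (2 * Suc k) ^ (2 * Suc k) / (\<beta> ^ (2 * Suc k) / \<epsilon> ^ Suc k) = G * \<epsilon> ^ Suc k" by (simp only: G_def divide_divide_eq_right times_divide_eq_left)
      finally have "exp (- \<beta> * q / \<epsilon>) / \<epsilon> ^ Suc k \<le> G" using e by (subst pos_divide_le_eq) auto
      moreover have "h ^ k \<le> 3 ^ k * H ^ k"
      proof -
        have "m ^ k \<le> 1" using m by (intro power_le_one)
        then have "3 ^ k * H ^ k * m ^ k \<le> 3 ^ k * H ^ k * 1" using Hk by (intro mult_left_mono) auto
        then show ?thesis using hp[of k] by linarith
      qed
      ultimately have "h ^ k * (1 + exp (- \<beta> * q / \<epsilon>) / \<epsilon> ^ Suc k) \<le> (3 ^ k * H ^ k) * (1 + G)"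
        using Hk e by (intro mult_mono) auto
      also have "\<dots> = (3 ^ k * (1 + G)) * H ^ k" by simp
      also have "\<dots> \<le> C * H ^ k" using FC Hk by (intro mult_right_mono)
      finally show ?thesis by simp
    qed
    show "cell_estimates \<beta> k C \<epsilon> H q t h"
      using 1 2 3 unfolding w_def m_def cell_estimates_def by blast
  qed
qed

text \<open>
  The square of a layer function of width \<open>\<epsilon> / \<kappa>\<close> has integral at most \<open>\<epsilon> / (2 * \<kappa>)\<close> on each of \<open>(0,1)\<close> and \<open>(1,2)\<close>.
\<close>

lemma exp_layer_L2:
  assumes k: "\<kappa> > 0" and e: "\<epsilon> > 0"
  defines "\<omega> \<equiv> \<lambda>x. exp (- \<kappa> * (x - (if x < 1 then 0 else 1)) / \<epsilon>)"
  shows "\<omega> \<in> L2 \<Omega>" "ip \<Omega> \<omega> \<omega> \<le> \<epsilon> / \<kappa>"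
proof -
  have w: "isCont \<omega> x \<and> \<bar>\<omega> x\<bar> \<le> 1" if x: "x \<in> \<Omega> - {1}" for x
  proof -
    obtain a S where a: "open S" "x \<in> S" "\<And>y. y \<in> S \<Longrightarrow> \<omega> y = exp (- \<kappa> * (y - a) / \<epsilon>)" "x - a \<ge> 0"
    proof (cases "x < 1")
      case True then show ?thesis using that[of "{..<1}" 0] x by (auto simp: \<omega>_def)
    next
      case False then show ?thesis using that[of "{1<..}" 1] x by (auto simp: \<omega>_def)
    qed
    have "\<forall>\<^sub>F y in nhds x. \<omega> y = exp (- \<kappa> * (y - a) / \<epsilon>)"
      using eventually_nhds_in_open[OF a(1,2)] a(3) by (auto elim: eventually_mono)
    then have "isCont \<omega> x \<longleftrightarrow> isCont (\<lambda>y. exp (- \<kappa> * (y - a) / \<epsilon>)) x" by (rule isCont_cong)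
    moreover have "isCont (\<lambda>y. exp (- \<kappa> * (y - a) / \<epsilon>)) x" using e by (intro continuous_intros) auto
    ultimately show ?thesis using a k e by (auto simp: zero_le_divide_iff)
  qed
  show wL: "\<omega> \<in> L2 \<Omega>" by (rule piecewise_continuous_L2[of "{1}" _ _ _ 1]) (use w in auto)
  have half: "(LINT x|lebesgue_on {a<..<a+1}. exp (- \<kappa> * (x - a) / \<epsilon>) * exp (- \<kappa> * (x - a) / \<epsilon>)) \<le> \<epsilon> / (2 * \<kappa>)" for a
  proof -
    define E where "E = (\<lambda>x. exp (- \<kappa> * (x - a) / \<epsilon>) * exp (- \<kappa> * (x - a) / \<epsilon>))"
    have Ec: "continuous_on {a..a+1} E" unfolding E_def using e by (intro continuous_intros) auto
    have "(LINT x|lebesgue_on {a<..<a+1}. E x) = - (\<epsilon> / (2 * \<kappa>)) * E (a+1) - - (\<epsilon> / (2 * \<kappa>)) * E a"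
    proof (rule LINT_FTC[of "{}"])
      show "integrable (lebesgue_on {a<..<a+1}) E" by (rule L2_integrable[OF _ _ continuous_Icc_L2[OF Ec]]) auto
      show "continuous_on {a..a+1} (\<lambda>x. - (\<epsilon> / (2 * \<kappa>)) * E x)" by (intro continuous_intros Ec)
      show "((\<lambda>x. - (\<epsilon> / (2 * \<kappa>)) * E x) has_real_derivative E x) (at x)" for x
        unfolding E_def using k e by (auto intro!: derivative_eq_intros simp: field_simps)
    qed auto
    also have "\<dots> \<le> \<epsilon> / (2 * \<kappa>)" using k e by (simp add: E_def)
    finally show ?thesis by (simp add: E_def)
  qed
  have "ip {0<..<1} \<omega> \<omega> = (LINT x|lebesgue_on {0<..<0+1}. exp (- \<kappa> * (x - 0) / \<epsilon>) * exp (- \<kappa> * (x - 0) / \<epsilon>))"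
    unfolding ip_def by (intro Bochner_Integration.integral_cong) (auto simp: \<omega>_def)
  moreover have "ip {1<..<2} \<omega> \<omega> = (LINT x|lebesgue_on {1<..<1+1}. exp (- \<kappa> * (x - 1) / \<epsilon>) * exp (- \<kappa> * (x - 1) / \<epsilon>))"
    unfolding ip_def by (intro Bochner_Integration.integral_cong) (auto simp: \<omega>_def)
  moreover have "ip \<Omega> \<omega> \<omega> = ip {0<..<1} \<omega> \<omega> + ip {1<..<2} \<omega> \<omega>"
    unfolding ip_def by (rule ip_split[OF L2_mult_integrable[OF wL wL]])
  ultimately show "ip \<Omega> \<omega> \<omega> \<le> \<epsilon> / \<kappa>" using half[of 0] half[of 1] by simp
qed

lemma ip_le_exp_layer:
  assumes k: "\<kappa> > 0" and e: "\<epsilon> > 0" and v: "v \<in> L2 \<Omega>" and pq: "A \<ge> 0" "p \<ge> 0" "q \<ge> 0"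
    and le: "AE x in lebesgue_on \<Omega>. \<bar>v x\<bar> \<le> A * (p + q * exp (- \<kappa> * (x - (if x < 1 then 0 else 1)) / \<epsilon>))"
  shows "ip \<Omega> v v \<le> A\<^sup>2 * (4 * p\<^sup>2 + 2 * q\<^sup>2 * (\<epsilon> / \<kappa>))"
proof -
  define \<omega> where "\<omega> = (\<lambda>x. exp (- \<kappa> * (x - (if x < 1 then 0 else 1)) / \<epsilon>))"
  note w = exp_layer_L2[OF k e, folded \<omega>_def]
  have i: "integrable (lebesgue_on \<Omega>) (\<lambda>x. \<omega> x * \<omega> x)" by (rule L2_mult_integrable[OF w(1) w(1)])
  have "ip \<Omega> v v \<le> (LINT x|lebesgue_on \<Omega>. A\<^sup>2 * (2 * p\<^sup>2) + A\<^sup>2 * (2 * q\<^sup>2) * (\<omega> x * \<omega> x))"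
  proof (rule ip_mono_bound[OF v])
    show "AE x in lebesgue_on \<Omega>. (v x)\<^sup>2 \<le> A\<^sup>2 * (2 * p\<^sup>2) + A\<^sup>2 * (2 * q\<^sup>2) * (\<omega> x * \<omega> x)"
      using le
    proof eventually_elim
      case (elim x)
      then have "\<bar>v x\<bar>\<^sup>2 \<le> (A * (p + q * \<omega> x))\<^sup>2" by (intro power_mono) (auto simp: \<omega>_def)
      also have "\<dots> = A\<^sup>2 * (p + q * \<omega> x)\<^sup>2" by (simp add: power_mult_distrib)
      also have "\<dots> \<le> A\<^sup>2 * (2 * p\<^sup>2 + 2 * q\<^sup>2 * (\<omega> x * \<omega> x))"
      proof (rule mult_left_mono)
        show "(p + q * \<omega> x)\<^sup>2 \<le> 2 * p\<^sup>2 + 2 * q\<^sup>2 * (\<omega> x * \<omega> x)"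
        proof -
          have "0 \<le> (p - q * \<omega> x)\<^sup>2" by simp
          then show ?thesis by (simp add: power2_eq_square algebra_simps)
        qed
      qed simp
      finally show ?case by (simp add: algebra_simps)
    qed
  qed (intro Bochner_Integration.integrable_add integrable_mult_right i integrable_const_interval)
  also have "\<dots> = (LINT x|lebesgue_on \<Omega>. A\<^sup>2 * (2 * p\<^sup>2)) + A\<^sup>2 * (2 * q\<^sup>2) * ip \<Omega> \<omega> \<omega>"
    unfolding ip_def by (simp only: Bochner_Integration.integral_add[OF integrable_const_interval integrable_mult_right[OF i]] integral_mult_right_zero)
  also have "(LINT x|lebesgue_on \<Omega>. A\<^sup>2 * (2 * p\<^sup>2)) = A\<^sup>2 * (4 * p\<^sup>2)"
    by (simp only: LINT_eq_integral(1)[OF integrable_const_interval]) simp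
  also have "A\<^sup>2 * (2 * q\<^sup>2) * ip \<Omega> \<omega> \<omega> \<le> A\<^sup>2 * (2 * q\<^sup>2) * (\<epsilon> / \<kappa>)"
    by (rule mult_left_mono[OF w(2)]) simp
  finally show ?thesis by (simp add: algebra_simps)
qed

section \<open>Interpolation error and Galerkin error\<close>

lemma layer_antimono: "\<beta> > 0 \<Longrightarrow> \<epsilon> > 0 \<Longrightarrow> x \<le> y \<Longrightarrow> layer \<beta> \<epsilon> a s y \<le> layer \<beta> \<epsilon> a s x"
  unfolding layer_def by (intro add_left_mono divide_right_mono) (auto simp: divide_right_mono)

lemma ip_mult_le:
  assumes h: "continuous_on {l..r} h" "\<And>x. x \<in> {l..r} \<Longrightarrow> \<bar>h x\<bar> \<le> B" and v: "v \<in> L2 {l<..<r}"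
  shows "ip {l<..<r} (\<lambda>x. h x * v x) (\<lambda>x. h x * v x) \<le> B\<^sup>2 * ip {l<..<r} v v"
proof -
  have "ip {l<..<r} (\<lambda>x. h x * v x) (\<lambda>x. h x * v x) \<le> (LINT x|lebesgue_on {l<..<r}. B\<^sup>2 * (v x * v x))"
  proof (rule ip_mono_bound[OF L2_mult_cont[OF h(1) v]])
    show "AE x in lebesgue_on {l<..<r}. (h x * v x)\<^sup>2 \<le> B\<^sup>2 * (v x * v x)"
    proof (rule AE_I2)
      fix x assume "x \<in> space (lebesgue_on {l<..<r})"
      then have "\<bar>h x\<bar>\<^sup>2 \<le> B\<^sup>2" using h(2)[of x] by (intro power_mono) auto
      then have "(h x)\<^sup>2 * (v x)\<^sup>2 \<le> B\<^sup>2 * (v x)\<^sup>2" by (intro mult_right_mono) auto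
      then show "(h x * v x)\<^sup>2 \<le> B\<^sup>2 * (v x * v x)" by (simp add: power_mult_distrib power2_eq_square mult_ac)
    qed
  qed (intro integrable_mult_right L2_mult_integrable v)
  then show ?thesis by (simp add: ip_def)
qed

lemma energy_norm_eq:
  assumes "has_weak_deriv \<Omega> v g"
  shows "energy_norm \<epsilon> \<gamma> v = sqrt (\<epsilon> * ip \<Omega> g g + \<gamma> * ip \<Omega> v v)"
proof -
  have "g \<in> L2 \<Omega>" "wderiv \<Omega> v \<in> L2 \<Omega>"
    using assms wderiv[OF H1I[OF assms]] by (auto simp: has_weak_deriv_def)
  then have "ip \<Omega> (wderiv \<Omega> v) (wderiv \<Omega> v) = ip \<Omega> g g"
    using ip_wderiv_eq[OF assms] by (metis ip_commute)
  then show ?thesis by (simp add: energy_norm_def L2_norm_sq)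
qed

lemma fe_space_diff:
  assumes u: "u \<in> fe_space k T" and v: "v \<in> fe_space k T"
  shows "(\<lambda>x. u x - v x) \<in> fe_space k T"
proof -
  have "(\<lambda>x. u x - v x) \<in> H01 \<Omega>" using u v by (intro H01_diff) (auto simp: fe_space_def)
  moreover have "\<exists>p :: real poly. degree p \<le> k \<and> (AE x in lebesgue_on \<tau>. u x - v x = poly p x)" if t: "\<tau> \<in> cells T" for \<tau>
  proof -
    obtain p q :: "real poly" where p: "degree p \<le> k" "AE x in lebesgue_on \<tau>. u x = poly p x"
      and q: "degree q \<le> k" "AE x in lebesgue_on \<tau>. v x = poly q x"
      using u v t by (fastforce simp: fe_space_def)
    have "AE x in lebesgue_on \<tau>. u x - v x = poly (p - q) x" using p(2) q(2) by eventually_elim simp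
    moreover have "degree (p - q) \<le> k" using p q by (intro degree_diff_le)
    ultimately show ?thesis by blast
  qed
  ultimately show ?thesis by (simp add: fe_space_def)
qed

context convection_diffusion
begin

definition layer_derivatives :: "nat \<Rightarrow> real \<Rightarrow> real \<Rightarrow> real \<Rightarrow> (real \<Rightarrow> real) \<Rightarrow> (real \<Rightarrow> real) \<Rightarrow> bool" where
  "layer_derivatives n C \<epsilon> a U Y \<longleftrightarrow> (\<exists>g. g 0 = U \<and> g (Suc 0) = Y
     \<and> (\<forall>i\<le>n. \<forall>x\<in>{a..a+1}. (g i has_real_derivative g (Suc i) x) (at x within {a..a+1}))
     \<and> (\<forall>x\<in>{a..a+1}. \<bar>g (Suc n) x\<bar> \<le> C * layer \<beta> \<epsilon> a (Suc n) x))"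

text \<open>
  On \<open>[0,1]\<close> the delayed term is the smooth history \<open>\<Phi>\<close>. On \<open>[1,2]\<close> it is \<open>u(x - 1)\<close>, whose derivatives satisfy layer bounds
  at 1 by the first step, so that the same transport argument applies.
\<close>

lemma solution_derivative_bounds:
  assumes Cm: "Cm_on n {0..2} b" "Cm_on n {0..2} c" "Cm_on n {0..2} d" "Cm_on n {0..2} f" "Cm_on n {-1..0} \<Phi>"
  obtains C where "C \<ge> 0"
    "\<And>\<epsilon> U Y a. \<lbrakk>0 < \<epsilon>; \<epsilon> < 1; classical_solution \<epsilon> U Y; a = 0 \<or> a = 1\<rbrakk> \<Longrightarrow> layer_derivatives n C \<epsilon> a U Y"
proof -
  \<comment> \<open>The index set consists of all solutions for all parameters, so that one constant serves them all.\<close>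
  define S where "S = {(\<epsilon>, U, Y). 0 < \<epsilon> \<and> \<epsilon> < 1 \<and> classical_solution \<epsilon> U Y}"
  define eps U Y where "eps = (fst :: real \<times> (real \<Rightarrow> real) \<times> (real \<Rightarrow> real) \<Rightarrow> real)"
    and "U = (\<lambda>p :: real \<times> (real \<Rightarrow> real) \<times> (real \<Rightarrow> real). fst (snd p))"
    and "Y = (\<lambda>p :: real \<times> (real \<Rightarrow> real) \<times> (real \<Rightarrow> real). snd (snd p))"
  have S: "0 < eps p" "eps p < 1" "classical_solution (eps p) (U p) (Y p)" if "p \<in> S" for p
    using that by (auto simp: S_def eps_def U_def Y_def)
  interpret small_parameter S eps \<beta> by unfold_locales (fact S(1) S(2) \<beta>(1))+
  obtain K where K: "K \<ge> 0" "\<And>\<epsilon> U Y x. \<lbrakk>0 < \<epsilon>; \<epsilon> < 1; classical_solution \<epsilon> U Y; x \<in> {0..2}\<rbrakk> \<Longrightarrow> \<bar>U x\<bar> \<le> K \<and> \<bar>Y x\<bar> \<le> K / \<epsilon>"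
    using solution_bounds by blast
  have bd: "\<bar>U p x\<bar> \<le> K" "\<bar>Y p x\<bar> \<le> K / eps p" if "p \<in> S" "x \<in> {0..2}" for p x
    using S[OF that(1)] K(2) that(2) by blast+
  define Y' where "Y' = (\<lambda>p x. (c x * U p x + d x * shifted \<Phi> (U p) x - f x - b x * Y p x) / eps p)"
  have der: "(U p has_real_derivative Y p x) (at x within {a..a+1})" "(Y p has_real_derivative Y' p x) (at x within {a..a+1})"
    if "p \<in> S" "a = 0 \<or> a = 1" "x \<in> {a..a+1}" for p a x
  proof -
    have I: "x \<in> {0..2}" "{a..a+1} \<subseteq> {0..2}" using that(2,3) by auto
    have "(U p has_real_derivative Y p x) (at x within {0..2})" "(Y p has_real_derivative Y' p x) (at x within {0..2})"
      using S(3)[OF that(1)] I(1) unfolding classical_solution_def Y'_def by blast+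
    then show "(U p has_real_derivative Y p x) (at x within {a..a+1})" "(Y p has_real_derivative Y' p x) (at x within {a..a+1})"
      by (auto intro: DERIV_subset[OF _ I(2)])
  qed
  have sub: "{a..a+1} \<subseteq> {0..2::real}" if "a = 0 \<or> a = 1" for a using that by auto
  have eq: "eps p * Y' p x + b x * Y p x = c x * U p x + (d x * shifted \<Phi> (U p) x + (-1) * f x)" if "p \<in> S" for p x
    using S(1)[OF that] by (simp add: Y'_def)
  have cm: "Cm_on n {a..a+1} b" "Cm_on n {a..a+1} c" "Cm_on n {a..a+1} d" "Cm_on n {a..a+1} f" if "a = 0 \<or> a = 1" for a
    using Cm(1-4) sub[OF that] by (auto intro: Cm_on_mono)
  have minus: "Cm_on n I (\<lambda>x. - 1 :: real)" for I
    by (auto simp: Cm_on_def intro!: exI[of _ "\<lambda>i x. if i = 0 then -1 else 0"])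
  have step: "layered a n (Suc 0) Y" if a: "a = 0 \<or> a = 1" and g: "layered a n 0 (\<lambda>p. shifted \<Phi> (U p))" for a
  proof (rule layered_convection_diffusion[OF _ cm(1)[OF a] cm(2)[OF a] _ der(1)[OF _ a] der(2)[OF _ a] eq])
    show "layered a n 0 (\<lambda>p x. d x * shifted \<Phi> (U p) x + (-1) * f x)"
      by (intro layered_add layered_mult[OF cm(3)[OF a] g] layered_mult[OF minus] layered_smooth cm(4)[OF a])
    show "\<beta> \<le> b x" if "x \<in> {a..a+1}" for x using \<beta>(2)[of x] that sub[OF a] by auto
    show "\<bar>U p x\<bar> \<le> K" if "p \<in> S" "x \<in> {a..a+1}" for p x using bd(1)[OF that(1)] that(2) sub[OF a] by auto
    show "\<bar>Y p a\<bar> \<le> K / eps p" if "p \<in> S" for p using bd(2)[OF that(1), of a] a by auto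
  qed
  have "layered 0 n 0 (\<lambda>p x. \<Phi> (x - 1))"
    using layered_smooth[of n 0 "\<lambda>x. \<Phi> (x - 1)" 0] Cm_on_shift[OF Cm(5)] by simp
  then have "layered 0 n 0 (\<lambda>p. shifted \<Phi> (U p))"
    by (rule layered_cong) (use S(3) \<Phi>0 in \<open>auto simp: classical_solution_def\<close>)
  then have Y0: "layered 0 n (Suc 0) Y" by (intro step) auto
  have "layered 0 (Suc n) 0 U"
  proof (rule layered_SucI[OF _ Y0])
    show "layer_bounded 0 0 U" unfolding layer_bounded_def
    proof (intro exI[of _ K] conjI ballI K(1))
      fix p x assume p: "p \<in> S" and x: "x \<in> {0..0+1::real}"
      have "K * 1 \<le> K * layer \<beta> (eps p) 0 0 x" using K(1) layer_ge_1[OF S(1)[OF p]] by (intro mult_left_mono) auto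
      then show "\<bar>U p x\<bar> \<le> K * layer \<beta> (eps p) 0 0 x" using bd(1)[OF p, of x] x by simp
    qed
  qed (use der(1)[of _ 0] in simp)
  then have "layered 0 n 0 U" by (rule layered_Suc_D)
  then have "layered 1 n 0 (\<lambda>p x. U p (x - 1))" using layered_shift[of 0 n 0 U] by simp
  then have "layered 1 n 0 (\<lambda>p. shifted \<Phi> (U p))" by (rule layered_cong) auto
  then have Y1: "layered 1 n (Suc 0) Y" by (intro step) auto
  obtain C0 where C0: "C0 \<ge> 0" "\<forall>p\<in>S. \<exists>g. g 0 = Y p
     \<and> (\<forall>i<n. \<forall>x\<in>{0..0+1}. (g i has_real_derivative g (Suc i) x) (at x within {0..0+1}))
     \<and> (\<forall>x\<in>{0..0+1}. \<bar>g n x\<bar> \<le> C0 * layer \<beta> (eps p) 0 (Suc 0 + n) x)" using layered_derivatives[OF Y0] by blast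
  obtain C1 where C1: "C1 \<ge> 0" "\<forall>p\<in>S. \<exists>g. g 0 = Y p
     \<and> (\<forall>i<n. \<forall>x\<in>{1..1+1}. (g i has_real_derivative g (Suc i) x) (at x within {1..1+1}))
     \<and> (\<forall>x\<in>{1..1+1}. \<bar>g n x\<bar> \<le> C1 * layer \<beta> (eps p) 1 (Suc 0 + n) x)" using layered_derivatives[OF Y1] by blast
  show ?thesis
  proof (rule that[of "C0 + C1"])
    show "C0 + C1 \<ge> 0" using C0 C1 by simp
    fix \<epsilon> U0 Y0 a assume h: "0 < \<epsilon>" "\<epsilon> < 1" "classical_solution \<epsilon> U0 Y0" and a: "a = 0 \<or> a = (1::real)"
    define p where "p = (\<epsilon>, U0, Y0)"
    have p: "p \<in> S" "eps p = \<epsilon>" "U p = U0" "Y p = Y0" using h by (auto simp: p_def S_def eps_def U_def Y_def)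
    have "\<exists>C g. C \<le> C0 + C1 \<and> g 0 = Y p
     \<and> (\<forall>i<n. \<forall>x\<in>{a..a+1}. (g i has_real_derivative g (Suc i) x) (at x within {a..a+1}))
     \<and> (\<forall>x\<in>{a..a+1}. \<bar>g n x\<bar> \<le> C * layer \<beta> (eps p) a (Suc 0 + n) x)"
    proof (cases "a = 0")
      case True
      obtain g where "g 0 = Y p" "\<forall>i<n. \<forall>x\<in>{0..0+1}. (g i has_real_derivative g (Suc i) x) (at x within {0..0+1})"
        "\<forall>x\<in>{0..0+1}. \<bar>g n x\<bar> \<le> C0 * layer \<beta> (eps p) 0 (Suc 0 + n) x" using C0(2) p(1) by blast
      then show ?thesis unfolding True using C1(1) by (intro exI[of _ C0] exI[of _ g]) auto
    next
      case False
      then have a1: "a = 1" using a by simp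
      obtain g where "g 0 = Y p" "\<forall>i<n. \<forall>x\<in>{1..1+1}. (g i has_real_derivative g (Suc i) x) (at x within {1..1+1})"
        "\<forall>x\<in>{1..1+1}. \<bar>g n x\<bar> \<le> C1 * layer \<beta> (eps p) 1 (Suc 0 + n) x" using C1(2) p(1) by blast
      then show ?thesis unfolding a1 using C0(1) by (intro exI[of _ C1] exI[of _ g]) auto
    qed
    then obtain C g where g: "C \<le> C0 + C1" "g 0 = Y p"
      "\<forall>i<n. \<forall>x\<in>{a..a+1}. (g i has_real_derivative g (Suc i) x) (at x within {a..a+1})"
      "\<forall>x\<in>{a..a+1}. \<bar>g n x\<bar> \<le> C * layer \<beta> (eps p) a (Suc 0 + n) x" by blast
    define G where "G = case_nat U0 g"
    have "(G i has_real_derivative G (Suc i) x) (at x within {a..a+1})" if "i \<le> n" "x \<in> {a..a+1}" for i x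
      using that g der(1)[OF p(1) a] p by (cases i) (auto simp: G_def)
    moreover have "\<bar>G (Suc n) x\<bar> \<le> (C0 + C1) * layer \<beta> \<epsilon> a (Suc n) x" if "x \<in> {a..a+1}" for x
    proof -
      have "C * layer \<beta> \<epsilon> a (Suc n) x \<le> (C0 + C1) * layer \<beta> \<epsilon> a (Suc n) x"
        using g(1) layer_ge_1[OF h(1), of \<beta> a "Suc n" x] by (intro mult_right_mono) auto
      then show ?thesis using g(4) that p by (force simp: G_def)
    qed
    ultimately show "layer_derivatives n (C0 + C1) \<epsilon> a U0 Y0"
      unfolding layer_derivatives_def using g(2) p by (intro exI[of _ G]) (auto simp: G_def)
  qed
qed

end

context convection_diffusion
begin

text \<open>
  The function \<open>\<nu>\<close> is the part of the interpolation error \<open>\<eta>\<close> in the layers: it is small in \<open>L\<^sup>2\<close> by the additional factor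
  \<open>sqrt \<epsilon>\<close>, whereas the remainder \<open>\<eta> - \<nu>\<close> has a derivative that is small without any power of \<open>\<epsilon>\<close>.
\<close>

definition near_far_split :: "real \<Rightarrow> real \<Rightarrow> (real \<Rightarrow> real) \<Rightarrow> bool" where
  "near_far_split \<epsilon> N \<eta> \<longleftrightarrow> (\<exists>\<eta>' \<nu> \<nu>'. \<eta> \<in> H01 \<Omega> \<and> has_weak_deriv \<Omega> \<eta> \<eta>' \<and> \<nu> \<in> H01 \<Omega> \<and> has_weak_deriv \<Omega> \<nu> \<nu>'
     \<and> (\<forall>x\<in>\<Omega>. \<bar>\<eta> x\<bar> \<le> N) \<and> \<epsilon> * ip \<Omega> \<eta>' \<eta>' \<le> N\<^sup>2 \<and> ip \<Omega> \<nu> \<nu> \<le> \<epsilon> * N\<^sup>2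
     \<and> ip \<Omega> (\<lambda>x. \<eta>' x - \<nu>' x) (\<lambda>x. \<eta>' x - \<nu>' x) \<le> N\<^sup>2)"

text \<open>
  The pointwise bounds on each cell are those of \<open>cell_estimates\<close>; they hold with one common layer function \<open>\<omega>\<close>, so the norms
  need no summation over cells. On the near cells \<open>max \<epsilon> q \<le> sqrt \<epsilon>\<close>, which is the factor gained by \<open>\<nu>\<close>.
\<close>

lemma interpolation_error:
  assumes k: "k \<ge> 1"
    and Cm: "Cm_on k {0..2} b" "Cm_on k {0..2} c" "Cm_on k {0..2} d" "Cm_on k {0..2} f" "Cm_on k {-1..0} \<Phi>"
  obtains K where "K \<ge> 0"
    "\<And>\<epsilon> H T U Y. \<lbrakk>0 < \<epsilon>; \<epsilon> < 1; 0 < H; H < 1; layer_mesh H \<epsilon> T; classical_solution \<epsilon> U Y\<rbrakk> \<Longrightarrow>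
       \<exists>\<eta>. (\<lambda>x. U x - \<eta> x) \<in> fe_space k T \<and> near_far_split \<epsilon> (K * H ^ k) \<eta>"
proof -
  obtain C where C: "C \<ge> 0" "\<And>\<epsilon> U Y a. \<lbrakk>0 < \<epsilon>; \<epsilon> < 1; classical_solution \<epsilon> U Y; a = 0 \<or> a = 1\<rbrakk> \<Longrightarrow> layer_derivatives k C \<epsilon> a U Y"
    using solution_derivative_bounds[OF Cm] by blast
  obtain D where D: "D \<ge> 0"
    "\<And>\<epsilon> H q t h. \<lbrakk>0 < \<epsilon>; \<epsilon> < 1; 0 < H; H < 1; 0 \<le> q; q \<le> 1; t \<le> q + h; 0 \<le> h; h \<le> 3 * H * max \<epsilon> q\<rbrakk> \<Longrightarrow>
      cell_estimates \<beta> k D \<epsilon> H q t h"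
    using layer_cell_bounds[OF \<beta>(1)] by blast
  define A where "A = 2 * C * D"
  have A: "A \<ge> 0" using C D by (simp add: A_def)
  \<comment> \<open>The square of \<open>s\<close> is the factor that \<open>ip_le_exp_layer\<close> produces for the rate \<open>\<beta> / 8\<close>.\<close>
  define s where "s = sqrt (4 + 16 / \<beta>)"
  have s2: "s\<^sup>2 = 4 + 16 / \<beta>" using \<beta> by (simp add: s_def)
  have s: "2 \<le> s" unfolding s_def using \<beta> by (intro real_le_rsqrt) auto
  show ?thesis
  proof (rule that[of "A * s"])
    show "A * s \<ge> 0" using A s by simp
    fix \<epsilon> H T U Y
    assume e: "0 < \<epsilon>" "\<epsilon> < (1::real)" and H: "0 < H" "H < (1::real)" and mesh: "layer_mesh H \<epsilon> T"
      and cs: "classical_solution \<epsilon> U Y"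
    note U = classical_solution_H01[OF cs]
    have T: "finite T" "0 \<in> T" "1 \<in> T" "2 \<in> T" "T \<subseteq> {0..2}" using mesh by (auto simp: layer_mesh_def)
    \<comment> \<open>The point to which the layer that is relevant for \<open>x\<close> is attached.\<close>
    define off where "off = (\<lambda>x::real. if x < 1 then 0 else 1 :: real)"
    define \<omega> where "\<omega> = (\<lambda>x. exp (- (\<beta> / 8) * (x - off x) / \<epsilon>))"
    have \<omega>: "0 \<le> \<omega> x" "\<omega> x \<le> 1" if "x \<in> \<Omega>" for x
      using that e \<beta> by (auto simp: \<omega>_def off_def zero_le_divide_iff)
    define N where "N = A * H ^ k"
    have N: "N \<ge> 0" using A H by (simp add: N_def)
    define good where "good = (\<lambda>l r (p :: real poly). degree p \<le> k \<and> poly p l = U l \<and> poly p r = U r \<and>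
        (\<forall>x\<in>{l<..<r}. \<bar>Y x - poly (pderiv p) x\<bar> \<le> N * (1 + 1 / \<epsilon> * \<omega> x)
          \<and> \<bar>U x - poly p x\<bar> \<le> N * (max \<epsilon> (l - off l) + 1 * \<omega> x)
          \<and> (sqrt \<epsilon> < l - off l \<longrightarrow> \<bar>Y x - poly (pderiv p) x\<bar> \<le> N * (1 + 0 * \<omega> x))))"
    have cell: "\<exists>p. good l r p" if c: "consecutive T l r" for l r
    proof -
      define a where "a = off l"
      have lr: "l < r" "l \<in> {0..2}" "r \<in> {0..2}" "1 \<notin> {l<..<r}" using c T by (auto simp: consecutive_def)
      have a: "a = 0 \<or> a = 1" "{l..r} \<subseteq> {a..a+1}" using lr by (auto simp: a_def off_def)
      have offx: "off x = a" if "x \<in> {l<..<r}" for x using that lr by (auto simp: a_def off_def)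
      have h: "r - l \<le> 3 * H * max \<epsilon> (l - a)" using mesh c by (auto simp: layer_mesh_def a_def off_def)
      obtain g where g: "g 0 = U" "g (Suc 0) = Y"
          "\<forall>i\<le>k. \<forall>x\<in>{a..a+1}. (g i has_real_derivative g (Suc i) x) (at x within {a..a+1})"
          "\<forall>x\<in>{a..a+1}. \<bar>g (Suc k) x\<bar> \<le> C * layer \<beta> \<epsilon> a (Suc k) x"
        using C(2)[OF e cs a(1)] unfolding layer_derivatives_def by blast
      define M where "M = C * layer \<beta> \<epsilon> a (Suc k) l"
      have gd: "(g i has_real_derivative g (Suc i) x) (at x within {l..r})" if "i \<le> k" "x \<in> {l..r}" for i x
        using g(3) that a(2) by (meson DERIV_subset subsetD)
      have gM: "\<bar>g (Suc k) x\<bar> \<le> M" if x: "x \<in> {l..r}" for x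
      proof -
        have "C * layer \<beta> \<epsilon> a (Suc k) x \<le> M" unfolding M_def
          using x C(1) \<beta>(1) e by (intro mult_left_mono layer_antimono) auto
        moreover have "x \<in> {a..a+1}" using x a(2) by blast
        ultimately show ?thesis using g(4) by (meson order_trans)
      qed
      obtain p :: "real poly" where p: "degree p \<le> k" "poly p l = g 0 l" "poly p r = g 0 r"
        "\<And>x. x \<in> {l..r} \<Longrightarrow> \<bar>poly p x - g 0 x\<bar> \<le> 2 * M * (r - l) ^ Suc k"
        "\<And>x. x \<in> {l..r} \<Longrightarrow> \<bar>poly (pderiv p) x - g 1 x\<bar> \<le> 2 * M * (r - l) ^ k"
        using taylor_interpolant[where g = g, OF lr(1) k gd gM] by blast
      have L: "layer \<beta> \<epsilon> a (Suc k) l = 1 + exp (- \<beta> * (l - a) / \<epsilon>) / \<epsilon> ^ Suc k" by (simp only: layer_def)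
      have q: "0 \<le> l - a" "l - a \<le> 1" using a(2) lr by auto
      have scale: "2 * M * z \<le> N * y" if "z * layer \<beta> \<epsilon> a (Suc k) l \<le> D * H ^ k * y" for z y
      proof -
        have "2 * C * (z * layer \<beta> \<epsilon> a (Suc k) l) \<le> 2 * C * (D * H ^ k * y)" using that C(1) by (intro mult_left_mono) auto
        then show ?thesis by (simp add: M_def N_def A_def mult_ac)
      qed
      have "\<bar>Y x - poly (pderiv p) x\<bar> \<le> N * (1 + 1 / \<epsilon> * \<omega> x)
          \<and> \<bar>U x - poly p x\<bar> \<le> N * (max \<epsilon> (l - off l) + 1 * \<omega> x)
          \<and> (sqrt \<epsilon> < l - off l \<longrightarrow> \<bar>Y x - poly (pderiv p) x\<bar> \<le> N * (1 + 0 * \<omega> x))" if x: "x \<in> {l<..<r}" for x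
      proof -
        have w: "\<omega> x = exp (- (\<beta> / 8) * (x - a) / \<epsilon>)" by (simp only: \<omega>_def offx[OF x])
        have "x - a \<le> (l - a) + (r - l)" "0 \<le> r - l" using x by auto
        note b = D(2)[OF e H q this h, unfolded cell_estimates_def, folded L w]
        have px: "\<bar>U x - poly p x\<bar> \<le> 2 * M * (r - l) ^ Suc k" "\<bar>Y x - poly (pderiv p) x\<bar> \<le> 2 * M * (r - l) ^ k"
          using p(4,5)[of x] x g(1,2) by (auto simp: abs_minus_commute)
        show ?thesis unfolding a_def[symmetric]
          using b px scale by (meson order_trans)
      qed
      then show ?thesis unfolding good_def using p(1-3) g(1) by (intro exI[of _ p]) simp
    qed
    define p where "p = (\<lambda>l r. SOME p. good l r p)"
    have "good l r (p l r)" if "consecutive T l r" for l r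
      unfolding p_def by (rule someI_ex[OF cell[OF that]])
    note P = this[unfolded good_def]
    define F F' where "F = (\<lambda>l r x. U x - poly (p l r) x)" and "F' = (\<lambda>l r x. Y x - poly (pderiv (p l r)) x)"
    \<comment> \<open>The near part of the interpolation error.\<close>
    define G G' where "G = (\<lambda>l r. if l - off l \<le> sqrt \<epsilon> then F l r else (\<lambda>_. 0))"
      and "G' = (\<lambda>l r. if l - off l \<le> sqrt \<epsilon> then F' l r else (\<lambda>_. 0))"
    have sub: "{l..r} \<subseteq> {0..2}" "{l<..<r} \<subseteq> \<Omega>" if "consecutive T l r" for l r
      using that T(5) unfolding consecutive_def by force+
    have Fc: "continuous_on {l..r} (F l r)" if "consecutive T l r" for l r
      unfolding F_def by (intro continuous_intros continuous_on_subset[OF U(3) sub(1)[OF that]])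
    have Fz: "F l r l = 0" "F l r r = 0" if "consecutive T l r" for l r using P[OF that] by (auto simp: F_def)
    have Fd: "(F l r has_real_derivative F' l r x) (at x)" if "consecutive T l r" "x \<in> {l<..<r}" for l r x
    proof -
      have x: "x \<in> \<Omega>" using sub(2)[OF that(1)] that(2) by blast
      then have "(U has_real_derivative Y x) (at x)"
        using cs by (intro DERIV_within_interior[of U "Y x" x 0 2]) (auto simp: classical_solution_def)
      then show ?thesis unfolding F_def F'_def by (auto intro!: derivative_intros)
    qed
    have Fi: "isCont (F' l r) x" if "consecutive T l r" "x \<in> {l<..<r}" for l r x
    proof -
      have x: "x \<in> \<Omega>" using sub(2)[OF that(1)] that(2) by blast
      have "isCont Y x" by (rule continuous_on_interior[OF U(4)]) (use x in auto)
      then show ?thesis unfolding F'_def by (intro continuous_intros)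
    qed
    have FB: "\<bar>F' l r x\<bar> \<le> N * (1 + 1 / \<epsilon>)" if c: "consecutive T l r" and x: "x \<in> {l<..<r}" for l r x
    proof -
      have "N * (1 + 1 / \<epsilon> * \<omega> x) \<le> N * (1 + 1 / \<epsilon> * 1)"
        using N e \<omega> x sub(2)[OF c] by (intro mult_left_mono add_left_mono) auto
      then show ?thesis using P[OF c] x by (force simp: F'_def)
    qed
    have NB: "0 \<le> N * (1 + 1 / \<epsilon>)" using N e by simp
    define \<eta> \<eta>' \<nu> \<nu>' where "\<eta> = glue T F" and "\<eta>' = glue T F'" and "\<nu> = glue T G" and "\<nu>' = glue T G'"
    have E: "has_weak_deriv \<Omega> \<eta> \<eta>'" "\<eta> \<in> H01 \<Omega>"
      unfolding \<eta>_def \<eta>'_def by (rule glue_H01[OF T(1,2,4,5) Fc Fz Fd Fi FB]; assumption)+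
    have V: "has_weak_deriv \<Omega> \<nu> \<nu>'" "\<nu> \<in> H01 \<Omega>"
    proof -
      have "continuous_on {l..r} (G l r)" "G l r l = 0" "G l r r = 0" if "consecutive T l r" for l r
        using Fc[OF that] Fz[OF that] by (auto simp: G_def)
      moreover have "(G l r has_real_derivative G' l r x) (at x)" "isCont (G' l r) x" "\<bar>G' l r x\<bar> \<le> N * (1 + 1 / \<epsilon>)"
        if "consecutive T l r" "x \<in> {l<..<r}" for l r x
        using Fd[OF that] Fi[OF that] FB[OF that] NB by (auto simp: G_def G'_def)
      ultimately show "has_weak_deriv \<Omega> \<nu> \<nu>'" "\<nu> \<in> H01 \<Omega>"
        unfolding \<nu>_def \<nu>'_def using glue_H01[OF T(1,2,4,5), of G G' "N * (1 + 1 / \<epsilon>)"] by blast+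
    qed
    have L2s: "\<eta>' \<in> L2 \<Omega>" "\<nu> \<in> L2 \<Omega>" "\<nu>' \<in> L2 \<Omega>" using E V by (auto simp: has_weak_deriv_def)
    have aeT: "AE x in lebesgue_on \<Omega>. x \<in> \<Omega> - T"
      using AE_not_finite[OF T(1), of \<Omega>] AE_space[of "lebesgue_on \<Omega>"] by (auto elim: eventually_elim2)
    have pt: "\<bar>\<eta> x\<bar> \<le> N * 2" "\<bar>\<eta>' x\<bar> \<le> N * (1 + 1 / \<epsilon> * \<omega> x)" "\<bar>\<nu> x\<bar> \<le> N * (sqrt \<epsilon> + 1 * \<omega> x)"
        "\<bar>\<eta>' x - \<nu>' x\<bar> \<le> N * (1 + 0 * \<omega> x)" if x: "x \<in> \<Omega> - T" for x
    proof -
      let ?l = "lo T x" and ?r = "hi T x"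
      have c: "consecutive T ?l ?r" "x \<in> {?l<..<?r}" using consecutive_lo_hi[OF T(1,2,4) x] by auto
      have eq: "\<eta> x = F ?l ?r x" "\<eta>' x = F' ?l ?r x" "\<nu> x = G ?l ?r x" "\<nu>' x = G' ?l ?r x"
        using x by (auto simp: \<eta>_def \<eta>'_def \<nu>_def \<nu>'_def glue_def)
      have b: "\<bar>F' ?l ?r x\<bar> \<le> N * (1 + 1 / \<epsilon> * \<omega> x)" "\<bar>F ?l ?r x\<bar> \<le> N * (max \<epsilon> (?l - off ?l) + 1 * \<omega> x)"
        "sqrt \<epsilon> < ?l - off ?l \<Longrightarrow> \<bar>F' ?l ?r x\<bar> \<le> N * (1 + 0 * \<omega> x)"
        using P[OF c(1)] c(2) by (auto simp: F_def F'_def)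
      have w: "0 \<le> \<omega> x" "\<omega> x \<le> 1" using \<omega> x by auto
      have se: "\<epsilon> \<le> sqrt \<epsilon>" "0 \<le> sqrt \<epsilon>" using e real_le_rsqrt[of \<epsilon> \<epsilon>] by (auto simp: power2_eq_square mult_le_one)
      have "?l - off ?l \<le> 1" using sub(1)[OF c(1)] c(2) by (auto simp: off_def)
      then have "N * (max \<epsilon> (?l - off ?l) + 1 * \<omega> x) \<le> N * 2" using N e w by (intro mult_left_mono) auto
      then show "\<bar>\<eta> x\<bar> \<le> N * 2" using b(2) eq by linarith
      show "\<bar>\<eta>' x\<bar> \<le> N * (1 + 1 / \<epsilon> * \<omega> x)" using b(1) eq by simp
      show "\<bar>\<nu> x\<bar> \<le> N * (sqrt \<epsilon> + 1 * \<omega> x)"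
      proof (cases "?l - off ?l \<le> sqrt \<epsilon>")
        case True
        then have "N * (max \<epsilon> (?l - off ?l) + 1 * \<omega> x) \<le> N * (sqrt \<epsilon> + 1 * \<omega> x)"
          using N se by (intro mult_left_mono) auto
        then show ?thesis using b(2) eq True by (simp add: G_def)
      next
        case False then show ?thesis using eq N w se by (simp add: G_def)
      qed
      show "\<bar>\<eta>' x - \<nu>' x\<bar> \<le> N * (1 + 0 * \<omega> x)" using b(3) eq N by (cases "?l - off ?l \<le> sqrt \<epsilon>") (auto simp: G'_def)
    qed
    have bound: "ip \<Omega> v v \<le> N\<^sup>2 * (4 * q1\<^sup>2 + 2 * q2\<^sup>2 * (\<epsilon> / (\<beta> / 8)))"
      if "v \<in> L2 \<Omega>" "0 \<le> q1" "0 \<le> q2" "\<And>x. x \<in> \<Omega> - T \<Longrightarrow> \<bar>v x\<bar> \<le> N * (q1 + q2 * \<omega> x)" for v q1 q2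
    proof (rule ip_le_exp_layer[OF _ e(1) that(1) N that(2,3)])
      show "AE x in lebesgue_on \<Omega>. \<bar>v x\<bar> \<le> N * (q1 + q2 * exp (- (\<beta> / 8) * (x - (if x < 1 then 0 else 1)) / \<epsilon>))"
        using aeT by eventually_elim (use that(4) in \<open>simp only: \<omega>_def off_def\<close>)
    qed (use \<beta> in simp)
    have Ns: "(A * s * H ^ k)\<^sup>2 = N\<^sup>2 * (4 + 16 / \<beta>)" unfolding s2[symmetric] by (simp add: N_def power_mult_distrib)
    have "\<bar>\<eta> x\<bar> \<le> A * s * H ^ k" if x: "x \<in> \<Omega>" for x
    proof (cases "x \<in> T")
      case True then show ?thesis using A s H by (simp add: \<eta>_def glue_def)
    next
      case False
      have "N * 2 \<le> N * s" using N s by (intro mult_left_mono)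
      then show ?thesis using pt(1)[of x] x False by (simp add: N_def mult_ac)
    qed
    moreover have "\<epsilon> * ip \<Omega> \<eta>' \<eta>' \<le> (A * s * H ^ k)\<^sup>2"
    proof -
      have "\<epsilon> * ip \<Omega> \<eta>' \<eta>' \<le> \<epsilon> * (N\<^sup>2 * (4 * 1\<^sup>2 + 2 * (1 / \<epsilon>)\<^sup>2 * (\<epsilon> / (\<beta> / 8))))"
        using e by (intro mult_left_mono bound L2s pt) auto
      also have "\<dots> = N\<^sup>2 * (4 * \<epsilon> + 16 / \<beta>)" using e \<beta> by (simp add: field_simps power2_eq_square)
      also have "\<dots> \<le> N\<^sup>2 * (4 + 16 / \<beta>)" using e by (intro mult_left_mono) auto
      finally show ?thesis by (simp only: Ns)
    qed
    moreover have "ip \<Omega> \<nu> \<nu> \<le> \<epsilon> * (A * s * H ^ k)\<^sup>2"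
    proof -
      have "ip \<Omega> \<nu> \<nu> \<le> N\<^sup>2 * (4 * (sqrt \<epsilon>)\<^sup>2 + 2 * 1\<^sup>2 * (\<epsilon> / (\<beta> / 8)))"
        using e by (intro bound L2s pt) auto
      also have "\<dots> = \<epsilon> * (N\<^sup>2 * (4 + 16 / \<beta>))" using e \<beta> by (simp add: field_simps)
      finally show ?thesis by (simp only: Ns)
    qed
    moreover have "ip \<Omega> (\<lambda>x. \<eta>' x - \<nu>' x) (\<lambda>x. \<eta>' x - \<nu>' x) \<le> (A * s * H ^ k)\<^sup>2"
    proof -
      have "ip \<Omega> (\<lambda>x. \<eta>' x - \<nu>' x) (\<lambda>x. \<eta>' x - \<nu>' x) \<le> N\<^sup>2 * (4 * 1\<^sup>2 + 2 * 0\<^sup>2 * (\<epsilon> / (\<beta> / 8)))"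
        by (intro bound L2_diff L2s pt) auto
      also have "\<dots> \<le> N\<^sup>2 * (4 + 16 / \<beta>)" using \<beta> by (intro mult_left_mono) auto
      finally show ?thesis by (simp only: Ns)
    qed
    moreover have "(\<lambda>x. U x - \<eta> x) \<in> fe_space k T"
    proof -
      have "\<exists>q :: real poly. degree q \<le> k \<and> (AE x in lebesgue_on \<tau>. U x - \<eta> x = poly q x)" if t: "\<tau> \<in> cells T" for \<tau>
      proof -
        obtain l r where lr: "\<tau> = {l<..<r}" "consecutive T l r" using t by (auto simp: cells_def consecutive_def)
        have "U x - \<eta> x = poly (p l r) x" if "x \<in> {l<..<r}" for x
          using glue_interior[OF T(1) lr(2) that, of F] by (simp add: \<eta>_def F_def)
        then show ?thesis using P[OF lr(2)] lr(1) by (intro exI[of _ "p l r"]) (auto intro!: AE_I2)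
      qed
      then show ?thesis using H01_diff[OF U(2) E(2)] by (simp add: fe_space_def)
    qed
    ultimately show "\<exists>\<eta>. (\<lambda>x. U x - \<eta> x) \<in> fe_space k T \<and> near_far_split \<epsilon> (A * s * H ^ k) \<eta>"
      using E V unfolding near_far_split_def by blast
  qed
qed

end

context convection_diffusion
begin

text \<open>
  The convective term is split as \<open>ip (b (\<eta>' - \<nu>')) \<xi> + ip (b \<nu>') \<xi>\<close>, and the second part is integrated by parts. Young's
  inequality moves a quarter of \<open>\<epsilon> \<parallel>\<xi>'\<parallel>\<^sup>2\<close> twice and a sixth of \<open>\<gamma> \<parallel>\<xi>\<parallel>\<^sup>2\<close> three times to the energy of \<open>\<xi>\<close>, in total one half
  of it, which coercivity can absorb.
\<close>

lemma near_far_estimate: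
  assumes Bb: "\<And>x. x \<in> {0..2} \<Longrightarrow> \<bar>b x\<bar> \<le> Bb" and Bb': "\<And>x. x \<in> {0..2} \<Longrightarrow> \<bar>b' x\<bar> \<le> Bb'"
    and Bc: "\<And>x. x \<in> {0..2} \<Longrightarrow> \<bar>c x\<bar> \<le> Bc" and Bd: "\<And>x. x \<in> {0..2} \<Longrightarrow> \<bar>d x\<bar> \<le> Bd"
    and e: "0 < \<epsilon>" "\<epsilon> < 1" and nf: "near_far_split \<epsilon> N \<eta>" and \<xi>: "\<xi> \<in> H01 \<Omega>"
  shows "bilin \<epsilon> b c d \<eta> \<xi> \<le> (\<epsilon> * ip \<Omega> (wderiv \<Omega> \<xi>) (wderiv \<Omega> \<xi>) + \<gamma> * ip \<Omega> \<xi> \<xi>) / 2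
    + (4 + 4 * Bb\<^sup>2 + 6 / \<gamma> * (2 * (Bc + Bd)\<^sup>2 + Bb\<^sup>2 + Bb'\<^sup>2)) * N\<^sup>2"
proof -
  let ?X = "wderiv \<Omega> \<xi>"
  obtain \<eta>' \<nu> \<nu>' where \<eta>: "\<eta> \<in> H01 \<Omega>" "has_weak_deriv \<Omega> \<eta> \<eta>'" and \<nu>: "\<nu> \<in> H01 \<Omega>" "has_weak_deriv \<Omega> \<nu> \<nu>'"
    and bd: "\<And>x. x \<in> \<Omega> \<Longrightarrow> \<bar>\<eta> x\<bar> \<le> N" "\<epsilon> * ip \<Omega> \<eta>' \<eta>' \<le> N\<^sup>2" "ip \<Omega> \<nu> \<nu> \<le> \<epsilon> * N\<^sup>2"
      "ip \<Omega> (\<lambda>x. \<eta>' x - \<nu>' x) (\<lambda>x. \<eta>' x - \<nu>' x) \<le> N\<^sup>2"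
    using nf unfolding near_far_split_def by blast
  \<comment> \<open>The form refers to the chosen weak derivatives \<open>E\<close> and \<open>V\<close>, which agree with \<open>\<eta>'\<close> and \<open>\<nu>'\<close> almost everywhere.\<close>
  define E V where "E = wderiv \<Omega> \<eta>" and "V = wderiv \<Omega> \<nu>"
  have L: "\<eta> \<in> L2 \<Omega>" "E \<in> L2 \<Omega>" "\<nu> \<in> L2 \<Omega>" "V \<in> L2 \<Omega>" "\<xi> \<in> L2 \<Omega>" "?X \<in> L2 \<Omega>" "\<eta>' \<in> L2 \<Omega>" "\<nu>' \<in> L2 \<Omega>"
    using H01_L2[OF \<eta>(1)] H01_L2[OF \<nu>(1)] H01_L2[OF \<xi>] \<eta>(2) \<nu>(2) by (auto simp: E_def V_def has_weak_deriv_def)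
  have EV: "ip \<Omega> E E = ip \<Omega> \<eta>' \<eta>'" "ip \<Omega> (\<lambda>x. E x - V x) (\<lambda>x. E x - V x) = ip \<Omega> (\<lambda>x. \<eta>' x - \<nu>' x) (\<lambda>x. \<eta>' x - \<nu>' x)"
  proof -
    have 1: "AE x in lebesgue_on \<Omega>. E x = \<eta>' x" "AE x in lebesgue_on \<Omega>. V x = \<nu>' x"
      unfolding E_def V_def by (rule wderiv_AE; fact)+
    show "ip \<Omega> E E = ip \<Omega> \<eta>' \<eta>'" by (intro ip_cong_AE 1 L)
    have "AE x in lebesgue_on \<Omega>. E x - V x = \<eta>' x - \<nu>' x" using 1 by eventually_elim simp
    then show "ip \<Omega> (\<lambda>x. E x - V x) (\<lambda>x. E x - V x) = ip \<Omega> (\<lambda>x. \<eta>' x - \<nu>' x) (\<lambda>x. \<eta>' x - \<nu>' x)"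
      by (intro ip_cong_AE L2_diff L) auto
  qed
  define w where "w = (\<lambda>x. c x * \<eta> x + d x * shifted (\<lambda>_. 0) \<eta> x)"
  have sL: "shifted (\<lambda>_. 0) \<eta> \<in> L2 \<Omega>" by (rule shifted_L2[OF L(1)]) simp
  have M: "w \<in> L2 \<Omega>" "(\<lambda>x. b x * E x) \<in> L2 \<Omega>" "(\<lambda>x. b x * V x) \<in> L2 \<Omega>" "(\<lambda>x. b x * (E x - V x)) \<in> L2 \<Omega>"
    "(\<lambda>x. b x * \<nu> x) \<in> L2 \<Omega>" "(\<lambda>x. b' x * \<nu> x) \<in> L2 \<Omega>"
    unfolding w_def by (intro L2_add L2_diff cont_mult_L2 cont b_cont L sL)+
  have "bilin \<epsilon> b c d \<eta> \<xi> = \<epsilon> * ip \<Omega> E ?X + ip \<Omega> (\<lambda>x. c x * \<eta> x - b x * E x + d x * shifted (\<lambda>_. 0) \<eta> x) \<xi>"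
    using bilin_shifted(2)[OF \<eta>(1) L(5)] by (simp only: E_def)
  also have "(\<lambda>x. c x * \<eta> x - b x * E x + d x * shifted (\<lambda>_. 0) \<eta> x) = (\<lambda>x. w x - (b x * (E x - V x) + b x * V x))"
    by (auto simp: w_def fun_eq_iff algebra_simps)
  also have "ip \<Omega> (\<lambda>x. w x - (b x * (E x - V x) + b x * V x)) \<xi>
      = ip \<Omega> w \<xi> - (ip \<Omega> (\<lambda>x. b x * (E x - V x)) \<xi> + ip \<Omega> (\<lambda>x. b x * V x) \<xi>)"
    by (simp only: ip_diff[OF M(1) L2_add[OF M(4,3)] L(5)] ip_add[OF M(4,3) L(5)])
  also have "ip \<Omega> (\<lambda>x. b x * V x) \<xi> = - ip \<Omega> (\<lambda>x. b' x * \<nu> x) \<xi> - ip \<Omega> (\<lambda>x. b x * \<nu> x) ?X"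
    using H01_integration_by_parts[OF b_deriv cont(1) _ \<nu>(1) \<xi>] by (simp add: V_def)
  finally have split: "bilin \<epsilon> b c d \<eta> \<xi> = \<epsilon> * ip \<Omega> E ?X + ip \<Omega> w \<xi> - ip \<Omega> (\<lambda>x. b x * (E x - V x)) \<xi>
      + ip \<Omega> (\<lambda>x. b' x * \<nu> x) \<xi> + ip \<Omega> (\<lambda>x. b x * \<nu> x) ?X" by simp
  have N0: "N\<^sup>2 \<ge> 0" by simp
  define X Z where "X = ip \<Omega> ?X ?X" and "Z = ip \<Omega> \<xi> \<xi>"
  \<comment> \<open>In the terms without \<open>\<xi>'\<close> the factor \<open>\<epsilon>\<close> gained by \<open>\<nu>\<close> can be given away.\<close>
  have \<nu>N: "ip \<Omega> \<nu> \<nu> \<le> N\<^sup>2" using bd(3) e N0 mult_right_mono[of \<epsilon> 1 "N\<^sup>2"] by linarith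
  have 1: "\<epsilon> * ip \<Omega> E ?X \<le> 4 * N\<^sup>2 + \<epsilon> * X / 4"
  proof -
    have "\<bar>ip \<Omega> E ?X\<bar> \<le> 4 * ip \<Omega> E E + X / 4" unfolding X_def by (rule ip_bound) (use L in auto)
    then have "\<epsilon> * ip \<Omega> E ?X \<le> \<epsilon> * (4 * ip \<Omega> E E + X / 4)" using e by (intro mult_left_mono) auto
    also have "\<dots> = 4 * (\<epsilon> * ip \<Omega> E E) + \<epsilon> * X / 4" by (simp add: algebra_simps)
    finally show ?thesis using bd(2) EV(1) by simp
  qed
  have 2: "ip \<Omega> (\<lambda>x. b x * \<nu> x) ?X \<le> 4 * Bb\<^sup>2 * N\<^sup>2 + \<epsilon> * X / 4"
  proof -
    have "\<bar>ip \<Omega> (\<lambda>x. b x * \<nu> x) ?X\<bar> \<le> 4 / \<epsilon> * ip \<Omega> (\<lambda>x. b x * \<nu> x) (\<lambda>x. b x * \<nu> x) + X / (4 / \<epsilon>)"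
      unfolding X_def by (rule ip_bound) (use L M e in auto)
    also have "4 / \<epsilon> * ip \<Omega> (\<lambda>x. b x * \<nu> x) (\<lambda>x. b x * \<nu> x) \<le> 4 / \<epsilon> * (Bb\<^sup>2 * (\<epsilon> * N\<^sup>2))"
      using e by (intro mult_left_mono order_trans[OF ip_mult_le[OF b_cont Bb L(3)]] bd(3)) auto
    also have "4 / \<epsilon> * (Bb\<^sup>2 * (\<epsilon> * N\<^sup>2)) = 4 * Bb\<^sup>2 * N\<^sup>2" using e by simp
    also have "X / (4 / \<epsilon>) = \<epsilon> * X / 4" by simp
    finally show ?thesis by linarith
  qed
  have young: "\<bar>ip \<Omega> v \<xi>\<bar> \<le> 6 / \<gamma> * B + \<gamma> * Z / 6" if "v \<in> L2 \<Omega>" "ip \<Omega> v v \<le> B" for v B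
  proof -
    have "\<bar>ip \<Omega> v \<xi>\<bar> \<le> 6 / \<gamma> * ip \<Omega> v v + Z / (6 / \<gamma>)"
      unfolding Z_def by (rule ip_bound) (use L that \<gamma> in auto)
    also have "6 / \<gamma> * ip \<Omega> v v \<le> 6 / \<gamma> * B" using that \<gamma> by (intro mult_left_mono) auto
    finally show ?thesis by (simp add: mult.commute)
  qed
  have 3: "\<bar>ip \<Omega> w \<xi>\<bar> \<le> 6 / \<gamma> * (2 * (Bc + Bd)\<^sup>2 * N\<^sup>2) + \<gamma> * Z / 6"
  proof (rule young[OF M(1)])
    have "ip \<Omega> w w \<le> (LINT x|lebesgue_on \<Omega>. (Bc + Bd)\<^sup>2 * N\<^sup>2)"
    proof (rule ip_mono_bound[OF M(1) integrable_const_interval])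
      have "AE x in lebesgue_on \<Omega>. x \<in> \<Omega> - {1}"
        using AE_not_finite[of "{1}" \<Omega>] AE_space[of "lebesgue_on \<Omega>"] by (auto elim: eventually_elim2)
      then show "AE x in lebesgue_on \<Omega>. (w x)\<^sup>2 \<le> (Bc + Bd)\<^sup>2 * N\<^sup>2"
      proof eventually_elim
        case (elim x)
        have Nn: "0 \<le> N" using bd(1)[of x] elim by (auto intro: order_trans[OF abs_ge_zero])
        have x: "x \<in> {0..2}" using elim by auto
        have "\<bar>shifted (\<lambda>_. 0) \<eta> x\<bar> \<le> N" using bd(1)[of "x - 1"] elim Nn by auto
        then have "\<bar>c x\<bar> * \<bar>\<eta> x\<bar> + \<bar>d x\<bar> * \<bar>shifted (\<lambda>_. 0) \<eta> x\<bar> \<le> Bc * N + Bd * N"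
          using bd(1)[of x] elim Bc[OF x] Bd[OF x] by (intro add_mono mult_mono) (auto intro: order_trans[OF abs_ge_zero])
        then have "\<bar>w x\<bar> \<le> (Bc + Bd) * N"
          unfolding w_def abs_mult[symmetric] distrib_right by linarith
        then have "\<bar>w x\<bar>\<^sup>2 \<le> ((Bc + Bd) * N)\<^sup>2" by (intro power_mono) auto
        then show ?case by (simp add: power_mult_distrib)
      qed
    qed
    also have "\<dots> = 2 * (Bc + Bd)\<^sup>2 * N\<^sup>2" by (simp only: LINT_eq_integral(1)[OF integrable_const_interval]) simp
    finally show "ip \<Omega> w w \<le> 2 * (Bc + Bd)\<^sup>2 * N\<^sup>2" .
  qed
  have 4: "\<bar>ip \<Omega> (\<lambda>x. b x * (E x - V x)) \<xi>\<bar> \<le> 6 / \<gamma> * (Bb\<^sup>2 * N\<^sup>2) + \<gamma> * Z / 6"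
    by (rule young[OF M(4) order_trans[OF ip_mult_le[OF b_cont Bb L2_diff[OF L(2,4)]]]])
      (use bd(4) EV(2) in \<open>auto intro: mult_left_mono\<close>)
  have 5: "\<bar>ip \<Omega> (\<lambda>x. b' x * \<nu> x) \<xi>\<bar> \<le> 6 / \<gamma> * (Bb'\<^sup>2 * N\<^sup>2) + \<gamma> * Z / 6"
    by (rule young[OF M(6) order_trans[OF ip_mult_le[OF cont(1) Bb' L(3)]]]) (use \<nu>N in \<open>auto intro: mult_left_mono\<close>)
  have "bilin \<epsilon> b c d \<eta> \<xi> \<le> (4 * N\<^sup>2 + \<epsilon> * X / 4) + (6 / \<gamma> * (2 * (Bc + Bd)\<^sup>2 * N\<^sup>2) + \<gamma> * Z / 6)
     + (6 / \<gamma> * (Bb\<^sup>2 * N\<^sup>2) + \<gamma> * Z / 6) + (6 / \<gamma> * (Bb'\<^sup>2 * N\<^sup>2) + \<gamma> * Z / 6) + (4 * Bb\<^sup>2 * N\<^sup>2 + \<epsilon> * X / 4)"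
    using 1 2 3 4 5 unfolding split by linarith
  also have "\<dots> = (\<epsilon> * X + \<gamma> * Z) / 2 + (4 + 4 * Bb\<^sup>2 + 6 / \<gamma> * (2 * (Bc + Bd)\<^sup>2 + Bb\<^sup>2 + Bb'\<^sup>2)) * N\<^sup>2"
  proof -
    have "(4 * n + x / 4) + (g * (2 * p * n) + z / 6) + (g * (q * n) + z / 6) + (g * (r * n) + z / 6) + (4 * q * n + x / 4)
        = (x + z) / 2 + (4 + 4 * q + g * (2 * p + q + r)) * n" for n x z g p q r :: real
      by (simp add: algebra_simps)
    then show ?thesis .
  qed
  finally show ?thesis by (simp only: X_def Z_def)
qed

text \<open>
  The discrete error is \<open>\<xi> = uN - (U - \<eta>)\<close>. Galerkin orthogonality gives \<open>B(\<xi>,\<xi>) = B(\<eta>,\<xi>)\<close>, and the full error is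
  \<open>\<eta> - \<xi>\<close>.
\<close>

lemma galerkin_error:
  assumes k: "k \<ge> 1"
    and Cm: "Cm_on k {0..2} b" "Cm_on k {0..2} c" "Cm_on k {0..2} d" "Cm_on k {0..2} f" "Cm_on k {-1..0} \<Phi>"
  obtains C where "C > 0"
    "\<And>\<epsilon> H T u uN. \<lbrakk>0 < \<epsilon>; \<epsilon> < 1; 0 < H; H < 1; layer_mesh H \<epsilon> T; bvp_solution \<epsilon> b c d f \<Phi> u;
       fe_solution k T \<epsilon> b c d f \<Phi> uN\<rbrakk> \<Longrightarrow> energy_norm \<epsilon> \<gamma> (\<lambda>x. u x - uN x) \<le> C * H ^ k"
proof -
  obtain K where K: "K \<ge> 0"
    "\<And>\<epsilon> H T U Y. \<lbrakk>0 < \<epsilon>; \<epsilon> < 1; 0 < H; H < 1; layer_mesh H \<epsilon> T; classical_solution \<epsilon> U Y\<rbrakk> \<Longrightarrow>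
       \<exists>\<eta>. (\<lambda>x. U x - \<eta> x) \<in> fe_space k T \<and> near_far_split \<epsilon> (K * H ^ k) \<eta>"
    by (rule interpolation_error[OF k Cm]) (rule that)
  obtain Bb where Bb: "\<And>x. x \<in> {0..2} \<Longrightarrow> \<bar>b x\<bar> \<le> Bb" using continuous_Icc_bound[OF b_cont] by blast
  obtain Bb' where Bb': "\<And>x. x \<in> {0..2} \<Longrightarrow> \<bar>b' x\<bar> \<le> Bb'" using continuous_Icc_bound[OF cont(1)] by blast
  obtain Bc where Bc: "\<And>x. x \<in> {0..2} \<Longrightarrow> \<bar>c x\<bar> \<le> Bc" using continuous_Icc_bound[OF cont(2)] by blast
  obtain Bd where Bd: "\<And>x. x \<in> {0..2} \<Longrightarrow> \<bar>d x\<bar> \<le> Bd" using continuous_Icc_bound[OF cont(3)] by blast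
  define Q where "Q = 4 + 4 * Bb\<^sup>2 + 6 / \<gamma> * (2 * (Bc + Bd)\<^sup>2 + Bb\<^sup>2 + Bb'\<^sup>2)"
  have Q: "Q \<ge> 0" using \<gamma> by (simp add: Q_def)
  define R where "R = 2 * (1 + 2 * \<gamma>) + 4 * Q"
  have R: "R \<ge> 0" using Q \<gamma> by (simp add: R_def)
  show ?thesis
  proof (rule that[of "sqrt R * K + 1"])
    show "sqrt R * K + 1 > 0" using R K(1) by (intro add_nonneg_pos mult_nonneg_nonneg) auto
    fix \<epsilon> H T u uN
    assume e: "0 < \<epsilon>" "\<epsilon> < (1::real)" and H: "0 < H" "H < (1::real)" and mesh: "layer_mesh H \<epsilon> T"
      and bvp: "bvp_solution \<epsilon> b c d f \<Phi> u" and fe: "fe_solution k T \<epsilon> b c d f \<Phi> uN"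
    obtain U Y where cs: "classical_solution \<epsilon> U Y" and ae: "AE x in lebesgue_on \<Omega>. u x = U x"
      using bvp_solution_classical[OF e(1) bvp] by blast
    \<comment> \<open>The order of convergence enters only through \<open>N\<close>.\<close>
    define N where "N = K * H ^ k"
    have N: "N \<ge> 0" using K(1) H by (simp add: N_def)
    obtain \<eta> where i: "(\<lambda>x. U x - \<eta> x) \<in> fe_space k T" and nf: "near_far_split \<epsilon> N \<eta>"
      using K(2)[OF e H mesh cs] unfolding N_def by blast
    obtain \<eta>' where \<eta>: "\<eta> \<in> H01 \<Omega>" "has_weak_deriv \<Omega> \<eta> \<eta>'" "\<forall>x\<in>\<Omega>. \<bar>\<eta> x\<bar> \<le> N" "\<epsilon> * ip \<Omega> \<eta>' \<eta>' \<le> N\<^sup>2"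
      using nf unfolding near_far_split_def by blast
    note U = classical_solution_H01[OF cs]
    have u: "u \<in> H01 \<Omega>" using bvp by (simp add: bvp_solution_def)
    have uN: "uN \<in> fe_space k T" "uN \<in> H01 \<Omega>" using fe by (auto simp: fe_solution_def fe_space_def)
    define I where "I = (\<lambda>x. U x - \<eta> x)"
    have IH: "I \<in> H01 \<Omega>" unfolding I_def by (rule H01_diff[OF U(2) \<eta>(1)]) simp
    define \<xi> where "\<xi> = (\<lambda>x. uN x - I x)"
    have \<xi>: "\<xi> \<in> fe_space k T" unfolding \<xi>_def I_def by (rule fe_space_diff[OF uN(1) i])
    have \<xi>H: "\<xi> \<in> H01 \<Omega>" using \<xi> by (simp add: fe_space_def)
    have "bilin \<epsilon> b c d \<xi> \<xi> = bilin \<epsilon> b c d uN \<xi> - (bilin \<epsilon> b c d U \<xi> - bilin \<epsilon> b c d \<eta> \<xi>)"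
      using bilin_diff_left[OF uN(2) IH \<xi>H, of \<epsilon>] bilin_diff_left[OF U(2) \<eta>(1) \<xi>H, of \<epsilon>] by (simp add: \<xi>_def I_def)
    moreover have "bilin \<epsilon> b c d uN \<xi> = rhs d f \<Phi> \<xi>" using fe \<xi> by (simp add: fe_solution_def)
    moreover have "bilin \<epsilon> b c d U \<xi> = rhs d f \<Phi> \<xi>"
      using classical_solution_weak[OF cs e(1)] \<xi>H by (simp add: weak_solution_def)
    ultimately have orth: "bilin \<epsilon> b c d \<xi> \<xi> = bilin \<epsilon> b c d \<eta> \<xi>" by simp
    let ?X = "wderiv \<Omega> \<xi>"
    have "\<epsilon> * ip \<Omega> ?X ?X + \<gamma> * ip \<Omega> \<xi> \<xi> \<le> bilin \<epsilon> b c d \<eta> \<xi>"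
      using coercive[OF \<xi>H, of \<epsilon>] orth by simp
    also have "\<dots> \<le> (\<epsilon> * ip \<Omega> ?X ?X + \<gamma> * ip \<Omega> \<xi> \<xi>) / 2 + Q * N\<^sup>2"
      unfolding Q_def by (rule near_far_estimate[OF Bb Bb' Bc Bd e nf \<xi>H])
    finally have "\<epsilon> * ip \<Omega> ?X ?X + \<gamma> * ip \<Omega> \<xi> \<xi> \<le> (\<epsilon> * ip \<Omega> ?X ?X + \<gamma> * ip \<Omega> \<xi> \<xi>) / 2 + Q * N\<^sup>2" .
    moreover have "t \<le> t / 2 + q \<Longrightarrow> t \<le> 2 * q" for t q :: real by simp
    ultimately have disc: "\<epsilon> * ip \<Omega> ?X ?X + \<gamma> * ip \<Omega> \<xi> \<xi> \<le> 2 * (Q * N\<^sup>2)" by blast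
    have L: "\<eta> \<in> L2 \<Omega>" "\<eta>' \<in> L2 \<Omega>" "\<xi> \<in> L2 \<Omega>" "?X \<in> L2 \<Omega>" "U \<in> L2 \<Omega>" "uN \<in> L2 \<Omega>" "u \<in> L2 \<Omega>"
      using \<eta>(2) H01_L2[OF \<xi>H] H01_L2[OF U(2)] H01_L2[OF uN(2)] H01_L2[OF u] by (auto simp: has_weak_deriv_def)
    have \<eta>N: "ip \<Omega> \<eta> \<eta> \<le> 2 * N\<^sup>2"
    proof -
      have "ip \<Omega> \<eta> \<eta> \<le> (LINT x|lebesgue_on \<Omega>. N\<^sup>2)"
      proof (rule ip_mono_bound[OF L(1) integrable_const_interval AE_I2])
        fix x assume "x \<in> space (lebesgue_on \<Omega>)"
        then have "\<bar>\<eta> x\<bar>\<^sup>2 \<le> N\<^sup>2" using \<eta>(3) by (intro power_mono) auto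
        then show "(\<eta> x)\<^sup>2 \<le> N\<^sup>2" by simp
      qed
      then show ?thesis by (simp only: LINT_eq_integral(1)[OF integrable_const_interval]) simp
    qed
    have wd0: "has_weak_deriv \<Omega> (\<lambda>x. \<eta> x - \<xi> x) (\<lambda>x. \<eta>' x - ?X x)"
      by (rule has_weak_deriv_diff[OF \<eta>(2) H01_weak_deriv[OF \<xi>H]]) auto
    have err: "AE x in lebesgue_on \<Omega>. \<eta> x - \<xi> x = u x - uN x"
      using ae by eventually_elim (simp add: \<xi>_def I_def)
    note L' = L2_diff[OF L(7,6)] L2_diff[OF L(1,3)]
    have wd: "has_weak_deriv \<Omega> (\<lambda>x. u x - uN x) (\<lambda>x. \<eta>' x - ?X x)"
      by (rule has_weak_deriv_cong_AE[OF wd0 L'(1) err])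
    have "ip \<Omega> (\<lambda>x. u x - uN x) (\<lambda>x. u x - uN x) = ip \<Omega> (\<lambda>x. \<eta> x - \<xi> x) (\<lambda>x. \<eta> x - \<xi> x)"
      by (rule ip_cong_AE[OF err err L'(2,2,1,1), symmetric])
    also have "\<dots> \<le> 2 * ip \<Omega> \<eta> \<eta> + 2 * ip \<Omega> \<xi> \<xi>" by (rule ip_diff_self_le[OF L(1,3)])
    finally have 1: "\<gamma> * ip \<Omega> (\<lambda>x. u x - uN x) (\<lambda>x. u x - uN x) \<le> \<gamma> * (2 * ip \<Omega> \<eta> \<eta> + 2 * ip \<Omega> \<xi> \<xi>)"
      using \<gamma>(1) by (intro mult_left_mono) auto
    have 2: "\<epsilon> * ip \<Omega> (\<lambda>x. \<eta>' x - ?X x) (\<lambda>x. \<eta>' x - ?X x) \<le> \<epsilon> * (2 * ip \<Omega> \<eta>' \<eta>' + 2 * ip \<Omega> ?X ?X)"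
      using e by (intro mult_left_mono ip_diff_self_le L) auto
    have 3: "\<gamma> * ip \<Omega> \<eta> \<eta> \<le> \<gamma> * (2 * N\<^sup>2)" using \<gamma>(1) \<eta>N by (intro mult_left_mono) auto
    have collect: "p + q \<le> R * n" if "q \<le> \<gamma> * (2 * h + 2 * z)" "p \<le> \<epsilon> * (2 * h' + 2 * x)" "\<gamma> * h \<le> \<gamma> * (2 * n)"
      "\<epsilon> * h' \<le> n" "\<epsilon> * x + \<gamma> * z \<le> 2 * (Q * n)" for p q h h' x z n :: real
      using that by (simp add: R_def algebra_simps)
    have "\<epsilon> * ip \<Omega> (\<lambda>x. \<eta>' x - ?X x) (\<lambda>x. \<eta>' x - ?X x)
        + \<gamma> * ip \<Omega> (\<lambda>x. u x - uN x) (\<lambda>x. u x - uN x) \<le> R * N\<^sup>2"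
      by (rule collect[OF 1 2 3 \<eta>(4) disc])
    then have "energy_norm \<epsilon> \<gamma> (\<lambda>x. u x - uN x) \<le> sqrt (R * N\<^sup>2)"
      unfolding energy_norm_eq[OF wd] by (rule real_sqrt_le_mono)
    also have "\<dots> = sqrt R * K * H ^ k" using N by (simp add: real_sqrt_mult N_def)
    also have "\<dots> \<le> (sqrt R * K + 1) * H ^ k" using H by (simp add: distrib_right)
    finally show "energy_norm \<epsilon> \<gamma> (\<lambda>x. u x - uN x) \<le> (sqrt R * K + 1) * H ^ k" .
  qed
qed

end

theorem theorem3p2:
  fixes k :: nat
  assumes "k \<ge> 1"
  shows "\<exists>m. \<forall>(\<beta>::real) (\<gamma>::real) (b::real \<Rightarrow> real) (c::real \<Rightarrow> real) (d::real \<Rightarrow> real)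
            (f::real \<Rightarrow> real) (\<Phi>::real \<Rightarrow> real).
           admissible_data m \<beta> \<gamma> b c d f \<Phi> \<longrightarrow>
           (\<exists>C>0. \<forall>\<epsilon>\<in>{0<..<1}. \<forall>H\<in>{0<..<1}. \<forall>T\<in>duran_meshes H \<epsilon>. \<forall>u uN.
              bvp_solution \<epsilon> b c d f \<Phi> u \<longrightarrow> fe_solution k T \<epsilon> b c d f \<Phi> uN \<longrightarrow>
              energy_norm \<epsilon> \<gamma> (\<lambda>x. u x - uN x) \<le> C * H ^ k)"
proof (intro exI[of _ "Suc k"] allI impI)
  fix \<beta> \<gamma> :: real and b c d f \<Phi> :: "real \<Rightarrow> real"
  assume "admissible_data (Suc k) \<beta> \<gamma> b c d f \<Phi>"
  note data = this[unfolded admissible_data_def]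
  have Cm: "Cm_on (Suc k) {0..2} b" "Cm_on (Suc k) {0..2} c" "Cm_on (Suc k) {0..2} d" "Cm_on (Suc k) {0..2} f"
    "Cm_on (Suc k) {-1..0} \<Phi>" using data by auto
  obtain b' where b': "\<And>x. x \<in> {0..2} \<Longrightarrow> (b has_real_derivative b' x) (at x within {0..2})" "Cm_on k {0..2} b'"
    using Cm_on_Suc[OF Cm(1)] by blast
  have vd: "vector_derivative b (at x within {0..2}) = b' x" if "x \<in> {0..2}" for x
    using b'(1)[OF that] that
    by (intro vector_derivative_within_closed_interval) (auto simp: has_real_derivative_iff_has_vector_derivative)
  interpret convection_diffusion \<beta> \<gamma> b b' c d f \<Phi>
  proof unfold_locales
    show "continuous_on {0..2} b'" "continuous_on {0..2} c" "continuous_on {0..2} d" "continuous_on {0..2} f"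
      "continuous_on {-1..0} \<Phi>" using Cm b'(2) by (auto intro: Cm_on_continuous)
    show "\<gamma> \<le> c x + b' x / 2 - Linf_norm {1<..<2} d / 2" if "x \<in> {0..2}" for x
      using data that vd[OF that] by force
  qed (use data b' in auto)
  have "Cm_on k {0..2} b" "Cm_on k {0..2} c" "Cm_on k {0..2} d" "Cm_on k {0..2} f" "Cm_on k {-1..0} \<Phi>"
    using Cm by (auto intro: Cm_on_mono)
  then obtain C where C: "C > 0"
    "\<And>\<epsilon> H T u uN. \<lbrakk>0 < \<epsilon>; \<epsilon> < 1; 0 < H; H < 1; layer_mesh H \<epsilon> T; bvp_solution \<epsilon> b c d f \<Phi> u;
       fe_solution k T \<epsilon> b c d f \<Phi> uN\<rbrakk> \<Longrightarrow> energy_norm \<epsilon> \<gamma> (\<lambda>x. u x - uN x) \<le> C * H ^ k"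
    by (rule galerkin_error[OF assms]) (rule that)
  show "\<exists>C>0. \<forall>\<epsilon>\<in>{0<..<1}. \<forall>H\<in>{0<..<1}. \<forall>T\<in>duran_meshes H \<epsilon>. \<forall>u uN.
      bvp_solution \<epsilon> b c d f \<Phi> u \<longrightarrow> fe_solution k T \<epsilon> b c d f \<Phi> uN \<longrightarrow>
      energy_norm \<epsilon> \<gamma> (\<lambda>x. u x - uN x) \<le> C * H ^ k"
    using C(1) by (intro exI[of _ C] conjI ballI allI impI C(2) duran_mesh_layer_mesh) auto
qed

end
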